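(* Let $(X,\sigma_X)$ and $(Y,\sigma_Y)$ be non-trivial mixing sofic shifts, and suppose there is a group isomorphism $\Psi\colon\mathrm{Aut}^{(\infty)}(\sigma_X)\to\mathrm{Aut}^{(\infty)}(\sigma_Y)$. Then $$\frac{h_{top}(\sigma_X)}{h_{top}(\sigma_Y)}\in\mathbb{Q}.$$
   Context: A subshift $(X,\sigma_X)$ is a nonempty closed shift-invariant subset $X\subset\mathcal{A}^{\mathbb{Z}}$ ($\mathcal{A}$ a finite alphabet) with $\sigma_X$ the restriction of the left shift. A sofic shift is a subshift that is a topological factor of a shift of finite type (equivalently, the set of label sequences of bi-infinite walks on a finite labeled directed graph). A subshift is mixing if for all words $u,v$ in its language there is $M$ such that for all $m\ge M$ there is a word $w$ of length $m$ with $uwv$ in the language. A mixing sofic shift is trivial if it consists of only one finite orbit. $h_{top}$ denotes topological entropy. For a homeomorphism $T$ of a compact metric space $X$, $\mathrm{Aut}(T)$ is the group of homeomorphisms of $X$ commuting with $T$, and the stabilized automorphism group is $\mathrm{Aut}^{(\infty)}(T)=\bigcup_{n\ge1}\mathrm{Aut}(T^n)$, a subgroup of $\mathrm{Homeo}(X)$. *)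

theory Defs
  imports "HOL-Analysis.Analysis" "HOL-Algebra.Bij"
begin

definition open_cover_of :: "'x topology \<Rightarrow> 'x set set \<Rightarrow> bool" where
  "open_cover_of X \<U> \<longleftrightarrow> (\<forall>U\<in>\<U>. openin X U) \<and> \<Union>\<U> = topspace X"

text \<open>On a compact space every open cover has a finite subcover, so the minimum exists.\<close>

definition min_subcover_card :: "'x topology \<Rightarrow> 'x set set \<Rightarrow> nat" where
  "min_subcover_card X \<U> =
     (LEAST k. \<exists>\<V>\<subseteq>\<U>. finite \<V> \<and> card \<V> = k \<and> \<Union>\<V> = topspace X)"

text \<open>The common refinement of the covers \<open>T\<^sup>-\<^sup>i \<U>\<close> for \<open>0 \<le> i < n\<close>.\<close>

definition cover_join :: "'x topology \<Rightarrow> ('x \<Rightarrow> 'x) \<Rightarrow> 'x set set \<Rightarrow> nat \<Rightarrow> 'x set set" where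
  "cover_join X T \<U> n =
     {{x \<in> topspace X. \<forall>i<n. (T ^^ i) x \<in> C i} | C. \<forall>i<n. C i \<in> \<U>}"

text \<open>The limit of the sequence below exists by subadditivity; taking \<open>limsup\<close>
  only avoids building its existence into the definition.\<close>

definition cover_entropy :: "'x topology \<Rightarrow> ('x \<Rightarrow> 'x) \<Rightarrow> 'x set set \<Rightarrow> ereal" where
  "cover_entropy X T \<U> =
     limsup (\<lambda>n. ereal (ln (real (min_subcover_card X (cover_join X T \<U> n))) / real n))"

definition topological_entropy :: "'x topology \<Rightarrow> ('x \<Rightarrow> 'x) \<Rightarrow> ereal" where
  "topological_entropy X T = (SUP \<U>\<in>{\<U>. open_cover_of X \<U>}. cover_entropy X T \<U>)"

text \<open>A self-homeomorphism of \<open>X\<close> is represented by its extensional representative in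
  \<^const>\<open>Bij\<close>, so that equality of group elements is equality of maps on \<open>topspace X\<close>.\<close>

definition Homeo :: "'x topology \<Rightarrow> ('x \<Rightarrow> 'x) set" where
  "Homeo X = {f \<in> Bij (topspace X). homeomorphic_map X X f}"

definition Aut :: "'x topology \<Rightarrow> ('x \<Rightarrow> 'x) \<Rightarrow> ('x \<Rightarrow> 'x) set" where
  "Aut X T = {f \<in> Homeo X. \<forall>x\<in>topspace X. f (T x) = T (f x)}"

definition stabilized_Aut :: "'x topology \<Rightarrow> ('x \<Rightarrow> 'x) \<Rightarrow> ('x \<Rightarrow> 'x) monoid" where
  "stabilized_Aut X T = (BijGroup (topspace X)) \<lparr>carrier := (\<Union>n\<in>{1..}. Aut X (T ^^ n))\<rparr>"

definition shift :: "(int \<Rightarrow> 'a) \<Rightarrow> int \<Rightarrow> 'a" where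
  "shift x = (\<lambda>i. x (i + 1))"

definition full_shift_topology :: "'a set \<Rightarrow> (int \<Rightarrow> 'a) topology" where
  "full_shift_topology A = product_topology (\<lambda>_. discrete_topology A) UNIV"

definition shift_topology :: "'a set \<Rightarrow> (int \<Rightarrow> 'a) set \<Rightarrow> (int \<Rightarrow> 'a) topology" where
  "shift_topology A X = subtopology (full_shift_topology A) X"

definition subshift :: "'a set \<Rightarrow> (int \<Rightarrow> 'a) set \<Rightarrow> bool" where
  "subshift A X \<longleftrightarrow>
     finite A \<and> X \<noteq> {} \<and> closedin (full_shift_topology A) X \<and> shift ` X = X"

definition occurs_in :: "'a list \<Rightarrow> (int \<Rightarrow> 'a) \<Rightarrow> bool" where
  "occurs_in w x \<longleftrightarrow> (\<exists>i. \<forall>k<length w. x (i + int k) = w ! k)"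

definition language :: "(int \<Rightarrow> 'a) set \<Rightarrow> 'a list set" where
  "language X = {w. \<exists>x\<in>X. occurs_in w x}"

definition shift_of_finite_type :: "'a set \<Rightarrow> (int \<Rightarrow> 'a) set \<Rightarrow> bool" where
  "shift_of_finite_type A X \<longleftrightarrow> subshift A X \<and>
     (\<exists>F. finite F \<and> X = {x. (\<forall>i. x i \<in> A) \<and> (\<forall>w\<in>F. \<not> occurs_in w x)})"

definition factor_map ::
    "'b set \<Rightarrow> (int \<Rightarrow> 'b) set \<Rightarrow> 'a set \<Rightarrow> (int \<Rightarrow> 'a) set
      \<Rightarrow> ((int \<Rightarrow> 'b) \<Rightarrow> (int \<Rightarrow> 'a)) \<Rightarrow> bool" where
  "factor_map B Z A X \<pi> \<longleftrightarrow>
     continuous_map (shift_topology B Z) (shift_topology A X) \<pi> \<and> \<pi> ` Z = X \<and>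
     (\<forall>z\<in>Z. \<pi> (shift z) = shift (\<pi> z))"

text \<open>Taking the alphabet of the covering shift of finite type to be a finite set of natural
  numbers is no restriction, since any finite alphabet can be renamed; it avoids quantifying
  over types.\<close>

definition sofic_shift :: "'a set \<Rightarrow> (int \<Rightarrow> 'a) set \<Rightarrow> bool" where
  "sofic_shift A X \<longleftrightarrow> subshift A X \<and>
     (\<exists>(B :: nat set) Z \<pi>. shift_of_finite_type B Z \<and> factor_map B Z A X \<pi>)"

definition mixing :: "(int \<Rightarrow> 'a) set \<Rightarrow> bool" where
  "mixing X \<longleftrightarrow> (\<forall>u\<in>language X. \<forall>v\<in>language X. \<exists>M. \<forall>m\<ge>M. \<exists>w.
     length w = m \<and> u @ w @ v \<in> language X)"

definition shift_orbit :: "(int \<Rightarrow> 'a) \<Rightarrow> (int \<Rightarrow> 'a) set" where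
  "shift_orbit x = range (\<lambda>(n::int) i. x (i + n))"

definition trivial_shift :: "(int \<Rightarrow> 'a) set \<Rightarrow> bool" where
  "trivial_shift X \<longleftrightarrow> (\<exists>x. finite (shift_orbit x) \<and> X = shift_orbit x)"

end

theory Submission
  imports Defs
begin

text \<open>
  Two facts are combined.

  First, there are finitely many elements of the stabilized group of \<open>Y\<close> such that every element
  commuting with all of them has its third power equal to a power of the shift. Hence for a
  suitable \<open>n\<close> the isomorphism \<open>\<Psi>\<close> maps the \<open>n\<close>-th power of the shift of \<open>X\<close> to some
  \<open>d\<close>-th power of the shift of \<open>Y\<close> with \<open>d \<noteq> 0\<close>, and so, putting \<open>m = \<bar>d\<bar>\<close>, it maps
  \<open>Aut(\<sigma>\<^sub>X\<^sup>n\<^sup>k)\<close> onto \<open>Aut(\<sigma>\<^sub>Y\<^sup>m\<^sup>k)\<close> for all \<open>k\<close>.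
  Fix a synchronizing word \<open>w\<close> and a length \<open>l\<close>; words of length \<open>l\<close> that begin with \<open>w\<close> and
  have the followers of \<open>w\<close> can be concatenated freely. Swapping neighbouring blocks of this kind,
  alternately at even and odd positions, splits a configuration into left- and right-moving
  particles, and an element commuting with the swaps and with the transpositions of pairs of
  blocks has to translate all particles by the same amount. Transpositions that repair
  a block which is not of this kind reduce arbitrary homoclinic points to such configurations.

  Second, \<open>Aut(\<sigma>\<^sub>X\<^sup>N)\<close> contains an element \<open>\<tau>\<close> of order \<open>2\<^sup>a\<close>, where \<open>2\<^sup>a\<close> is comparable
  to the number of words of length \<open>N\<close>, permuting words in blocks of length \<open>N\<close>, and the normal
  closure of its power of order two contains a nontrivial \<open>\<kappa>\<close> that does not depend on \<open>N\<close>.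
  The image of \<open>\<kappa>\<close> moves a periodic point of \<open>Y\<close>, so the power of order two of the image of
  \<open>\<tau>\<close> acts nontrivially on the points of the corresponding period in \<open>Y\<close>; these are
  therefore at least \<open>2\<^sup>a\<close> many. Letting \<open>N\<close> grow gives \<open>n h(X) \<le> m h(Y)\<close>, and equality
  by symmetry.
\<close>

section \<open>Windows and the topology of a subshift\<close>

text \<open>The third power comes from divisibility. Swaps act on pairs of blocks of length
  \<open>l\<close> and repairs on triples, so the equation "this power of \<open>g\<close> is that
  translation" can be carried back through them only if the translation length is a multiple of
  \<open>2 * l\<close> and of \<open>3 * l\<close>. On configurations of free blocks
  \<open>g\<close> translates by a multiple of \<open>2 * l\<close>; cubing supplies the factor 3.
  In a sofic shift two words may be exchanged only if their two-sided contexts agree. For words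
  beginning with the synchronizing word the context is determined by the followers, and a repair
  restores them in its last block. The order is a power of two because a nontrivial cyclic 2-group
  has a single involution: if that involution moves a point, the orbit of the point has the full
  length \<open>2^a\<close>. Independence of \<kappa> from \<open>N\<close> lets one periodic point
  moved by its image serve for all lengths, its period being built into the sequence of
  lengths.\<close>

definition sh :: "int \<Rightarrow> (int \<Rightarrow> 'a) \<Rightarrow> int \<Rightarrow> 'a" where
  "sh n x = (\<lambda>i. x (i + n))"

lemma sh_apply: "sh n x i = x (i + n)"
  by (simp add: sh_def)

lemma sh_0 [simp]: "sh 0 x = x"
  by (simp add: sh_def)

lemma sh_sh [simp]: "sh m (sh n x) = sh (m + n) x"
  by (auto simp: sh_def algebra_simps)

lemma shift_eq_sh: "shift x = sh 1 x"
  by (simp add: shift_def sh_def)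

lemma shift_funpow: "(shift ^^ n) x = sh (int n) x"
  by (induction n) (auto simp: shift_eq_sh)

definition win :: "(int \<Rightarrow> 'a) \<Rightarrow> int \<Rightarrow> nat \<Rightarrow> 'a list" where
  "win x i n = map (\<lambda>k. x (i + int k)) [0..<n]"

lemma length_win [simp]: "length (win x i n) = n"
  by (simp add: win_def)

lemma nth_win [simp]: "k < n \<Longrightarrow> win x i n ! k = x (i + int k)"
  by (simp add: win_def)

lemma win_0 [simp]: "win x i 0 = []"
  by (simp add: win_def)

lemma win_add: "win x i (m + n) = win x i m @ win x (i + int m) n"
  by (rule nth_equalityI) (auto simp: nth_append algebra_simps)

lemma win_sh: "win (sh k x) i n = win x (i + k) n"
  by (rule nth_equalityI) (auto simp: sh_def algebra_simps)

lemma win_eq_iff: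
  "win x i n = win y j n \<longleftrightarrow> (\<forall>k<n. x (i + int k) = y (j + int k))"
  by (auto simp: list_eq_iff_nth_eq)

lemma win_eqI:
  assumes "\<And>k. i \<le> k \<Longrightarrow> k < i + int n \<Longrightarrow> x k = y k"
  shows "win x i n = win y i n"
  using assms by (auto simp: win_eq_iff)

lemma win_eqD:
  assumes "win x i n = win y i n" "i \<le> k" "k < i + int n"
  shows "x k = y k"
proof -
  have "nat (k - i) < n" "i + int (nat (k - i)) = k"
    using assms by auto
  with assms(1) show ?thesis
    by (metis win_eq_iff)
qed

definition agree :: "nat \<Rightarrow> (int \<Rightarrow> 'a) \<Rightarrow> (int \<Rightarrow> 'a) \<Rightarrow> bool" where
  "agree R x y \<longleftrightarrow> (\<forall>i. \<bar>i\<bar> \<le> int R \<longrightarrow> x i = y i)"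

lemma agree_refl [simp]: "agree R x x"
  by (simp add: agree_def)

lemma agree_trans: "agree R x y \<Longrightarrow> agree R y z \<Longrightarrow> agree R x z"
  by (simp add: agree_def)

lemma agree_mono: "agree R x y \<Longrightarrow> S \<le> R \<Longrightarrow> agree S x y"
  by (auto simp: agree_def)

lemma agree_iff_win: "agree R x y \<longleftrightarrow> win x (- int R) (2 * R + 1) = win y (- int R) (2 * R + 1)"
proof
  assume "agree R x y"
  then show "win x (- int R) (2 * R + 1) = win y (- int R) (2 * R + 1)"
    by (intro win_eqI) (auto simp: agree_def)
next
  assume eq: "win x (- int R) (2 * R + 1) = win y (- int R) (2 * R + 1)"
  show "agree R x y"
    unfolding agree_def
  proof safe
    fix i :: int assume "\<bar>i\<bar> \<le> int R"
    then show "x i = y i" by (intro win_eqD[OF eq]) auto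
  qed
qed

lemma topspace_full_shift: "topspace (full_shift_topology A) = {x. \<forall>i. x i \<in> A}"
  by (auto simp: full_shift_topology_def PiE_def)

lemma openin_full_shift:
  "openin (full_shift_topology A) U \<longleftrightarrow>
     (\<forall>x\<in>U. (\<forall>i. x i \<in> A) \<and> (\<exists>R. \<forall>y. (\<forall>i. y i \<in> A) \<and> agree R x y \<longrightarrow> y \<in> U))"
  (is "?L \<longleftrightarrow> ?R")
proof
  assume L: ?L
  have "U \<subseteq> topspace (full_shift_topology A)"
    using L openin_subset by blast
  moreover have "\<exists>R. \<forall>y. (\<forall>i. y i \<in> A) \<and> agree R x y \<longrightarrow> y \<in> U" if x: "x \<in> U" for x
  proof -
    obtain V where V: "finite {i. V i \<noteq> A}" "x \<in> PiE UNIV V" "PiE UNIV V \<subseteq> U"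
      using L x unfolding full_shift_topology_def openin_product_topology_alt by fastforce
    define R where "R = Max (insert 0 ((\<lambda>i. nat \<bar>i\<bar>) ` {i. V i \<noteq> A}))"
    have R: "\<bar>i\<bar> \<le> int R" if "V i \<noteq> A" for i
    proof -
      have "nat \<bar>i\<bar> \<le> R"
        unfolding R_def using V(1) that by (intro Max_ge) auto
      then show ?thesis by linarith
    qed
    have "y \<in> U" if y: "\<forall>i. y i \<in> A" "agree R x y" for y
    proof -
      have "y i \<in> V i" for i
      proof (cases "V i = A")
        case False
        then have "x i = y i" using R y(2) by (auto simp: agree_def)
        then show ?thesis using V(2) by (metis PiE_mem UNIV_I)
      qed (use y in auto)
      then show ?thesis using V(3) by auto
    qed
    then show ?thesis by blast
  qed
  ultimately show ?R
    by (auto simp: topspace_full_shift)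
next
  assume R: ?R
  show ?L
    unfolding full_shift_topology_def openin_product_topology_alt
  proof (intro ballI conjI allI)
    fix x assume x: "x \<in> U"
    then obtain R where R': "\<forall>y. (\<forall>i. y i \<in> A) \<and> agree R x y \<longrightarrow> y \<in> U" "\<forall>i. x i \<in> A"
      using R by blast
    define V where "V = (\<lambda>i::int. if \<bar>i\<bar> \<le> int R then {x i} else A)"
    have "finite {i\<in>UNIV. V i \<noteq> topspace (discrete_topology A)}"
      by (rule finite_subset[of _ "{- int R..int R}"]) (auto simp: V_def)
    moreover have "\<forall>i\<in>UNIV. openin (discrete_topology A) (V i)"
      using R' by (auto simp: V_def)
    moreover have "x \<in> PiE UNIV V"
      using R' by (auto simp: V_def)
    moreover have "PiE UNIV V \<subseteq> U"
    proof
      fix y assume "y \<in> PiE UNIV V"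
      then have y: "y i \<in> V i" for i by auto
      have "y i \<in> A" for i using y[of i] R' by (auto simp: V_def split: if_splits)
      moreover have "agree R x y"
        unfolding agree_def
      proof safe
        fix i :: int assume "\<bar>i\<bar> \<le> int R"
        then show "x i = y i" using y[of i] by (simp add: V_def)
      qed
      ultimately show "y \<in> U" using R' by blast
    qed
    ultimately show "\<exists>Ua. finite {i \<in> UNIV. Ua i \<noteq> topspace (discrete_topology A)} \<and>
              (\<forall>i\<in>UNIV. openin (discrete_topology A) (Ua i)) \<and>
              x \<in> Pi\<^sub>E UNIV Ua \<and> Pi\<^sub>E UNIV Ua \<subseteq> U"
      by blast
  qed
qed

lemma language_iff: "w \<in> language X \<longleftrightarrow> (\<exists>x\<in>X. \<exists>i. win x i (length w) = w)"
proof -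
  have "(\<forall>k<length w. x (i + int k) = w ! k) \<longleftrightarrow> win x i (length w) = w" for x and i :: int
    unfolding list_eq_iff_nth_eq by (metis length_win nth_win)
  then show ?thesis
    unfolding language_def occurs_in_def mem_Collect_eq by meson
qed

locale subshift_space =
  fixes A :: "'a set" and X :: "(int \<Rightarrow> 'a) set"
  assumes subshift_AX: "Defs.subshift A X"
begin

abbreviation L :: "'a list set" where "L \<equiv> language X"

abbreviation space_top :: "(int \<Rightarrow> 'a) topology" where "space_top \<equiv> shift_topology A X"

lemma finite_A: "finite A"
  and X_nonempty: "X \<noteq> {}"
  and closed_X: "closedin (full_shift_topology A) X"
  and shift_X: "shift ` X = X"
  using subshift_AX by (auto simp: Defs.subshift_def)

lemma in_A: "x \<in> X \<Longrightarrow> x i \<in> A"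
  using closedin_subset[OF closed_X] by (auto simp: topspace_full_shift)

lemma topspace_top [simp]: "topspace space_top = X"
  using closedin_subset[OF closed_X] by (auto simp: shift_topology_def)

lemma sh_X: "sh n x \<in> X" if "x \<in> X"
proof -
  have 1: "sh 1 y \<in> X" if "y \<in> X" for y
    using shift_X that by (metis imageI shift_eq_sh)
  have 2: "sh (-1) y \<in> X" if "y \<in> X" for y
  proof -
    have "y \<in> shift ` X"
      using that unfolding shift_X .
    then obtain z where "z \<in> X" "y = shift z"
      by (rule imageE)
    then show ?thesis by (simp add: shift_eq_sh)
  qed
  show ?thesis
  proof (induction n rule: int_induct[where k = 0])
    case base
    then show ?case using that by simp
  next
    case (step1 i)
    then show ?case using 1[of "sh i x"] by (simp add: add.commute)
  next
    case (step2 i)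
    then show ?case using 2[of "sh i x"] by simp
  qed
qed

lemma sh_X_iff [simp]: "sh n x \<in> X \<longleftrightarrow> x \<in> X"
  using sh_X[of x n] sh_X[of "sh n x" "-n"] by auto

lemma win_in_L: "x \<in> X \<Longrightarrow> win x i n \<in> L"
  by (auto simp: language_iff)

lemma L_obtain:
  assumes "w \<in> L"
  obtains x where "x \<in> X" "win x i (length w) = w"
proof -
  obtain x j where "x \<in> X" "win x j (length w) = w"
    using assms by (auto simp: language_iff)
  then show ?thesis
    by (intro that[of "sh (j - i) x"]) (auto simp: win_sh)
qed

lemma set_in_A: "w \<in> L \<Longrightarrow> set w \<subseteq> A"
proof -
  assume "w \<in> L"
  then obtain x where x: "x \<in> X" "win x 0 (length w) = w"
    using L_obtain by blast
  have "set (win x 0 (length w)) \<subseteq> A"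
    using in_A[OF x(1)] by (auto simp: win_def)
  with x show ?thesis by simp
qed

lemma finite_words: "finite {u \<in> L. length u = n}"
  by (rule finite_subset[OF _ finite_lists_length_eq[OF finite_A, of n]]) (use set_in_A in auto)

lemma L_appendD1: "u @ v \<in> L \<Longrightarrow> u \<in> L"
  and L_appendD2: "u @ v \<in> L \<Longrightarrow> v \<in> L"
proof -
  assume "u @ v \<in> L"
  then obtain x where x: "x \<in> X" "win x 0 (length (u @ v)) = u @ v"
    by (rule L_obtain)
  then have "win x 0 (length u) @ win x (int (length u)) (length v) = u @ v"
    using win_add[of x 0 "length u" "length v"] by simp
  then have "win x 0 (length u) = u" "win x (int (length u)) (length v) = v"
    by (simp_all add: append_eq_append_conv)
  with x(1) show "u \<in> L" "v \<in> L"
    using language_iff by fast+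
qed

lemma Nil_in_L: "[] \<in> L"
  using X_nonempty by (auto simp: language_iff)

lemma in_X_if_agree:
  assumes "\<And>R. \<exists>y\<in>X. agree R x y"
  shows "x \<in> X"
proof (rule ccontr)
  assume "x \<notin> X"
  have xA: "\<forall>i. x i \<in> A"
  proof
    fix i
    obtain y where "y \<in> X" "agree (nat \<bar>i\<bar>) x y" using assms by blast
    then show "x i \<in> A" using in_A[of y i] by (auto simp: agree_def)
  qed
  have "openin (full_shift_topology A) (topspace (full_shift_topology A) - X)"
    using closed_X by (simp add: closedin_def)
  then obtain R where R: "\<forall>y. (\<forall>i. y i \<in> A) \<and> agree R x y
      \<longrightarrow> y \<in> topspace (full_shift_topology A) - X"
    using \<open>x \<notin> X\<close> xA unfolding openin_full_shift topspace_full_shift by blast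
  obtain y where "y \<in> X" "agree R x y" using assms by blast
  moreover have "\<forall>i. y i \<in> A" using in_A \<open>y \<in> X\<close> by blast
  ultimately show False using R by auto
qed

lemma in_X_if_win:
  assumes "\<And>R. win x (- int R) (2 * R + 1) \<in> L"
  shows "x \<in> X"
proof (rule in_X_if_agree)
  fix R
  obtain y where "y \<in> X" "win y (- int R) (2 * R + 1) = win x (- int R) (2 * R + 1)"
    using L_obtain[OF assms[of R], of "- int R"] by auto
  then show "\<exists>y\<in>X. agree R x y"
    by (metis agree_iff_win)
qed

lemma openin_top:
  "openin space_top U \<longleftrightarrow> U \<subseteq> X \<and> (\<forall>x\<in>U. \<exists>R. \<forall>y\<in>X. agree R x y \<longrightarrow> y \<in> U)"
  (is "?L \<longleftrightarrow> ?R")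
proof
  assume ?L
  then obtain T where T: "openin (full_shift_topology A) T" "U = T \<inter> X"
    by (auto simp: shift_topology_def openin_subtopology)
  show ?R
  proof (intro conjI ballI)
    show "U \<subseteq> X" using T(2) by blast
    fix x assume "x \<in> U"
    then have "x \<in> T" using T(2) by blast
    then obtain R where R: "\<forall>y. (\<forall>i. y i \<in> A) \<and> agree R x y \<longrightarrow> y \<in> T"
      using T(1) unfolding openin_full_shift by meson
    have "\<forall>y\<in>X. agree R x y \<longrightarrow> y \<in> U"
      using R in_A T(2) by simp
    then show "\<exists>R. \<forall>y\<in>X. agree R x y \<longrightarrow> y \<in> U" ..
  qed
next
  assume R: ?R
  define T where "T = {y. (\<forall>i. y i \<in> A) \<and>
      (\<exists>x\<in>U. \<exists>R. agree R x y \<and> (\<forall>y'\<in>X. agree R x y' \<longrightarrow> y' \<in> U))}"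
  have "openin (full_shift_topology A) T"
    unfolding openin_full_shift
  proof (intro ballI conjI)
    fix y assume "y \<in> T"
    then obtain x R where x: "\<forall>i. y i \<in> A" "x \<in> U" "agree R x y" "\<forall>y'\<in>X. agree R x y' \<longrightarrow> y' \<in> U"
      unfolding T_def by blast
    show "\<forall>i. y i \<in> A" by fact
    have "y' \<in> T" if "\<forall>i. y' i \<in> A" "agree R y y'" for y'
      unfolding T_def mem_Collect_eq using that x agree_trans[OF x(3) that(2)] by metis
    then show "\<exists>R. \<forall>y'. (\<forall>i. y' i \<in> A) \<and> agree R y y' \<longrightarrow> y' \<in> T" by blast
  qed
  moreover have "U = T \<inter> X"
  proof
    show "U \<subseteq> T \<inter> X"
    proof
      fix x assume x: "x \<in> U"
      with R obtain S where "\<forall>y\<in>X. agree S x y \<longrightarrow> y \<in> U" by blast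
      moreover have "x \<in> X" "\<forall>i. x i \<in> A" using x R in_A by auto
      ultimately show "x \<in> T \<inter> X"
        unfolding T_def using x agree_refl by blast
    qed
  qed (auto simp: T_def)
  ultimately show ?L
    by (auto simp: shift_topology_def openin_subtopology)
qed

lemma compact_top: "compact_space space_top"
proof -
  have "compact_space (full_shift_topology A)"
    unfolding full_shift_topology_def
    using finite_A by (auto simp: compact_space_product_topology compact_space_discrete_topology)
  then show ?thesis
    unfolding shift_topology_def
    using closed_X by (simp add: closedin_compact_space compact_space_subtopology)
qed

text \<open>Cylinders contained in members of the cover already cover \<open>X\<close>, and finitely
  many of them suffice. Membership in a cylinder is decided by a fixed radius for all of its points,
  so the largest of these radii works everywhere.\<close>

lemma lebesgue_number:
  assumes "\<And>U. U \<in> \<U> \<Longrightarrow> openin space_top U" "X \<subseteq> \<Union>\<U>"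
  shows "\<exists>R. \<forall>x\<in>X. \<exists>U\<in>\<U>. \<forall>y\<in>X. agree R x y \<longrightarrow> y \<in> U"
proof -
  define \<V> where "\<V> = {V. \<exists>x R U. V = {y\<in>X. agree R x y} \<and> U \<in> \<U> \<and> V \<subseteq> U}"
  have op: "openin space_top V" if "V \<in> \<V>" for V
    using that unfolding \<V>_def openin_top by (auto intro: agree_trans)
  have cov: "X \<subseteq> \<Union>\<V>"
  proof
    fix x assume x: "x \<in> X"
    then obtain U where U: "U \<in> \<U>" "x \<in> U" using assms by blast
    then obtain R where "\<forall>y\<in>X. agree R x y \<longrightarrow> y \<in> U"
      using assms(1) unfolding openin_top by meson
    then have "{y\<in>X. agree R x y} \<subseteq> U" by auto
    then have "{y\<in>X. agree R x y} \<in> \<V>"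
      unfolding \<V>_def mem_Collect_eq using U(1) by metis
    moreover have "x \<in> {y\<in>X. agree R x y}" using x by simp
    ultimately show "x \<in> \<Union>\<V>" by (rule UnionI)
  qed
  obtain \<F> where \<F>: "finite \<F>" "\<F> \<subseteq> \<V>" "X \<subseteq> \<Union>\<F>"
    using compact_top op cov unfolding compact_space_alt topspace_top by meson
  have "\<exists>R. \<forall>x\<in>V. \<forall>y\<in>X. agree R x y \<longrightarrow> y \<in> V" if "V \<in> \<F>" for V
  proof -
    have "V \<in> \<V>" using that \<F>(2) by blast
    then obtain x R where "V = {y\<in>X. agree R x y}" unfolding \<V>_def by blast
    then show ?thesis by (intro exI[of _ R]) (auto intro: agree_trans)
  qed
  then obtain r where r: "\<And>V x y. V \<in> \<F> \<Longrightarrow> x \<in> V \<Longrightarrow> y \<in> X \<Longrightarrow> agree (r V) x y \<Longrightarrow> y \<in> V"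
    by metis
  define R where "R = Max (insert 0 (r ` \<F>))"
  show ?thesis
  proof (intro exI[of _ R] ballI)
    fix x assume x: "x \<in> X"
    then obtain V where V: "V \<in> \<F>" "x \<in> V" using \<F> by blast
    then have "r V \<le> R" unfolding R_def using \<F> by (intro Max_ge) auto
    obtain U where "U \<in> \<U>" "V \<subseteq> U" using V \<F>(2) by (auto simp: \<V>_def)
    then show "\<exists>U\<in>\<U>. \<forall>y\<in>X. agree R x y \<longrightarrow> y \<in> U"
      using r[OF V] \<open>r V \<le> R\<close> by (meson agree_mono subsetD)
  qed
qed

end

text \<open>The sets on which letter \<open>i\<close> of the image has a given value form an open
  cover of \<open>Z\<close>; its Lebesgue number is the radius. Commutation with the shift is not
  assumed, so the radius may depend on \<open>i\<close>.\<close>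

lemma continuous_imp_local:
  assumes "subshift_space B Z" "subshift_space A X"
    and f: "continuous_map (shift_topology B Z) (shift_topology A X) f"
  shows "\<exists>R. \<forall>x\<in>Z. \<forall>y\<in>Z. agree R x y \<longrightarrow> f x i = f y i"
proof -
  interpret Z: subshift_space B Z by fact
  interpret X: subshift_space A X by fact
  define \<U> where "\<U> = (\<lambda>a. {z\<in>Z. f z \<in> {x\<in>X. x i = a}}) ` A"
  have opn: "openin (shift_topology A X) {x\<in>X. x i = a}" for a
    unfolding X.openin_top
    by (auto intro!: exI[of _ "nat \<bar>i\<bar>"] simp: agree_def)
  have "openin (shift_topology B Z) U" if U: "U \<in> \<U>" for U
  proof -
    obtain a where "U = {z\<in>Z. f z \<in> {x\<in>X. x i = a}}"
      using U unfolding \<U>_def by blast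
    then show ?thesis
      using openin_continuous_map_preimage[OF f opn] by simp
  qed
  moreover have "Z \<subseteq> \<Union>\<U>"
    using f X.in_A unfolding \<U>_def continuous_map_def by auto
  ultimately obtain R where "\<forall>x\<in>Z. \<exists>U\<in>\<U>. \<forall>y\<in>Z. agree R x y \<longrightarrow> y \<in> U"
    using Z.lebesgue_number by meson
  then show ?thesis
    unfolding \<U>_def by (intro exI[of _ R]) fastforce
qed

lemma local_imp_continuous:
  assumes "subshift_space B Z" "subshift_space A X" "\<And>z. z \<in> Z \<Longrightarrow> f z \<in> X"
    and loc: "\<And>i. \<exists>R. \<forall>x\<in>Z. \<forall>y\<in>Z. agree R x y \<longrightarrow> f x i = f y i"
  shows "continuous_map (shift_topology B Z) (shift_topology A X) f"
proof -
  interpret Z: subshift_space B Z by fact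
  interpret X: subshift_space A X by fact
  obtain r where r: "\<And>i x y. x \<in> Z \<Longrightarrow> y \<in> Z \<Longrightarrow> agree (r i) x y \<Longrightarrow> f x i = f y i"
    using loc by metis
  have "openin (shift_topology B Z) {x \<in> Z. f x \<in> U}" if U: "openin (shift_topology A X) U" for U
    unfolding Z.openin_top
  proof (intro conjI ballI)
    fix x assume "x \<in> {x \<in> Z. f x \<in> U}"
    then have x: "x \<in> Z" "f x \<in> U" by auto
    then obtain R where R: "\<forall>y\<in>X. agree R (f x) y \<longrightarrow> y \<in> U"
      using U unfolding X.openin_top by blast
    define S where "S = Max (r ` {- int R..int R})"
    have S: "r i \<le> S" if "\<bar>i\<bar> \<le> int R" for i
      unfolding S_def using that by (intro Max_ge finite_imageI imageI) auto
    show "\<exists>R. \<forall>y\<in>Z. agree R x y \<longrightarrow> y \<in> {x \<in> Z. f x \<in> U}"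
    proof (intro exI[of _ S] ballI impI)
      fix y assume y: "y \<in> Z" "agree S x y"
      have "agree R (f x) (f y)"
        unfolding agree_def using r[OF x(1) y(1)] S agree_mono[OF y(2)] by blast
      then show "y \<in> {x \<in> Z. f x \<in> U}"
        using R y assms(3) by auto
    qed
  qed auto
  then show ?thesis
    using assms(3) unfolding continuous_map_def by auto
qed

section \<open>Syntactic contexts and synchronizing words\<close>

text \<open>The syntactic context: words with equal contexts may be exchanged inside every word of
  the language. Finiteness of the set of contexts is the property drawn from soficity.\<close>

definition ctx :: "(int \<Rightarrow> 'a) set \<Rightarrow> 'a list \<Rightarrow> ('a list \<times> 'a list) set" where
  "ctx X u = {(a, b). a @ u @ b \<in> language X}"

definition fol :: "(int \<Rightarrow> 'a) set \<Rightarrow> 'a list \<Rightarrow> 'a list set" where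
  "fol X u = {b. u @ b \<in> language X}"

lemma ctxD: "ctx X u = ctx X v \<Longrightarrow> a @ u @ b \<in> language X \<longleftrightarrow> a @ v @ b \<in> language X"
  by (auto simp: ctx_def)

lemma finite_range_via:
  assumes "finite (range E)" "\<And>u v. E u = E v \<Longrightarrow> f u = f v"
  shows "finite (range f)"
proof (rule finite_subset)
  show "range f \<subseteq> (\<lambda>e. f (SOME v. E v = e)) ` range E"
  proof
    fix y assume "y \<in> range f"
    then obtain u where u: "y = f u" by blast
    have "E (SOME v. E v = E u) = E u"
      by (rule someI) simp
    then have "f (SOME v. E v = E u) = y"
      using assms(2) u by metis
    then show "y \<in> (\<lambda>e. f (SOME v. E v = e)) ` range E"
      by (intro image_eqI[of _ _ "E u"]) auto
  qed
qed (use assms(1) in simp)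

text \<open>A word can be replaced inside a point whenever the set \<open>E\<close> of boundary patterns of its
  preimages in the covering shift of finite type is unchanged, since preimages can be spliced.\<close>
lemma sofic_finite_ctx:
  assumes "sofic_shift A X"
  shows "finite (range (ctx X))"
proof -
  have AX: "Defs.subshift A X" using assms by (simp add: sofic_shift_def)
  obtain B :: "nat set" and Z \<pi> where Z: "shift_of_finite_type B Z" "factor_map B Z A X \<pi>"
    using assms unfolding sofic_shift_def by meson
  have BZ: "Defs.subshift B Z" using Z by (simp add: shift_of_finite_type_def)
  interpret X: subshift_space A X by (unfold_locales) fact
  interpret Z: subshift_space B Z by (unfold_locales) fact
  obtain F where F: "finite F" "Z = {x. (\<forall>i. x i \<in> B) \<and> (\<forall>w\<in>F. \<not> occurs_in w x)}"
    using Z(1) unfolding shift_of_finite_type_def by blast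
  have cont: "continuous_map (shift_topology B Z) (shift_topology A X) \<pi>" and im: "\<pi> ` Z = X"
    and comm: "\<And>z. z \<in> Z \<Longrightarrow> \<pi> (sh 1 z) = sh 1 (\<pi> z)"
    using Z(2) by (auto simp: factor_map_def shift_eq_sh)
  obtain R where R: "\<And>x y. x \<in> Z \<Longrightarrow> y \<in> Z \<Longrightarrow> agree R x y \<Longrightarrow> \<pi> x 0 = \<pi> y 0"
    using continuous_imp_local[OF Z.subshift_space_axioms X.subshift_space_axioms cont] by blast
  have comm': "\<pi> (sh n z) = sh n (\<pi> z)" if "z \<in> Z" for n z
  proof (induction n rule: int_induct[where k = 0])
    case (step1 i)
    then show ?case using comm[of "sh i z"] that by (simp add: add.commute)
  next
    case (step2 i)
    have "sh 1 (\<pi> (sh (i - 1) z)) = \<pi> (sh i z)"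
      using comm[of "sh (i - 1) z"] that by simp
    then have "sh (-1) (sh 1 (\<pi> (sh (i - 1) z))) = sh (-1) (sh i (\<pi> z))"
      using step2 by simp
    then show ?case by simp
  qed simp
  have loc: "\<pi> x i = \<pi> y j" if "x \<in> Z" "y \<in> Z" "\<And>k. \<bar>k\<bar> \<le> int R \<Longrightarrow> x (i + k) = y (j + k)" for x y i j
  proof -
    have "\<pi> (sh i x) 0 = \<pi> (sh j y) 0"
      using that by (intro R) (auto simp: agree_def sh_apply add.commute)
    then show ?thesis using comm' that by (simp add: sh_def)
  qed
  \<comment> \<open>\<open>D\<close> exceeds the radius of \<open>\<pi>\<close> and bounds the
    lengths of the forbidden words, so coding windows and forbidden words fit into an overlap of
    width \<open>2 * D\<close>.\<close>
  define D where "D = Max (insert (Suc R) (length ` F))"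
  have DR: "R < D"
  proof -
    have "Suc R \<le> D" unfolding D_def using F(1) by (intro Max_ge) auto
    then show ?thesis by simp
  qed
  have DF: "length f \<le> D" if "f \<in> F" for f
    unfolding D_def using F(1) that by (intro Max_ge) auto
  define I where "I = {- int D..<int D}"
  define E where "E = (\<lambda>u. {(restrict z I, restrict (sh (int (length u)) z) I) | z. z \<in> Z \<and> win (\<pi> z) 0 (length u) = u})"
  define P where "P = PiE I (\<lambda>_. B)"
  have "finite P" unfolding P_def I_def using Z.finite_A by (intro finite_PiE) auto
  have "E u \<subseteq> P \<times> P" for u
    unfolding E_def P_def using Z.in_A Z.sh_X by auto
  then have "range E \<subseteq> Pow (P \<times> P)" by blast
  moreover have "finite (Pow (P \<times> P))" using \<open>finite P\<close> by simp
  ultimately have finE: "finite (range E)" by (rule finite_subset)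
  have sub: "ctx X u \<subseteq> ctx X u'" if "E u = E u'" for u u'
  proof
    fix p assume "p \<in> ctx X u"
    obtain a b where p: "p = (a, b)" by force
    then have "a @ u @ b \<in> language X" using \<open>p \<in> _\<close> by (auto simp: ctx_def)
    then obtain x where x: "x \<in> X" "win x (- int (length a)) (length (a @ u @ b)) = a @ u @ b"
      by (rule X.L_obtain)
    define n n' where "n = length u" and "n' = length u'"
    have "win x (- int (length a)) (length a) @ win x 0 n @ win x (int n) (length b) = a @ u @ b"
      using x(2) win_add[of x "- int (length a)" "length a" "n + length b"] win_add[of x 0 n "length b"]
      by (simp add: n_def)
    then have "win x (- int (length a)) (length a) = a \<and> win x 0 n @ win x (int n) (length b) = u @ b"
      by (subst (asm) append_eq_append_conv) simp_all
    moreover from this have "win x 0 n = u \<and> win x (int n) (length b) = b"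
      by (subst (asm) append_eq_append_conv) (simp_all add: n_def)
    ultimately have xw: "win x (- int (length a)) (length a) = a" "win x 0 n = u" "win x (int n) (length b) = b"
      by blast+
    obtain z where z: "z \<in> Z" "\<pi> z = x" using im x(1) by blast
    have "(restrict z I, restrict (sh (int n) z) I) \<in> E u"
      unfolding E_def mem_Collect_eq n_def
      by (rule exI[of _ z]) (simp add: z xw(2)[unfolded n_def])
    then have "(restrict z I, restrict (sh (int n) z) I) \<in> E u'" using that by simp
    then obtain z' where z': "z' \<in> Z" "win (\<pi> z') 0 n' = u'" "restrict z I = restrict z' I"
        "restrict (sh (int n) z) I = restrict (sh (int n') z') I"
      unfolding E_def n'_def mem_Collect_eq by (metis prod.inject)
    have e1: "z i = z' i" if "- int D \<le> i" "i < int D" for i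
      using fun_cong[OF z'(3), of i] that by (auto simp: I_def)
    have e2: "z (i + int n) = z' (i + int n')" if "- int D \<le> i" "i < int D" for i
      using fun_cong[OF z'(4), of i] that by (auto simp: I_def sh_def)
    \<comment> \<open>The splice: \<open>z\<close> on the left, the middle of \<open>z'\<close>, and
      the right part of \<open>z\<close> moved by the difference of the lengths. Equality of the
      patterns in \<open>E\<close> makes the pieces agree on the overlaps.\<close>
    define y where "y = (\<lambda>i. if i < 0 then z i else if i < int n' then z' i else z (i - int n' + int n))"
    have y1: "y i = z i" if "i < int D" "i < int n' + int D" for i
      using e1[of i] e2[of "i - int n'"] that unfolding y_def by (auto simp: algebra_simps)
    have y2: "y i = z' i" if "- int D \<le> i" "i < int n' + int D" for i
      using e1[of i] e2[of "i - int n'"] that unfolding y_def by (auto simp: algebra_simps)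
    have y3: "y i = z (i - int n' + int n)" if "int n' - int D \<le> i" for i
      using e1[of i] e2[of "i - int n'"] y2[of i] that DR unfolding y_def by (auto simp: algebra_simps)
    have yZ: "y \<in> Z"
      unfolding F(2) mem_Collect_eq
    proof (intro conjI allI ballI notI)
      fix i show "y i \<in> B" unfolding y_def using Z.in_A z(1) z'(1) by auto
    next
      fix f assume f: "f \<in> F" "occurs_in f y"
      then obtain i where i: "\<And>k. k < length f \<Longrightarrow> y (i + int k) = f ! k"
        unfolding occurs_in_def by blast
      have lf: "length f \<le> D" using DF f by blast
      have nz: "\<not> occurs_in f z" "\<not> occurs_in f z'" using f(1) z(1) z'(1) F(2) by auto
      \<comment> \<open>An occurrence starting at \<open>i\<close> lies entirely where
        \<open>y\<close> copies \<open>z\<close>, the moved \<open>z\<close>, or \<open>z'\<close>,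
        respectively.\<close>
      consider "i \<le> 0" | "i > 0" "i \<ge> int n' - int D" | "i > 0" "i < int n' - int D" by linarith
      then show False
      proof cases
        case 1
        then have "\<forall>k<length f. z (i + int k) = f ! k" using i y1 lf by (metis (no_types, lifting) add_strict_increasing2 add_mono_thms_linordered_field(4) add.commute add_0 of_nat_less_iff less_le_trans of_nat_0_le_iff)
        then show False using nz unfolding occurs_in_def by blast
      next
        case 2
        have "z ((i - int n' + int n) + int k) = f ! k" if "k < length f" for k
        proof -
          have "y (i + int k) = z (i + int k - int n' + int n)" using 2 by (intro y3) auto
          then show ?thesis using i[OF that] by (simp add: algebra_simps)
        qed
        then show False using nz unfolding occurs_in_def by blast
      next
        case 3
        have "z' (i + int k) = f ! k" if "k < length f" for k
        proof -
          have "y (i + int k) = z' (i + int k)" using 3 that lf by (intro y2) auto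
          then show ?thesis using i[OF that] by simp
        qed
        then show False using nz unfolding occurs_in_def by blast
      qed
    qed
    have p1: "\<pi> y i = x i" if "i < 0" for i
      using loc[OF yZ z(1), of i i] z(2) y1 that DR by auto
    have p2: "\<pi> y i = \<pi> z' i" if "0 \<le> i" "i < int n'" for i
      using loc[OF yZ z'(1), of i i] y2 that DR by auto
    have p3: "\<pi> y i = x (i - int n' + int n)" if "int n' \<le> i" for i
    proof -
      have "\<pi> y i = \<pi> z (i - int n' + int n)"
      proof (rule loc[OF yZ z(1)])
        fix k :: int assume "\<bar>k\<bar> \<le> int R"
        then have "y (i + k) = z (i + k - int n' + int n)" using that DR by (intro y3) auto
        then show "y (i + k) = z (i - int n' + int n + k)" by (simp add: algebra_simps)
      qed
      then show ?thesis using z(2) by simp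
    qed
    have "win (\<pi> y) (- int (length a)) (length a) = a"
      by (subst xw(1)[symmetric], rule win_eqI) (auto intro: p1)
    moreover have "win (\<pi> y) 0 n' = u'"
      by (subst z'(2)[symmetric], rule win_eqI) (auto intro: p2)
    moreover have "win (\<pi> y) (int n') (length b) = b"
      by (subst xw(3)[symmetric]) (auto simp: win_eq_iff p3 algebra_simps)
    ultimately have "win (\<pi> y) (- int (length a)) (length a + (n' + length b)) = a @ u' @ b"
      using win_add[of "\<pi> y" "- int (length a)" "length a" "n' + length b"] win_add[of "\<pi> y" 0 n' "length b"]
      by simp
    moreover have "\<pi> y \<in> X" using im yZ by blast
    ultimately have "a @ u' @ b \<in> language X"
      using X.win_in_L by metis
    then show "p \<in> ctx X u'"
      by (simp add: p ctx_def)
  qed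
  show ?thesis
    by (rule finite_range_via[OF finE]) (simp add: sub subset_antisym)
qed

text \<open>\<open>w\<close> is synchronizing, and \<open>M\<close> is a mixing gap that works for all pairs of words at once;
  the latter exists because mixing only depends on the finitely many contexts.\<close>
locale mixing_sofic = subshift_space A X for A :: "'a set" and X +
  fixes w :: "'a list" and M :: nat
  assumes w_ne: "w \<noteq> []"
    and ww: "w @ w \<in> language X"
    and sync: "a @ w \<in> language X \<Longrightarrow> w @ b \<in> language X \<Longrightarrow> a @ w @ b \<in> language X"
    and mix: "u \<in> language X \<Longrightarrow> v \<in> language X \<Longrightarrow> M \<le> m \<Longrightarrow> \<exists>a. length a = m \<and> u @ a @ v \<in> language X"
    and fin_ctx: "finite (range (ctx X))"
    and nontrivial: "\<not> trivial_shift X"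

text \<open>A word \<open>w0\<close> with minimal follower set is synchronizing: a prefix can only
  remove followers, and by minimality it removes none. Prolonging it to \<open>w0 @ c\<close>, where
  \<open>w0 @ c @ w0\<close> is in the language, makes it nonempty and allows it to follow
  itself.\<close>

lemma mixing_sofic_exists:
  assumes "sofic_shift A X" "mixing X" "\<not> trivial_shift X"
  shows "\<exists>w M. mixing_sofic A X w M"
proof -
  have AX: "Defs.subshift A X" using assms by (simp add: sofic_shift_def)
  interpret subshift_space A X by (unfold_locales) fact
  have finite_support: "finite (range (ctx X))" using assms(1) by (rule sofic_finite_ctx)
  have fol_ctx: "fol X u = fol X v" if "ctx X u = ctx X v" for u v
    using ctxD[OF that, of "[]"] by (auto simp: fol_def)
  have "finite (range (fol X))" by (rule finite_range_via[OF finite_support fol_ctx])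
  then have finfol: "finite (fol X ` L)"
    by (rule finite_subset[rotated]) auto
  have "fol X ` L \<noteq> {}" using Nil_in_L by blast
  then obtain m where m: "m \<in> fol X ` L" "\<And>c. c \<in> fol X ` L \<Longrightarrow> c \<subseteq> m \<Longrightarrow> m = c"
    using finite_has_minimal[OF finfol] by metis
  then obtain w0 where w0: "w0 \<in> L" "m = fol X w0" by blast
  have sync0: "a @ w0 @ b \<in> L" if "a @ w0 \<in> L" "w0 @ b \<in> L" for a b
  proof -
    have "fol X (a @ w0) \<subseteq> fol X w0"
      by (auto simp: fol_def intro: L_appendD2)
    then have "fol X w0 = fol X (a @ w0)" using m(2)[of "fol X (a @ w0)"] w0 that by blast
    moreover have "b \<in> fol X w0" using that by (simp add: fol_def)
    ultimately show ?thesis by (simp add: fol_def)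
  qed
  obtain M0 where M0: "\<And>m. m \<ge> M0 \<Longrightarrow> \<exists>c. length c = m \<and> w0 @ c @ w0 \<in> L"
    using assms(2) w0(1) unfolding mixing_def by meson
  obtain c where c: "length c = Suc M0" "w0 @ c @ w0 \<in> L" using M0[of "Suc M0"] by auto
  define w where "w = w0 @ c"
  have wL: "w @ w0 \<in> L" using c by (simp add: w_def)
  have wL': "w \<in> L" using wL by (rule L_appendD1)
  have ww: "w @ w \<in> L"
    using sync0[of "w0 @ c" c] wL wL' by (simp add: w_def)
  have sync: "a @ w @ b \<in> L" if "a @ w \<in> L" "w @ b \<in> L" for a b
  proof -
    have "a @ w0 \<in> L" using L_appendD1[of "a @ w0" c] that by (simp add: w_def)
    then show ?thesis using sync0[of a "c @ b"] that by (simp add: w_def)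
  qed
  obtain N where N: "\<And>u v m. u \<in> L \<Longrightarrow> v \<in> L \<Longrightarrow> N u v \<le> m \<Longrightarrow> \<exists>a. length a = m \<and> u @ a @ v \<in> L"
    using assms(2) unfolding mixing_def by metis
  define rep where "rep = (\<lambda>c. SOME v. v \<in> L \<and> ctx X v = c)"
  have rep: "rep (ctx X u) \<in> L \<and> ctx X (rep (ctx X u)) = ctx X u" if "u \<in> L" for u
    unfolding rep_def by (rule someI[of _ u]) (use that in simp)
  define S where "S = (\<lambda>(c, d). N (rep c) (rep d)) ` (range (ctx X) \<times> range (ctx X))"
  have finS: "finite S" unfolding S_def using finite_support by blast
  define M where "M = Max S"
  have mix: "\<exists>a. length a = m \<and> u @ a @ v \<in> L" if "u \<in> L" "v \<in> L" "M \<le> m" for u v m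
  proof -
    have "N (rep (ctx X u)) (rep (ctx X v)) \<in> S" unfolding S_def by (rule image_eqI[of _ _ "(ctx X u, ctx X v)"]) auto
    then have "N (rep (ctx X u)) (rep (ctx X v)) \<le> M" unfolding M_def using finS by (rule Max_ge[rotated])
    then have "N (rep (ctx X u)) (rep (ctx X v)) \<le> m" using that(3) by simp
    moreover have "rep (ctx X u) \<in> L" "rep (ctx X v) \<in> L" using rep that by auto
    ultimately obtain a where a: "length a = m" "rep (ctx X u) @ a @ rep (ctx X v) \<in> L"
      using N by blast
    have "u @ a @ rep (ctx X v) \<in> L"
      using ctxD[of X "rep (ctx X u)" u "[]" "a @ rep (ctx X v)"] rep[OF that(1)] a by simp
    then have "u @ a @ v \<in> L"
      using ctxD[of X "rep (ctx X v)" v "u @ a" "[]"] rep[OF that(2)] by simp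
    then show ?thesis using a by blast
  qed
  have "w \<noteq> []" using c by (auto simp: w_def)
  have "mixing_sofic A X w M"
    by unfold_locales (use \<open>w \<noteq> []\<close> ww sync mix finite_support assms(3) in blast)+
  then show ?thesis by blast
qed

section \<open>Words beginning with the synchronizing word: return blocks and loops\<close>

context mixing_sofic
begin

abbreviation F :: "'a list \<Rightarrow> 'a list set" where "F \<equiv> fol X"

definition starts :: "'a list \<Rightarrow> bool" where
  "starts u \<longleftrightarrow> (\<exists>v. u = w @ v)"

lemma w_L: "w \<in> L"
  using L_appendD1 ww by blast

lemma starts_w [simp]: "starts w"
  by (auto simp: starts_def)

lemma starts_append [simp]: "starts u \<Longrightarrow> starts (u @ v)"
  by (auto simp: starts_def)

text \<open>The leading \<open>w\<close> of \<open>v\<close> screens off the past: whether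
  \<open>u\<close> may precede \<open>v\<close> is tested by \<open>u @ w\<close> alone.\<close>

lemma append_L_iff:
  assumes "starts v"
  shows "u @ v \<in> L \<longleftrightarrow> u @ w \<in> L \<and> v \<in> L"
proof -
  obtain v' where v: "v = w @ v'" using assms by (auto simp: starts_def)
  show ?thesis
    using sync[of u v'] L_appendD1[of "u @ w" v'] L_appendD2[of u v] by (auto simp: v)
qed

lemma F_append:
  assumes "starts v" "u @ w \<in> L"
  shows "F (u @ v) = F v"
  using assms append_L_iff[of "v @ _" u] by (auto simp: fol_def)

text \<open>Since \<open>w\<close> screens off the past, followers alone determine the two-sided
  context. For this reason only words beginning with \<open>w\<close> are ever exchanged.\<close>

lemma ctx_eqI:
  assumes "starts u" "starts v" "F u = F v"
  shows "ctx X u = ctx X v"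
proof -
  have "u @ b \<in> L \<longleftrightarrow> v @ b \<in> L" for b
    using assms(3) by (auto simp: fol_def)
  then have "a @ u @ b \<in> L \<longleftrightarrow> a @ v @ b \<in> L" for a b
    using append_L_iff[of "u @ b" a] append_L_iff[of "v @ b" a] assms by auto
  then show ?thesis by (auto simp: ctx_def)
qed

definition R :: "nat \<Rightarrow> 'a list set" where
  "R n = {c. length c = n \<and> starts c \<and> c \<in> L \<and> F c = F w}"

lemma R_length: "c \<in> R n \<Longrightarrow> length c = n"
  and R_starts: "c \<in> R n \<Longrightarrow> starts c"
  and R_L: "c \<in> R n \<Longrightarrow> c \<in> L"
  and R_F: "c \<in> R n \<Longrightarrow> F c = F w"
  by (auto simp: R_def)

lemma R_w: "c \<in> R n \<Longrightarrow> c @ w \<in> L"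
  using ww by (auto simp: R_def fol_def)

lemma R_append_L: "c \<in> R n \<Longrightarrow> starts v \<Longrightarrow> v \<in> L \<Longrightarrow> c @ v \<in> L"
  using append_L_iff R_w by blast

lemma R_append_F: "c \<in> R n \<Longrightarrow> starts v \<Longrightarrow> F (c @ v) = F v"
  using F_append R_w by blast

lemma R_append: "c \<in> R n \<Longrightarrow> d \<in> R m \<Longrightarrow> c @ d \<in> R (n + m)"
  using R_append_L[of c n d] R_append_F[of c n d] by (auto simp: R_def)

text \<open>Weaker than membership in \<open>R\<close>: a loop may be followed by \<open>w\<close>,
  but its follower set can differ from that of \<open>w\<close>. Loops still concatenate freely, and
  every word of the language sits inside one.\<close>

definition loop :: "'a list \<Rightarrow> bool" where
  "loop u \<longleftrightarrow> starts u \<and> u @ w \<in> L"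

lemma loop_L: "loop u \<Longrightarrow> u \<in> L"
  using L_appendD1 by (auto simp: loop_def)

lemma loop_append: "loop u \<Longrightarrow> loop v \<Longrightarrow> loop (u @ v)"
  using append_L_iff[of "v @ w" u] by (auto simp: loop_def)

lemma R_loop: "c \<in> R n \<Longrightarrow> loop c"
  by (auto simp: loop_def R_starts R_w)

lemma loop_w_R: "loop u \<Longrightarrow> length u + length w = n \<Longrightarrow> u @ w \<in> R n"
  using F_append[of w u] by (auto simp: loop_def R_def)

lemma finite_R: "finite (R n)"
  by (rule finite_subset[OF _ finite_words[of n]]) (auto simp: R_def)

lemma R_large:
  assumes "n \<ge> 2 * length w + M"
  shows "R n \<noteq> {}"
proof -
  have "M \<le> n - 2 * length w" using assms by linarith
  from mix[OF w_L w_L this] obtain a where a: "length a = n - 2 * length w" "w @ a @ w \<in> L"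
    by blast
  then have "(w @ a) @ w \<in> R n"
    using assms by (intro loop_w_R) (auto simp: loop_def starts_def)
  then show ?thesis by blast
qed

text \<open>If there were at most one block of each length, blocks \<open>c\<close> and
  \<open>d\<close> of lengths \<open>n\<close> and \<open>n + 1\<close> would satisfy
  \<open>c @ d = d @ c\<close>, which forces \<open>c\<close> to be constant. Every word of the
  language sits inside such a block, so \<open>X\<close> would be a single fixed point.\<close>

lemma R_two: "\<exists>n c d. c \<in> R n \<and> d \<in> R n \<and> c \<noteq> d"
proof (rule ccontr)
  assume H: "\<nexists>n c d. c \<in> R n \<and> d \<in> R n \<and> c \<noteq> d"
  define x where "x = hd w"
  have const: "set c \<subseteq> {x}" if c: "c \<in> R n" "n \<ge> 2 * length w + M" for c n
  proof -
    obtain d where d: "d \<in> R (Suc n)" using R_large[of "Suc n"] c by auto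
    have "c @ d \<in> R (n + Suc n)" "d @ c \<in> R (n + Suc n)"
      using R_append[OF c(1) d] R_append[OF d c(1)] by (simp_all add: add.commute)
    then have comm: "c @ d = d @ c" using H by blast
    have l: "length c = n" "length d = Suc n" using c d by (auto simp: R_length)
    have nth: "(c @ d) ! k = (d @ c) ! k" for k using comm by simp
    have shiftc: "c ! k = c ! Suc k" if "Suc k < n" for k
    proof -
      have "d ! Suc k = c ! Suc k" using nth[of "Suc k"] that l by (simp add: nth_append)
      moreover have "d ! Suc k = c ! k"
        using nth[of "Suc k + n"] that l by (auto simp: nth_append)
      ultimately show ?thesis by simp
    qed
    have "c ! k = c ! 0" if "k < n" for k
      using that by (induction k) (auto simp: shiftc[symmetric])
    moreover have "c ! 0 = x"
      using R_starts[OF c(1)] w_ne by (auto simp: starts_def x_def hd_conv_nth nth_append)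
    ultimately show ?thesis using l by (auto simp: in_set_conv_nth)
  qed
  have Lx: "set u \<subseteq> {x}" if u: "u \<in> L" for u
  proof -
    obtain a where a: "length a = M" "w @ a @ u \<in> L" using mix[OF w_L u, of M] by auto
    obtain b where b: "length b = length w + M" "(w @ a @ u) @ b @ w \<in> L"
      using mix[OF a(2) w_L, of "length w + M"] by auto
    have "(w @ a @ u @ b) @ w \<in> R (length (w @ a @ u @ b) + length w)"
      using b by (intro loop_w_R) (auto simp: loop_def starts_def)
    from const[OF this] show ?thesis using a b by auto
  qed
  have "y = (\<lambda>_. x)" if "y \<in> X" for y
  proof
    fix i
    show "y i = x" using Lx[OF win_in_L[OF that, of i 1]] by (auto simp: win_def)
  qed
  then have "X = {\<lambda>_. x}" using X_nonempty by blast
  moreover have "shift_orbit (\<lambda>_. x) = {\<lambda>_. x}" by (auto simp: shift_orbit_def)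
  ultimately have "trivial_shift X" unfolding trivial_shift_def
    by (intro exI[of _ "\<lambda>_. x"]) simp
  then show False using nontrivial by blast
qed

text \<open>Two distinct blocks \<open>c\<close>, \<open>d\<close> of equal length yield
  \<open>cc\<close>, \<open>cd\<close>, \<open>dc\<close>, \<open>dd\<close>; a common tail
  \<open>r\<close> adjusts the length. Four blocks are what a double transposition of blocks
  needs.\<close>

lemma R_card: "\<exists>n0. \<forall>n\<ge>n0. 4 \<le> card (R n)"
proof -
  obtain p c d where cd: "c \<in> R p" "d \<in> R p" "c \<noteq> d" using R_two by blast
  have l: "length c = p" "length d = p" using cd by (auto simp: R_length)
  show ?thesis
  proof (intro exI[of _ "2 * p + (2 * length w + M)"] allI impI)
    fix n assume n: "2 * p + (2 * length w + M) \<le> n"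
    then have "2 * length w + M \<le> n - 2 * p" by linarith
    from R_large[OF this] obtain r where r: "r \<in> R (n - 2 * p)" by blast
    let ?S = "{c @ c @ r, c @ d @ r, d @ c @ r, d @ d @ r}"
    have e: "p + (p + (n - 2 * p)) = n" using n by simp
    have "?S \<subseteq> R n"
      using R_append[OF cd(1) R_append[OF cd(1) r]] R_append[OF cd(1) R_append[OF cd(2) r]]
        R_append[OF cd(2) R_append[OF cd(1) r]] R_append[OF cd(2) R_append[OF cd(2) r]]
      unfolding e by simp
    moreover have "card ?S = 4"
      using cd(3) l by (auto simp: append_eq_append_conv card_insert_if)
    ultimately show "4 \<le> card (R n)" using card_mono[OF finite_R] by metis
  qed
qed

text \<open>There are finitely many follower sets, so representatives of bounded length exist. A
  prefix \<open>w @ a\<close> does not change the followers, and mixing allows \<open>a\<close> to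
  have any sufficiently large length.\<close>

lemma reach: "\<exists>n0. \<forall>n\<ge>n0. \<forall>u\<in>L. starts u \<longrightarrow> (\<exists>e\<in>L. length e = n \<and> starts e \<and> F e = F u)"
proof -
  have fol_ctx: "F u = F v" if "ctx X u = ctx X v" for u v
    using ctxD[OF that, of "[]"] by (auto simp: fol_def)
  have finite_support: "finite (range F)" by (rule finite_range_via[OF fin_ctx fol_ctx])
  define rep where "rep = (\<lambda>c. SOME v. v \<in> L \<and> starts v \<and> F v = c)"
  have rep: "rep (F u) \<in> L \<and> starts (rep (F u)) \<and> F (rep (F u)) = F u" if "u \<in> L" "starts u" for u
    unfolding rep_def by (rule someI[of _ u]) (use that in simp)
  define K where "K = Max ((\<lambda>c. length (rep c)) ` range F)"
  have K: "length (rep (F u)) \<le> K" for u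
    unfolding K_def using finite_support by (intro Max_ge) auto
  show ?thesis
  proof (intro exI[of _ "length w + M + K"] allI ballI impI)
    fix n u assume n: "length w + M + K \<le> n" and u: "u \<in> L" "starts u"
    define v where "v = rep (F u)"
    have v: "v \<in> L" "starts v" "F v = F u" "length v \<le> K"
      using rep[OF u] K v_def by auto
    have Mle: "M \<le> n - length w - length v" using n v(4) by linarith
    obtain a where a: "length a = n - length w - length v" "w @ a @ v \<in> L"
      using mix[OF w_L v(1) Mle] by blast
    have "(w @ a) @ w \<in> L" using append_L_iff[OF v(2), of "w @ a"] a by simp
    then have "F ((w @ a) @ v) = F v" by (intro F_append v)
    then show "\<exists>e\<in>L. length e = n \<and> starts e \<and> F e = F u"
      using a v n by (intro bexI[of _ "w @ a @ v"]) (auto simp: starts_def)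
  qed
qed

end

section \<open>Gates and the stabilized group\<close>

definition blk :: "nat \<Rightarrow> (int \<Rightarrow> 'a) \<Rightarrow> int \<Rightarrow> 'a list" where
  "blk N x j = win x (int N * j) N"

text \<open>The permutation acts on all aligned blocks of length \<open>N\<close> at once. Such maps
  commute with the \<open>N\<close>-th power of the shift but in general not with the shift, so they
  live naturally in the stabilized group.\<close>

definition gate :: "nat \<Rightarrow> ('a list \<Rightarrow> 'a list) \<Rightarrow> (int \<Rightarrow> 'a) \<Rightarrow> int \<Rightarrow> 'a" where
  "gate N \<pi> x = (\<lambda>i. \<pi> (blk N x (i div int N)) ! nat (i mod int N))"

lemma length_blk [simp]: "length (blk N x j) = N"
  by (simp add: blk_def)

lemma blk_gate:
  assumes "N > 0" "length (\<pi> (blk N x j)) = N"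
  shows "blk N (gate N \<pi> x) j = \<pi> (blk N x j)"
proof (rule nth_equalityI)
  fix k assume "k < length (blk N (gate N \<pi> x) j)"
  then have k: "k < N" by simp
  then have "(int N * j + int k) div int N = j" "(int N * j + int k) mod int N = int k"
    by simp_all
  moreover have "blk N (gate N \<pi> x) j ! k = gate N \<pi> x (int N * j + int k)"
    using k by (simp add: blk_def)
  ultimately show "blk N (gate N \<pi> x) j ! k = \<pi> (blk N x j) ! k"
    by (simp add: gate_def)
qed (use assms in simp)

lemma nth_blk: "N > 0 \<Longrightarrow> x i = blk N x (i div int N) ! nat (i mod int N)"
  by (simp add: blk_def nat_less_iff)

lemma blk_eqI:
  assumes "N > 0" "\<And>j. blk N x j = blk N y j"
  shows "x = y"
proof
  fix i show "x i = y i"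
    using nth_blk[OF assms(1), of x i] nth_blk[OF assms(1), of y i] assms(2) by simp
qed

lemma blk_sh: "blk N (sh (int N * k) x) j = blk N x (j + k)"
  by (simp add: blk_def win_sh algebra_simps)

lemma gate_sh:
  assumes "N > 0" "\<And>u. length u = N \<Longrightarrow> length (\<pi> u) = N"
  shows "gate N \<pi> (sh (int N * k) x) = sh (int N * k) (gate N \<pi> x)"
  by (rule blk_eqI[OF assms(1)]) (simp add: blk_gate blk_sh assms)

text \<open>Preservation of contexts is what keeps a gate inside the subshift; bijectivity on words
  of length \<open>N\<close> makes it invertible.\<close>

definition adm :: "(int \<Rightarrow> 'a) set \<Rightarrow> nat \<Rightarrow> ('a list \<Rightarrow> 'a list) \<Rightarrow> bool" where
  "adm X N \<pi> \<longleftrightarrow> N > 0 \<and> bij_betw \<pi> {u. length u = N} {u. length u = N} \<and>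
     (\<forall>u. length u = N \<longrightarrow> ctx X (\<pi> u) = ctx X u)"

lemma adm_length: "adm X N \<pi> \<Longrightarrow> length u = N \<Longrightarrow> length (\<pi> u) = N"
  by (auto simp: adm_def bij_betw_def)

lemma adm_ctx: "adm X N \<pi> \<Longrightarrow> length u = N \<Longrightarrow> ctx X (\<pi> u) = ctx X u"
  by (auto simp: adm_def)

lemma adm_pos: "adm X N \<pi> \<Longrightarrow> N > 0"
  by (auto simp: adm_def)

lemma adm_comp: "adm X N \<pi> \<Longrightarrow> adm X N \<rho> \<Longrightarrow> adm X N (\<pi> \<circ> \<rho>)"
  using adm_length[of X N \<rho>] by (auto simp: adm_def intro: bij_betw_trans)

lemma adm_involI:
  assumes "N > 0" "\<And>u. length u = N \<Longrightarrow> length (\<pi> u) = N" "\<And>u. length u = N \<Longrightarrow> \<pi> (\<pi> u) = u"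
    "\<And>u. length u = N \<Longrightarrow> ctx X (\<pi> u) = ctx X u"
  shows "adm X N \<pi>"
  unfolding adm_def using assms by (auto intro!: bij_betw_byWitness[where f' = \<pi>])

abbreviation trans :: "'a \<Rightarrow> 'a \<Rightarrow> 'a \<Rightarrow> 'a" where
  "trans \<equiv> Transposition.transpose"

lemma adm_transpose:
  assumes "N > 0" "length p = N" "length q = N" "ctx X p = ctx X q"
  shows "adm X N (trans p q)"
  by (rule adm_involI) (use assms in \<open>auto simp: Transposition.transpose_def\<close>)

lemma adm_inverse:
  assumes "adm X N \<pi>"
  obtains \<rho> where "adm X N \<rho>" "\<And>u. length u = N \<Longrightarrow> \<pi> (\<rho> u) = u" "\<And>u. length u = N \<Longrightarrow> \<rho> (\<pi> u) = u"
proof -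
  define \<rho> where "\<rho> = inv_into {u. length u = N} \<pi>"
  have b: "bij_betw \<pi> {u. length u = N} {u. length u = N}" using assms by (simp add: adm_def)
  then have b': "bij_betw \<rho> {u. length u = N} {u. length u = N}"
    unfolding \<rho>_def by (rule bij_betw_inv_into)
  have 1: "\<pi> (\<rho> u) = u" if "length u = N" for u
    using bij_betw_inv_into_right[OF b, of u] that by (simp add: \<rho>_def)
  have 2: "\<rho> (\<pi> u) = u" if "length u = N" for u
    using bij_betw_inv_into_left[OF b, of u] that by (simp add: \<rho>_def)
  have l: "length (\<rho> u) = N" if "length u = N" for u
    using b' that by (auto simp: bij_betw_def)
  have "ctx X (\<rho> u) = ctx X u" if "length u = N" for u
    using adm_ctx[OF assms l[OF that]] 1[OF that] by simp
  then have "adm X N \<rho>" using b' assms by (auto simp: adm_def)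
  with 1 2 show thesis by (intro that) auto
qed

lemma gate_gate: "adm X N \<rho> \<Longrightarrow> adm X N \<pi> \<Longrightarrow> gate N \<pi> (gate N \<rho> x) = gate N (\<pi> \<circ> \<rho>) x"
proof -
  assume a: "adm X N \<rho>" "adm X N \<pi>"
  have N: "N > 0" using a(1) by (rule adm_pos)
  have "blk N (gate N \<pi> (gate N \<rho> x)) j = blk N (gate N (\<pi> \<circ> \<rho>) x) j" for j
    using a N adm_length[OF a(1)] adm_length[OF a(2)] by (simp add: blk_gate)
  then show ?thesis by (rule blk_eqI[OF N])
qed

lemma gate_ident: "N > 0 \<Longrightarrow> (\<And>u. length u = N \<Longrightarrow> \<pi> u = u) \<Longrightarrow> gate N \<pi> x = x"
  by (rule blk_eqI) (auto simp: blk_gate)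

context subshift_space
begin

lemma win_sub:
  assumes "win y i n \<in> L" "i \<le> i'" "i' + int n' \<le> i + int n"
  shows "win y i' n' \<in> L"
proof -
  define a where "a = nat (i' - i)"
  define b where "b = n - a - n'"
  have n: "n = a + (n' + b)" "i + int a = i'" using assms(2,3) by (auto simp: a_def b_def)
  have "win y i n = win y i a @ win y i' n' @ win y (i' + int n') b"
    unfolding n(1) win_add n(2) ..
  then show ?thesis using assms(1) L_appendD1 L_appendD2 by metis
qed

text \<open>The blocks are replaced one after another; each replacement keeps the context and hence
  membership of the surrounding word in the language.\<close>

lemma gate_X: 
  assumes "adm X N \<pi>" "x \<in> X"
  shows "gate N \<pi> x \<in> X"
proof (rule in_X_if_win)
  fix R
  let ?y = "gate N \<pi> x"
  have N: "N > 0" using assms by (simp add: adm_def)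
  have step: "win z (int N * j) (N * Suc n) = win z (int N * j) (N * n) @ blk N z (j + int n)" for z :: "int \<Rightarrow> 'a" and j n
    using win_add[of z "int N * j" "N * n" N] by (simp add: blk_def algebra_simps)
  have "a @ win ?y (int N * j) (N * n) @ b \<in> L \<longleftrightarrow> a @ win x (int N * j) (N * n) @ b \<in> L" for a b j n
  proof (induction n arbitrary: b)
    case (Suc n)
    have "ctx X (blk N ?y (j + int n)) = ctx X (blk N x (j + int n))"
      using assms by (simp add: blk_gate N adm_length adm_ctx)
    from ctxD[OF this, of "a @ win ?y (int N * j) (N * n)" b] Suc.IH[of "blk N x (j + int n) @ b"]
    show ?case unfolding step by simp
  qed simp
  \<comment> \<open>\<open>Suc R\<close> blocks on each side cover the positions from
    \<open>- R\<close> to \<open>R\<close>, because a block has at least one letter.\<close>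
  from this[of "[]" "- int (Suc R)" "2 * Suc R" "[]"]
  have "win ?y (int N * (- int (Suc R))) (N * (2 * Suc R)) \<in> L"
    using win_in_L[OF assms(2)] by (simp only: append_Nil append_Nil2)
  moreover have "int N * int (Suc R) \<ge> int (Suc R)" using N
    by (metis One_nat_def Suc_leI mult_le_mono1 nat_mult_1 of_nat_le_iff of_nat_mult)
  ultimately show "win ?y (- int R) (2 * R + 1) \<in> L"
    by (elim win_sub) (auto simp: algebra_simps)
qed

lemma gate_local: "N > 0 \<Longrightarrow> \<exists>S. \<forall>x\<in>X. \<forall>y\<in>X. agree S x y \<longrightarrow> gate N \<pi> x i = gate N \<pi> y i"
proof (intro exI ballI impI)
  fix x y :: "int \<Rightarrow> 'a"
  assume N: "N > 0" and ag: "agree (nat \<bar>int N * (i div int N)\<bar> + N) x y"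
  have "blk N x (i div int N) = blk N y (i div int N)"
    unfolding blk_def by (rule win_eqI) (use ag in \<open>auto simp: agree_def\<close>)
  then show "gate N \<pi> x i = gate N \<pi> y i" by (simp add: gate_def)
qed

lemma AutI:
  assumes "\<And>x. x \<in> X \<Longrightarrow> f x \<in> X" "\<And>x. x \<in> X \<Longrightarrow> f' x \<in> X"
    "\<And>x. x \<in> X \<Longrightarrow> f' (f x) = x" "\<And>x. x \<in> X \<Longrightarrow> f (f' x) = x"
    and loc: "\<And>i. \<exists>S. \<forall>x\<in>X. \<forall>y\<in>X. agree S x y \<longrightarrow> f x i = f y i"
      "\<And>i. \<exists>S. \<forall>x\<in>X. \<forall>y\<in>X. agree S x y \<longrightarrow> f' x i = f' y i"
    and comm: "\<And>x. x \<in> X \<Longrightarrow> f (sh (int n) x) = sh (int n) (f x)"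
  shows "restrict f X \<in> Aut space_top (shift ^^ n)"
proof -
  have s: "subshift_space A X" by unfold_locales
  have "continuous_map space_top space_top (restrict f X)" "continuous_map space_top space_top (restrict f' X)"
    using assms by (auto intro!: local_imp_continuous[OF s s])
  then have "homeomorphic_maps space_top space_top (restrict f X) (restrict f' X)"
    using assms by (auto simp: homeomorphic_maps_def)
  then have "homeomorphic_map space_top space_top (restrict f X)"
    using homeomorphic_map_maps by blast
  moreover have "bij_betw f X X"
    by (rule bij_betw_byWitness[where f' = f']) (use assms in auto)
  then have "restrict f X \<in> Bij X"
    by (simp add: Bij_def bij_betw_restrict_eq)
  ultimately show ?thesis
    using comm by (simp add: Aut_def Homeo_def shift_funpow)
qed

lemma gate_Aut:
  assumes "adm X N \<pi>"
  shows "restrict (gate N \<pi>) X \<in> Aut space_top (shift ^^ N)"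
proof -
  obtain \<rho> where \<rho>: "adm X N \<rho>" "\<And>u. length u = N \<Longrightarrow> \<pi> (\<rho> u) = u" "\<And>u. length u = N \<Longrightarrow> \<rho> (\<pi> u) = u"
    using adm_inverse[OF assms] by blast
  have N: "N > 0" using assms by (rule adm_pos)
  show ?thesis
  proof (rule AutI[where f' = "gate N \<rho>"])
    fix x :: "int \<Rightarrow> 'a"
    show "gate N \<rho> (gate N \<pi> x) = x" "gate N \<pi> (gate N \<rho> x) = x"
      using \<rho> assms N by (simp_all add: gate_gate gate_ident)
    show "gate N \<pi> (sh (int N) x) = sh (int N) (gate N \<pi> x)"
      using gate_sh[OF N, of \<pi> 1 x] adm_length[OF assms] by simp
  qed (use gate_X gate_local \<rho> assms N in auto)
qed

lemma sh_Aut: "restrict (sh k) X \<in> Aut space_top (shift ^^ n)"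
proof (rule AutI[where f' = "sh (- k)"])
  fix i
  have "\<exists>S. \<forall>x\<in>X. \<forall>y\<in>X. agree S x y \<longrightarrow> sh m x i = sh m y i" for m :: int
    by (rule exI[of _ "nat \<bar>i + m\<bar>"]) (auto simp: agree_def sh_apply)
  then show "\<exists>S. \<forall>x\<in>X. \<forall>y\<in>X. agree S x y \<longrightarrow> sh k x i = sh k y i"
    "\<exists>S. \<forall>x\<in>X. \<forall>y\<in>X. agree S x y \<longrightarrow> sh (- k) x i = sh (- k) y i" by blast+
qed (auto simp: algebra_simps)

section \<open>The group structure of the stabilized automorphism group\<close>

abbreviation G :: "((int \<Rightarrow> 'a) \<Rightarrow> int \<Rightarrow> 'a) monoid" where
  "G \<equiv> stabilized_Aut space_top shift"

abbreviation AutN :: "nat \<Rightarrow> ((int \<Rightarrow> 'a) \<Rightarrow> int \<Rightarrow> 'a) set" where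
  "AutN n \<equiv> Aut space_top (shift ^^ n)"

lemma AutN_D:
  assumes "f \<in> AutN n"
  shows "f \<in> Bij X" "bij_betw f X X" "f \<in> extensional X" "\<And>x. x \<in> X \<Longrightarrow> f x \<in> X"
    "\<And>x. x \<in> X \<Longrightarrow> f (sh (int n) x) = sh (int n) (f x)" "continuous_map space_top space_top f"
    "inj_on f X"
  using assms
  by (auto simp: Aut_def Homeo_def Bij_def shift_funpow bij_betw_def homeomorphic_imp_continuous_map)

lemma AutN_sh:
  assumes "f \<in> AutN n" "x \<in> X"
  shows "f (sh (int n * k) x) = sh (int n * k) (f x)"
proof (induction k rule: int_induct[where k = 0])
  case (step1 i)
  then show ?case using AutN_D(5)[OF assms(1), of "sh (int n * i) x"] assms(2) by (simp add: algebra_simps)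
next
  case (step2 i)
  have "sh (int n) (f (sh (int n * (i - 1)) x)) = f (sh (int n * i) x)"
    using AutN_D(5)[OF assms(1), of "sh (int n * (i - 1)) x"] assms(2) by (simp add: algebra_simps)
  then have "sh (- int n) (sh (int n) (f (sh (int n * (i - 1)) x))) = sh (- int n) (sh (int n * i) (f x))"
    using step2 by simp
  then show ?case by (simp add: algebra_simps)
qed simp

lemma AutN_iff:
  assumes "f \<in> AutN n"
  shows "f \<in> AutN m \<longleftrightarrow> (\<forall>x\<in>X. f (sh (int m) x) = sh (int m) (f x))"
  using assms by (auto simp: Aut_def shift_funpow)

lemma AutN_dvd:
  assumes "f \<in> AutN n" "n dvd m"
  shows "f \<in> AutN m"
proof -
  obtain k where "m = n * k" using assms(2) by blast
  then show ?thesis using AutN_iff[OF assms(1), of m] AutN_sh[OF assms(1), of _ "int k"] by simp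
qed

lemma carrier_G: "carrier G = (\<Union>n\<in>{1..}. AutN n)"
  by (simp add: stabilized_Aut_def)

lemma AutN_G: "f \<in> AutN n \<Longrightarrow> n > 0 \<Longrightarrow> f \<in> carrier G"
  unfolding carrier_G by (rule UN_I[of n]) auto

lemma G_AutN: "f \<in> carrier G \<Longrightarrow> (\<And>n. n > 0 \<Longrightarrow> f \<in> AutN n \<Longrightarrow> P) \<Longrightarrow> P"
proof -
  assume "f \<in> carrier G" and *: "\<And>n. n > 0 \<Longrightarrow> f \<in> AutN n \<Longrightarrow> P"
  then obtain n where "n \<in> {1..}" "f \<in> AutN n" unfolding carrier_G by (elim UN_E)
  then show P using *[of n] by simp
qed

lemma mult_G: "f \<in> carrier G \<Longrightarrow> g \<in> carrier G \<Longrightarrow> f \<otimes>\<^bsub>G\<^esub> g = compose X f g"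
  by (auto simp: stabilized_Aut_def BijGroup_def elim!: G_AutN dest: AutN_D(1))

lemma one_G: "\<one>\<^bsub>G\<^esub> = restrict id X"
  by (simp add: stabilized_Aut_def BijGroup_def id_def)

lemma compose_AutN:
  assumes "f \<in> AutN n" "g \<in> AutN n"
  shows "compose X f g \<in> AutN n"
proof -
  have "homeomorphic_map space_top space_top (compose X f g)"
    by (rule homeomorphic_map_eq[of _ _ "f \<circ> g"])
      (use assms in \<open>auto simp: Aut_def Homeo_def compose_def intro: homeomorphic_map_compose\<close>)
  moreover have "compose X f g \<in> Bij X"
    using assms by (simp add: compose_Bij AutN_D(1))
  moreover have "compose X f g (sh (int n) x) = sh (int n) (compose X f g x)" if "x \<in> X" for x
    using that AutN_D(4,5)[OF assms(1)] AutN_D(4,5)[OF assms(2)] by (simp add: compose_def)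
  ultimately show ?thesis by (simp add: Aut_def Homeo_def shift_funpow)
qed

lemma inverse_AutN:
  assumes "f \<in> AutN n"
  shows "restrict (inv_into X f) X \<in> AutN n"
proof -
  have b: "bij_betw f X X" using AutN_D[OF assms] by blast
  have inv: "inv_into X f x \<in> X" "f (inv_into X f x) = x" if "x \<in> X" for x
    using that b by (auto simp: bij_betw_def inv_into_into f_inv_into_f)
  have "homeomorphic_map space_top space_top f" using assms by (auto simp: Aut_def Homeo_def)
  then obtain g where g: "homeomorphic_maps space_top space_top f g"
    using homeomorphic_map_maps by blast
  have "g x = restrict (inv_into X f) X x" if "x \<in> X" for x
  proof -
    have "f (g x) = x" "g x \<in> X"
      using g that by (auto simp: homeomorphic_maps_def continuous_map_def)
    then show ?thesis
      using that b inv_into_f_f[of f X "g x"] by (simp add: bij_betw_def)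
  qed
  moreover have "homeomorphic_map space_top space_top g" using g homeomorphic_map_maps homeomorphic_maps_sym by blast
  ultimately have "homeomorphic_map space_top space_top (restrict (inv_into X f) X)"
    using homeomorphic_map_eq topspace_top by metis
  moreover have "restrict (inv_into X f) X \<in> Bij X"
    using AutN_D(1)[OF assms] by (rule restrict_inv_into_Bij)
  moreover have "inv_into X f (sh (int n) x) = sh (int n) (inv_into X f x)" if "x \<in> X" for x
  proof -
    have "f (sh (int n) (inv_into X f x)) = sh (int n) x"
      using AutN_D(5)[OF assms, of "inv_into X f x"] inv that by simp
    then show ?thesis using inv_into_f_f[of f X "sh (int n) (inv_into X f x)"] b inv that
      by (simp add: bij_betw_def)
  qed
  ultimately show ?thesis by (simp add: Aut_def Homeo_def shift_funpow)
qed

lemma group_G: "group G"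
proof (rule groupI)
  fix f g assume "f \<in> carrier G" "g \<in> carrier G"
  then obtain n m where "n > 0" "f \<in> AutN n" "m > 0" "g \<in> AutN m" by (elim G_AutN) auto
  then have "f \<in> AutN (n * m)" "g \<in> AutN (n * m)" "n * m > 0"
    using AutN_dvd by auto
  then show "f \<otimes>\<^bsub>G\<^esub> g \<in> carrier G"
    using mult_G AutN_G compose_AutN \<open>f \<in> carrier G\<close> \<open>g \<in> carrier G\<close> by metis
next
  have "restrict (sh 0) X \<in> AutN 1" by (rule sh_Aut)
  moreover have "restrict (sh 0) X = restrict id X" by auto
  ultimately show one: "\<one>\<^bsub>G\<^esub> \<in> carrier G" using AutN_G[of _ 1] by (simp add: one_G)
  fix f assume f: "f \<in> carrier G"
  then obtain n where n: "n > 0" "f \<in> AutN n" by (elim G_AutN) auto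
  show "\<one>\<^bsub>G\<^esub> \<otimes>\<^bsub>G\<^esub> f = f"
    using mult_G[OF one f] AutN_D[OF n(2)] by (auto simp: one_G compose_def fun_eq_iff extensional_def)
  let ?g = "restrict (inv_into X f) X"
  have g: "?g \<in> carrier G" using inverse_AutN[OF n(2)] n(1) AutN_G by blast
  have "compose X ?g f = restrict id X"
    using Bij_compose_restrict_eq[OF AutN_D(1)[OF n(2)]] by (simp add: id_def)
  then show "\<exists>g\<in>carrier G. g \<otimes>\<^bsub>G\<^esub> f = \<one>\<^bsub>G\<^esub>"
    using mult_G[OF g f] g by (auto simp: one_G)
next
  fix f g h assume f: "f \<in> carrier G" and g: "g \<in> carrier G" and h: "h \<in> carrier G"
  interpret B: group "BijGroup X" by (rule group_BijGroup)
  have "f \<in> Bij X" "g \<in> Bij X" "h \<in> Bij X"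
    using f g h by (auto elim!: G_AutN dest: AutN_D(1))
  then show "f \<otimes>\<^bsub>G\<^esub> g \<otimes>\<^bsub>G\<^esub> h = f \<otimes>\<^bsub>G\<^esub> (g \<otimes>\<^bsub>G\<^esub> h)"
    using B.m_assoc[of f g h] by (simp add: stabilized_Aut_def BijGroup_def)
qed

lemma mult_G_apply: "f \<in> carrier G \<Longrightarrow> g \<in> carrier G \<Longrightarrow> x \<in> X \<Longrightarrow> (f \<otimes>\<^bsub>G\<^esub> g) x = f (g x)"
  by (simp add: mult_G compose_def)

lemma G_ext: "f \<in> carrier G \<Longrightarrow> g \<in> carrier G \<Longrightarrow> (\<And>x. x \<in> X \<Longrightarrow> f x = g x) \<Longrightarrow> f = g"
  by (metis (no_types, lifting) AutN_D(3) G_AutN extensionalityI)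

lemma G_X: "f \<in> carrier G \<Longrightarrow> x \<in> X \<Longrightarrow> f x \<in> X"
  by (metis AutN_D(4) G_AutN)

lemma pow_G_apply:
  assumes "f \<in> carrier G" "x \<in> X"
  shows "(f [^]\<^bsub>G\<^esub> (n::nat)) x = (f ^^ n) x"
proof -
  interpret group G by (rule group_G)
  show ?thesis
    using assms(2)
  proof (induction n arbitrary: x)
    case 0
    then show ?case by (simp add: one_G)
  next
    case (Suc n)
    then show ?case
      using assms(1) G_X[OF assms(1)] by (simp add: mult_G_apply funpow_swap1)
  qed
qed

end

section \<open>Block configurations and the swap dynamics\<close>

lemma gate_fixed_iff:
  assumes "N > 0" "\<And>u. length u = N \<Longrightarrow> length (\<pi> u) = N"
  shows "gate N \<pi> x = x \<longleftrightarrow> (\<forall>j. \<pi> (blk N x j) = blk N x j)"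
proof
  assume "gate N \<pi> x = x"
  then show "\<forall>j. \<pi> (blk N x j) = blk N x j"
    using blk_gate[OF assms(1), of \<pi> x] assms(2) by (metis length_blk)
next
  assume "\<forall>j. \<pi> (blk N x j) = blk N x j"
  then have "blk N (gate N \<pi> x) j = blk N x j" for j
    using blk_gate[OF assms(1), of \<pi> x j] assms(2)[of "blk N x j"] by simp
  then show "gate N \<pi> x = x" by (rule blk_eqI[OF assms(1)])
qed

lemma blk_double: "blk (2 * l) x j = blk l x (2 * j) @ blk l x (2 * j + 1)"
proof -
  have e: "2 * l = l + l" "int (l + l) * j = int l * (2 * j)" "int l * (2 * j) + int l = int l * (2 * j + 1)"
    by (simp_all add: algebra_simps)
  show ?thesis
    unfolding blk_def e(1) win_add e(2,3) ..
qed

lemma blk_triple: "blk (3 * l) x j = blk l x (3 * j) @ blk l x (3 * j + 1) @ blk l x (3 * j + 2)"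
proof -
  have e: "3 * l = l + (l + l)" "int (l + (l + l)) * j = int l * (3 * j)"
    "int l * (3 * j) + int l = int l * (3 * j + 1)" "int l * (3 * j + 1) + int l = int l * (3 * j + 2)"
    by (simp_all add: algebra_simps)
  show ?thesis
    unfolding blk_def e(1) win_add e(2,3,4) ..
qed

definition pt :: "nat \<Rightarrow> (int \<Rightarrow> 'a list) \<Rightarrow> int \<Rightarrow> 'a" where
  "pt l c = (\<lambda>i. c (i div int l) ! nat (i mod int l))"

lemma blk_pt:
  assumes "l > 0" "length (c j) = l"
  shows "blk l (pt l c) j = c j"
proof (rule nth_equalityI)
  fix k assume "k < length (blk l (pt l c) j)"
  then have k: "k < l" by simp
  then have "(int l * j + int k) div int l = j" "(int l * j + int k) mod int l = int k"
    by simp_all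
  moreover have "blk l (pt l c) j ! k = pt l c (int l * j + int k)"
    using k by (simp add: blk_def)
  ultimately show "blk l (pt l c) j ! k = c j ! k"
    by (simp add: pt_def)
qed (use assms in simp)

text \<open>Continuity in coordinates: every output letter depends on a finite window, which may
  vary with the position.\<close>

definition is_local :: "(int \<Rightarrow> 'a) set \<Rightarrow> ((int \<Rightarrow> 'a) \<Rightarrow> int \<Rightarrow> 'a) \<Rightarrow> bool" where
  "is_local X f \<longleftrightarrow> (\<forall>i. \<exists>S. \<forall>x\<in>X. \<forall>y\<in>X. agree S x y \<longrightarrow> f x i = f y i)"

lemma is_local_comp:
  assumes "is_local X f" "is_local X g" "\<And>x. x \<in> X \<Longrightarrow> g x \<in> X"
  shows "is_local X (\<lambda>x. f (g x))"
  unfolding is_local_def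
proof
  fix i
  obtain S where S: "\<And>x y. x \<in> X \<Longrightarrow> y \<in> X \<Longrightarrow> agree S x y \<Longrightarrow> f x i = f y i"
    using assms(1) unfolding is_local_def by meson
  obtain r where r: "\<And>k x y. x \<in> X \<Longrightarrow> y \<in> X \<Longrightarrow> agree (r k) x y \<Longrightarrow> g x k = g y k"
    using assms(2) unfolding is_local_def by metis
  define T where "T = Max (r ` {- int S..int S})"
  have T: "r k \<le> T" if "\<bar>k\<bar> \<le> int S" for k
    unfolding T_def using that by (intro Max_ge finite_imageI imageI) auto
  have "f (g x) i = f (g y) i" if "x \<in> X" "y \<in> X" "agree T x y" for x y
  proof (rule S)
    show "agree S (g x) (g y)"
      unfolding agree_def using r[OF that(1,2)] T agree_mono[OF that(3)] by blast
  qed (use that assms(3) in auto)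
  then show "\<exists>S. \<forall>x\<in>X. \<forall>y\<in>X. agree S x y \<longrightarrow> f (g x) i = f (g y) i" by blast
qed

section \<open>Gates exchanging return blocks\<close>

context mixing_sofic
begin

definition swp :: "nat \<Rightarrow> 'a list \<Rightarrow> 'a list" where
  "swp l u = (if take l u \<in> R l \<and> drop l u \<in> R l then drop l u @ take l u else u)"

lemma swp_append:
  assumes "length c = l"
  shows "swp l (c @ d) = (if c \<in> R l \<and> d \<in> R l then d @ c else c @ d)"
  using assms by (simp add: swp_def)

lemma length_swp: "length u = 2 * l \<Longrightarrow> length (swp l u) = 2 * l"
  by (simp add: swp_def)

text \<open>Both orders of two return blocks begin with \<open>w\<close> and have the followers of
  \<open>w\<close>, so their contexts agree.\<close>

lemma adm_swp:
  assumes "l > 0"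
  shows "adm X (2 * l) (swp l)"
proof (rule adm_involI)
  fix u :: "'a list" assume u: "length u = 2 * l"
  show "swp l (swp l u) = u"
    using u by (auto simp: swp_def)
  have "ctx X (drop l u @ take l u) = ctx X (take l u @ drop l u)"
    if "take l u \<in> R l" "drop l u \<in> R l"
  proof (rule ctx_eqI)
    show "F (drop l u @ take l u) = F (take l u @ drop l u)"
      using that by (simp only: R_append_F R_starts R_F)
  qed (intro starts_append R_starts; use that in blast)+
  then show "ctx X (swp l u) = ctx X u"
    by (simp add: swp_def)
qed (use assms in \<open>auto simp: length_swp\<close>)

lemma adm_pair:
  assumes "l > 0" "c \<in> R l" "d \<in> R l" "c' \<in> R l" "d' \<in> R l"
  shows "adm X (2 * l) (trans (c @ d) (c' @ d'))"
proof (rule adm_transpose)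
  show "ctx X (c @ d) = ctx X (c' @ d')"
    by (rule ctx_eqI) (use assms R_append_F R_starts R_F in auto)
qed (use assms R_length in auto)

end

text \<open>\<open>g\<close> is an element commuting with the shift and with all test gates of block
  length \<open>2 * l\<close> and \<open>3 * l\<close>. The block \<open>z\<close> plays the vacuum
  and \<open>a\<close> a particle; \<open>b\<close> is kept out of the test configurations, which
  supplies pairs that certainly do not occur in them.\<close>

locale swap_centralizer = mixing_sofic A X w M for A :: "'a set" and X w M +
  fixes l :: nat and z a b :: "'a list" and g :: "(int \<Rightarrow> 'a) \<Rightarrow> int \<Rightarrow> 'a"
  assumes l_pos: "l > 0"
    and zR: "z \<in> R l" and aR: "a \<in> R l" and bR: "b \<in> R l"
    and dist: "a \<noteq> z" "b \<noteq> z" "a \<noteq> b"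
    and reach_l: "\<And>u. u \<in> L \<Longrightarrow> starts u \<Longrightarrow> \<exists>e\<in>L. length e = l \<and> starts e \<and> F e = F u"
    and gX: "\<And>x. x \<in> X \<Longrightarrow> g x \<in> X"
    and g_inj: "inj_on g X"
    and g_local: "is_local X g"
    and g_sh: "\<And>x k. x \<in> X \<Longrightarrow> g (sh k x) = sh k (g x)"
    and g_swp: "\<And>x. x \<in> X \<Longrightarrow> g (gate (2 * l) (swp l) x) = gate (2 * l) (swp l) (g x)"
    and g_pair: "\<And>x c d c' d'. x \<in> X \<Longrightarrow> c \<in> R l \<Longrightarrow> d \<in> R l \<Longrightarrow> c' \<in> R l \<Longrightarrow> d' \<in> R l \<Longrightarrow>
      g (gate (2 * l) (trans (c @ d) (c' @ d')) x) =
      gate (2 * l) (trans (c @ d) (c' @ d')) (g x)"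
    and g_triple: "\<And>x p q. x \<in> X \<Longrightarrow> p \<in> L \<Longrightarrow> q \<in> L \<Longrightarrow> starts p \<Longrightarrow> starts q \<Longrightarrow>
      length p = 3 * l \<Longrightarrow> length q = 3 * l \<Longrightarrow> F p = F q \<Longrightarrow>
      g (gate (3 * l) (trans p q) x) = gate (3 * l) (trans p q) (g x)"
begin

abbreviation B :: "(int \<Rightarrow> 'a) \<Rightarrow> int \<Rightarrow> 'a list" where "B \<equiv> blk l"

lemma B_eqI: "(\<And>j. B x j = B y j) \<Longrightarrow> x = y"
  by (rule blk_eqI[OF l_pos])

lemma B_sh: "B (sh (int l * k) x) j = B x (j + k)"
  by (rule blk_sh)

text \<open>A gate whose block grid starts at the \<open>k\<close>-th block of length
  \<open>l\<close> instead of at the origin. Here \<open>N\<close> is a multiple of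
  \<open>l\<close>, and \<open>k\<close> selects one of its alignments.\<close>

definition phased :: "nat \<Rightarrow> ('a list \<Rightarrow> 'a list) \<Rightarrow> int \<Rightarrow> (int \<Rightarrow> 'a) \<Rightarrow> int \<Rightarrow> 'a" where
  "phased N \<pi> k x = sh (int l * (- k)) (gate N \<pi> (sh (int l * k) x))"

lemma phased_X: "adm X N \<pi> \<Longrightarrow> x \<in> X \<Longrightarrow> phased N \<pi> k x \<in> X"
  by (simp add: phased_def gate_X)

lemma phased_g:
  assumes "adm X N \<pi>" "x \<in> X" "\<And>x. x \<in> X \<Longrightarrow> g (gate N \<pi> x) = gate N \<pi> (g x)"
  shows "g (phased N \<pi> k x) = phased N \<pi> k (g x)"
  using assms by (simp add: phased_def g_sh gate_X)

lemma phased_inj: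
  assumes "adm X N \<pi>" "phased N \<pi> k x = phased N \<pi> k y"
  shows "x = y"
proof -
  obtain \<rho> where \<rho>: "adm X N \<rho>" "\<And>u. length u = N \<Longrightarrow> \<pi> (\<rho> u) = u" "\<And>u. length u = N \<Longrightarrow> \<rho> (\<pi> u) = u"
    using adm_inverse[OF assms(1)] by blast
  have inv: "gate N \<rho> (gate N \<pi> x) = x" for x :: "int \<Rightarrow> 'a"
    using \<rho> adm_pos[OF assms(1)] by (simp add: gate_gate[OF assms(1) \<rho>(1)] gate_ident)
  have "sh (int l * k) (phased N \<pi> k x) = sh (int l * k) (phased N \<pi> k y)"
    using assms(2) by simp
  then have "gate N \<pi> (sh (int l * k) x) = gate N \<pi> (sh (int l * k) y)"
    by (simp add: phased_def)
  then have "sh (int l * k) x = sh (int l * k) y"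
    using inv by metis
  then have "sh (int l * (- k)) (sh (int l * k) x) = sh (int l * (- k)) (sh (int l * k) y)"
    by simp
  then show ?thesis by simp
qed

definition S :: "int \<Rightarrow> (int \<Rightarrow> 'a) \<Rightarrow> int \<Rightarrow> 'a" where
  "S k = phased (2 * l) (swp l) k"

lemma adm_S: "adm X (2 * l) (swp l)"
  by (rule adm_swp[OF l_pos])

lemma S_X: "x \<in> X \<Longrightarrow> S k x \<in> X"
  unfolding S_def by (rule phased_X[OF adm_S])

lemma g_S: "x \<in> X \<Longrightarrow> g (S k x) = S k (g x)"
  unfolding S_def by (rule phased_g[OF adm_S _ g_swp])

lemma B_swp:
  "B (gate (2 * l) (swp l) x) (2 * i) = (if B x (2 * i) \<in> R l \<and> B x (2 * i + 1) \<in> R l then B x (2 * i + 1) else B x (2 * i))"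
  "B (gate (2 * l) (swp l) x) (2 * i + 1) = (if B x (2 * i) \<in> R l \<and> B x (2 * i + 1) \<in> R l then B x (2 * i) else B x (2 * i + 1))"
proof -
  have "blk (2 * l) (gate (2 * l) (swp l) x) i = swp l (blk (2 * l) x i)"
    using l_pos by (intro blk_gate) (simp_all add: length_swp)
  then have "B (gate (2 * l) (swp l) x) (2 * i) @ B (gate (2 * l) (swp l) x) (2 * i + 1) =
      (if B x (2 * i) \<in> R l \<and> B x (2 * i + 1) \<in> R l then B x (2 * i + 1) @ B x (2 * i) else B x (2 * i) @ B x (2 * i + 1))"
    unfolding blk_double by (simp add: swp_append)
  then show "B (gate (2 * l) (swp l) x) (2 * i) = (if B x (2 * i) \<in> R l \<and> B x (2 * i + 1) \<in> R l then B x (2 * i + 1) else B x (2 * i))"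
    "B (gate (2 * l) (swp l) x) (2 * i + 1) = (if B x (2 * i) \<in> R l \<and> B x (2 * i + 1) \<in> R l then B x (2 * i) else B x (2 * i + 1))"
    by (auto split: if_splits)
qed

text \<open>The index exchanged with \<open>j\<close> when the pairs start at the positions
  congruent to \<open>k\<close> modulo 2.\<close>

definition partner :: "int \<Rightarrow> int \<Rightarrow> int" where
  "partner k j = (if even (j - k) then j + 1 else j - 1)"

lemma B_S:
  "B (S k x) j = (if B x j \<in> R l \<and> B x (partner k j) \<in> R l then B x (partner k j) else B x j)"
proof -
  have eq: "B (S k x) j = B (gate (2 * l) (swp l) (sh (int l * k) x)) (j - k)"
    unfolding S_def phased_def B_sh by simp
  show ?thesis
  proof (cases "even (j - k)")
    case True
    then obtain i where i: "j - k = 2 * i" by blast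
    then have e: "2 * i + k = j" "2 * i + 1 + k = j + 1" by simp_all
    show ?thesis
      using True unfolding eq i B_swp B_sh partner_def e by simp
  next
    case False
    then obtain i where i: "j - k = 2 * i + 1" by (elim oddE)
    then have e: "2 * i + k = j - 1" "2 * i + 1 + k = j" by simp_all
    show ?thesis
      using False unfolding eq i B_swp B_sh partner_def e by simp
  qed
qed

lemma S_good: "B (S k x) j \<in> R l \<longleftrightarrow> B x j \<in> R l"
  by (simp add: B_S)

text \<open>The phase alternates, so a block exchanged at one step is carried on in the same
  direction at the next one, as long as it meets return blocks. Blocks outside \<open>R l\<close>
  stay in place and act as walls.\<close>

primrec evolve :: "nat \<Rightarrow> (int \<Rightarrow> 'a) \<Rightarrow> int \<Rightarrow> 'a" where
  "evolve 0 x = x"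
| "evolve (Suc t) x = S (int t) (evolve t x)"

lemma evolve_X: "x \<in> X \<Longrightarrow> evolve t x \<in> X"
  by (induction t) (auto simp: S_X)

lemma g_evolve: "x \<in> X \<Longrightarrow> g (evolve t x) = evolve t (g x)"
  by (induction t) (auto simp: g_S evolve_X)

lemma evolve_good: "B (evolve t x) j \<in> R l \<longleftrightarrow> B x j \<in> R l"
  by (induction t) (auto simp: S_good)

text \<open>The content of a position of the parity of the next swap moves right in every step, so left
  of the first bad block these positions eventually carry only \<open>z\<close>; symmetrically on the right.\<close>
lemma evolve_left:
  assumes "\<And>j. j < c \<Longrightarrow> B x j \<in> R l" "\<And>j. j < m \<Longrightarrow> B x j = z"
    and "j < c" "j < m + int t" "even (j - int t)"
  shows "B (evolve t x) j = z"
  using assms(3-5)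
proof (induction t arbitrary: j)
  case 0
  then show ?case using assms(2) by simp
next
  case (Suc t)
  have odd: "odd (j - int t)"
    using Suc.prems(3) by simp
  have "B (evolve t x) (j - 1) = z"
    using Suc.prems odd by (intro Suc.IH) auto
  moreover have "B (evolve t x) j \<in> R l" "B (evolve t x) (j - 1) \<in> R l"
    using assms(1) Suc.prems(1) by (simp_all add: evolve_good)
  ultimately show ?case
    using odd by (simp add: B_S partner_def)
qed

lemma evolve_right:
  assumes "\<And>j. j > c \<Longrightarrow> B x j \<in> R l" "\<And>j. j > m \<Longrightarrow> B x j = z"
    and "j > c" "j > m - int t" "odd (j - int t)"
  shows "B (evolve t x) j = z"
  using assms(3-5)
proof (induction t arbitrary: j)
  case 0
  then show ?case using assms(2) by simp
next
  case (Suc t)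
  have ev: "even (j - int t)"
    using Suc.prems(3) by simp
  have "B (evolve t x) (j + 1) = z"
    using Suc.prems ev by (intro Suc.IH) auto
  moreover have "B (evolve t x) j \<in> R l" "B (evolve t x) (j + 1) \<in> R l"
    using assms(1) Suc.prems(1) by (simp_all add: evolve_good)
  ultimately show ?case
    using ev by (simp add: B_S partner_def)
qed

text \<open>In terms of blocks: homoclinic to the periodic point consisting of copies of
  \<open>z\<close>.\<close>

definition finite_support :: "(int \<Rightarrow> 'a) \<Rightarrow> bool" where
  "finite_support x \<longleftrightarrow> (\<exists>m. \<forall>j. \<bar>j\<bar> > m \<longrightarrow> B x j = z)"

lemma finite_supportD: "finite_support x \<Longrightarrow> \<exists>m\<ge>0. \<forall>j. \<bar>j\<bar> > m \<longrightarrow> B x j = z"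
proof -
  assume "finite_support x"
  then obtain m where "\<forall>j. \<bar>j\<bar> > m \<longrightarrow> B x j = z" by (auto simp: finite_support_def)
  then show ?thesis by (intro exI[of _ "max m 0"]) auto
qed

lemma S_finite_support: "finite_support x \<Longrightarrow> finite_support (S k x)"
proof -
  assume "finite_support x"
  then obtain m where m: "\<And>j. \<bar>j\<bar> > m \<Longrightarrow> B x j = z" by (auto simp: finite_support_def)
  have "B (S k x) j = z" if "\<bar>j\<bar> > m + 1" for j
  proof -
    have "\<bar>j\<bar> > m" "\<bar>partner k j\<bar> > m"
      using that by (auto simp: partner_def)
    then show ?thesis by (simp add: B_S m)
  qed
  then show ?thesis unfolding finite_support_def by blast
qed

lemma evolve_finite_support: "finite_support x \<Longrightarrow> finite_support (evolve t x)"
  by (induction t) (auto simp: S_finite_support)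

definition good :: "(int \<Rightarrow> 'a) \<Rightarrow> bool" where
  "good x \<longleftrightarrow> x \<in> X \<and> finite_support x \<and> (\<forall>j. B x j \<in> R l)"

text \<open>A loop in the middle, prolonged on both sides by return blocks, stays a loop; hence
  every central window lies in the language.\<close>

lemma extend_X:
  assumes loop: "loop (win x (- (int l * int k)) (2 * l * k))"
    and ext: "\<And>j. j < - int k \<or> j \<ge> int k \<Longrightarrow> B x j \<in> R l"
  shows "x \<in> X"
proof (rule in_X_if_win)
  fix r
  have step: "loop (win x (- (int l * int (k + m))) (2 * l * (k + m)))" for m
  proof (induction m)
    case 0
    then show ?case using loop by simp
  next
    case (Suc m)
    have "win x (- (int l * int (k + Suc m))) (l + (2 * l * (k + m) + l)) =
      B x (- int (k + Suc m)) @ win x (- (int l * int (k + m))) (2 * l * (k + m)) @ B x (int (k + m))"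
      unfolding win_add by (simp add: blk_def algebra_simps)
    moreover have "l + (2 * l * (k + m) + l) = 2 * l * (k + Suc m)" by (simp add: algebra_simps)
    moreover have "loop (B x (- int (k + Suc m)))" "loop (B x (int (k + m)))"
      by (rule R_loop, rule ext, simp)+
    ultimately show ?case using Suc.IH loop_append by metis
  qed
  define q where "q = int l * int (k + Suc r)"
  have "1 * int (k + Suc r) \<le> q"
    unfolding q_def using l_pos by (intro mult_right_mono) auto
  then have q: "int r + 1 \<le> q" by simp
  have "int (2 * l * (k + Suc r)) = 2 * q" by (simp add: q_def algebra_simps)
  then show "win x (- int r) (2 * r + 1) \<in> L"
    using loop_L[OF step[of "Suc r"], folded q_def] q by (elim win_sub) auto
qed

lemma pt_X:
  assumes "\<And>j. c j \<in> R l"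
  shows "pt l c \<in> X" "B (pt l c) j = c j"
proof -
  have blk: "B (pt l c) j = c j" for j
    using assms by (intro blk_pt l_pos R_length)
  then show "B (pt l c) j = c j" .
  have "win (pt l c) (- (int l * int 1)) (2 * l * 1) = B (pt l c) (- 1) @ B (pt l c) 0"
    using win_add[of "pt l c" "- int l" l l] by (simp add: blk_def mult_2)
  then have "loop (win (pt l c) (- (int l * int 1)) (2 * l * 1))"
    using assms by (simp only: blk) (intro loop_append R_loop)
  then show "pt l c \<in> X"
    by (rule extend_X) (simp add: blk assms)
qed

lemma good_pt:
  assumes "\<And>j. c j \<in> R l" "\<And>j. \<bar>j\<bar> > m \<Longrightarrow> c j = z"
  shows "good (pt l c)"
  using pt_X[of c] assms unfolding good_def finite_support_def by auto

definition Z0 :: "int \<Rightarrow> 'a" where "Z0 = pt l (\<lambda>_. z)"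

lemma good_Z0: "good Z0" and B_Z0: "B Z0 j = z"
  unfolding Z0_def using good_pt[of "\<lambda>_. z" 0] pt_X[of "\<lambda>_. z"] zR by auto

lemma Z0_X: "Z0 \<in> X"
  using good_Z0 by (simp add: good_def)

lemma pair_fixed_iff:
  assumes "c \<in> R l" "d \<in> R l" "c' \<in> R l" "d' \<in> R l" "(c, d) \<noteq> (c', d')"
  shows "gate (2 * l) (trans (c @ d) (c' @ d')) x = x \<longleftrightarrow>
    (\<forall>i. (B x (2 * i), B x (2 * i + 1)) \<noteq> (c, d) \<and> (B x (2 * i), B x (2 * i + 1)) \<noteq> (c', d'))"
proof -
  have len: "length c = l" "length d = l" "length c' = l" "length d' = l"
    using assms by (auto simp: R_length)
  have ne: "c @ d \<noteq> c' @ d'" using assms(5) len by auto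
  have "gate (2 * l) (trans (c @ d) (c' @ d')) x = x \<longleftrightarrow>
    (\<forall>i. trans (c @ d) (c' @ d') (blk (2 * l) x i) = blk (2 * l) x i)"
    using len l_pos by (intro gate_fixed_iff) (auto simp: Transposition.transpose_def)
  also have "\<dots> \<longleftrightarrow> (\<forall>i. blk (2 * l) x i \<noteq> c @ d \<and> blk (2 * l) x i \<noteq> c' @ d')"
    using ne by (auto simp: Transposition.transpose_def)
  also have "\<dots> \<longleftrightarrow> (\<forall>i. (B x (2 * i), B x (2 * i + 1)) \<noteq> (c, d) \<and> (B x (2 * i), B x (2 * i + 1)) \<noteq> (c', d'))"
    unfolding blk_double using len by (simp add: append_eq_append_conv)
  finally show ?thesis .
qed

text \<open>An injective map commuting with a gate preserves and reflects its fixed points. Together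
  with \<open>pair_fixed_iff\<close> this turns the transpositions into tests for the occurrence of
  pairs of blocks.\<close>

lemma g_pair_fixed_iff:
  assumes x: "x \<in> X" and R: "c \<in> R l" "d \<in> R l" "c' \<in> R l" "d' \<in> R l"
  shows "gate (2 * l) (trans (c @ d) (c' @ d')) (g x) = g x \<longleftrightarrow>
    gate (2 * l) (trans (c @ d) (c' @ d')) x = x"
  using g_pair[OF x R] g_inj x gate_X[OF adm_pair[OF l_pos R] x] by (metis inj_onD)

end

section \<open>Images of finitely supported points\<close>

context swap_centralizer
begin

lemma g_block_local:
  "\<exists>r. \<forall>x\<in>X. \<forall>y\<in>X. \<forall>j j'. (\<forall>k. \<bar>k\<bar> \<le> r \<longrightarrow> B x (j + k) = B y (j' + k)) \<longrightarrow> B (g x) j = B (g y) j'"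
proof -
  obtain S0 where S0: "\<And>x y. x \<in> X \<Longrightarrow> y \<in> X \<Longrightarrow> agree S0 x y \<Longrightarrow> g x 0 = g y 0"
    using g_local unfolding is_local_def by meson
  \<comment> \<open>A window of radius \<open>S0\<close> around a letter of block \<open>j\<close>
    stays between the blocks \<open>j - S0\<close> and \<open>j + S0 + 1\<close>. Commutation of
    \<open>g\<close> with all shifts makes one radius valid for all \<open>j\<close>.\<close>
  have key: "B (g x) j = B (g y) j'"
    if x: "x \<in> X" and y: "y \<in> X" and eq: "\<And>k. \<bar>k\<bar> \<le> int S0 + 1 \<Longrightarrow> B x (j + k) = B y (j' + k)" for x y j j'
  proof (rule nth_equalityI)
    fix k assume "k < length (B (g x) j)"
    then have k: "k < l" by simp
    have nth: "B (g u) i ! k = g (sh (int l * i + int k) u) 0" if "u \<in> X" for u i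
      using k that by (simp add: blk_def g_sh sh_apply)
    have pos: "u (m + int l * i) = B u (i + m div int l) ! nat (m mod int l)" for u :: "int \<Rightarrow> 'a" and m i
      using nth_blk[OF l_pos, of u "m + int l * i"] l_pos by (simp add: add.commute)
    have "agree S0 (sh (int l * j + int k) x) (sh (int l * j' + int k) y)"
      unfolding agree_def
    proof safe
      fix i :: int assume i: "\<bar>i\<bar> \<le> int S0"
      define m where "m = i + int k"
      have "(- int S0) * int l \<le> (- int S0) * 1"
        using l_pos by (intro mult_left_mono_neg) auto
      then have "(- int S0) * int l \<le> m" using i by (simp add: m_def)
      then have lo: "- int S0 \<le> m div int l"
        using zdiv_mono1[of "(- int S0) * int l" m "int l"] l_pos
          nonzero_mult_div_cancel_right[of "int l" "- int S0"] by linarith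
      have "int S0 * 1 \<le> int S0 * int l" using l_pos by (intro mult_left_mono) auto
      then have "m \<le> (int S0 + 1) * int l" using i k by (simp add: m_def algebra_simps)
      then have hi: "m div int l \<le> int S0 + 1"
        using zdiv_mono1[of m "(int S0 + 1) * int l" "int l"] l_pos
          nonzero_mult_div_cancel_right[of "int l" "int S0 + 1"] by linarith
      have "x (m + int l * j) = y (m + int l * j')"
        unfolding pos using eq[of "m div int l"] lo hi by simp
      then show "sh (int l * j + int k) x i = sh (int l * j' + int k) y i"
        by (simp add: sh_apply m_def algebra_simps)
    qed
    then show "B (g x) j ! k = B (g y) j' ! k"
      using S0 x y by (simp add: nth)
  qed simp
  show ?thesis
    by (rule exI[of _ "int S0 + 1"]) (use key in blast)
qed

text \<open>The image is a repetition of one block \<open>u\<close>, not yet known to be a return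
  block. Exchanging \<open>zz\<close> with \<open>aa\<close> moves \<open>Z0\<close>, so
  \<open>u\<close> is \<open>z\<close> or \<open>a\<close>; exchanging \<open>aa\<close> with
  \<open>ab\<close> fixes \<open>Z0\<close>, which excludes \<open>a\<close>.\<close>

lemma g_Z0: "g Z0 = Z0"
proof -
  have "sh (int l * 1) Z0 = Z0"
    by (rule B_eqI) (simp only: B_sh B_Z0)
  then have per: "B (g Z0) (j + 1) = B (g Z0) j" for j
    using g_sh[OF Z0_X, of "int l * 1"] B_sh[of 1 "g Z0" j] by simp
  have const: "B (g Z0) j = B (g Z0) 0" for j
  proof (induction j rule: int_induct[where k = 0])
    case (step2 i)
    then show ?case using per[of "i - 1"] by simp
  qed (use per in auto)
  define u where "u = B (g Z0) 0"
  have u: "B (g Z0) j = u" for j using const u_def by simp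
  have "(z, z) \<noteq> (a, a)" "(a, a) \<noteq> (a, b)" using dist by auto
  note iff = pair_fixed_iff[OF zR zR aR aR this(1)] pair_fixed_iff[OF aR aR aR bR this(2)]
  have "u = z \<or> u = a"
    using g_pair_fixed_iff[OF Z0_X zR zR aR aR] unfolding iff u B_Z0 by auto
  moreover have "u \<noteq> a"
    using g_pair_fixed_iff[OF Z0_X aR aR aR bR] dist unfolding iff u B_Z0 by auto
  ultimately show ?thesis
    by (intro B_eqI) (simp add: B_Z0 u)
qed

text \<open>Far from the support a point looks like \<open>Z0\<close>, which \<open>g\<close>
  fixes.\<close>

lemma g_finite_support:
  assumes "x \<in> X" "finite_support x"
  shows "finite_support (g x)"
proof -
  obtain r where r: "\<And>x y j j'. x \<in> X \<Longrightarrow> y \<in> X \<Longrightarrow> (\<And>k. \<bar>k\<bar> \<le> r \<Longrightarrow> B x (j + k) = B y (j' + k)) \<Longrightarrow> B (g x) j = B (g y) j'"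
    using g_block_local by metis
  obtain m where m: "\<And>j. \<bar>j\<bar> > m \<Longrightarrow> B x j = z" using assms(2) by (auto simp: finite_support_def)
  have "B (g x) j = z" if "\<bar>j\<bar> > m + r" for j
  proof -
    have "B (g x) j = B (g Z0) 0"
    proof (rule r[OF assms(1) Z0_X])
      fix k assume "\<bar>k\<bar> \<le> r"
      then have "B x (j + k) = z" using that by (intro m) auto
      then show "B x (j + k) = B Z0 (0 + k)" by (simp add: B_Z0)
    qed
    then show ?thesis by (simp add: g_Z0 B_Z0)
  qed
  then show ?thesis unfolding finite_support_def by blast
qed

definition tri :: "(int \<Rightarrow> 'a) \<Rightarrow> int \<Rightarrow> 'a list" where
  "tri x j = B x j @ B x (j + 1) @ B x (j + 2)"

lemma length_tri: "length (tri x j) = 3 * l"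
  by (simp add: tri_def)

lemma tri_eq_append:
  assumes "length c = l" "length d = l"
  shows "tri x j = c @ d @ e \<longleftrightarrow> B x j = c \<and> B x (j + 1) = d \<and> B x (j + 2) = e"
  using assms by (simp add: tri_def append_eq_append_conv)

lemma tri_eqD:
  assumes "tri x i = tri y j"
  shows "B x i = B y j" "B x (i + 1) = B y (j + 1)" "B x (i + 2) = B y (j + 2)"
  using assms tri_eq_append[of "B y j" "B y (j + 1)" x i "B y (j + 2)"] by (auto simp: tri_def[of y])

lemma tri_phased:
  assumes "adm X (3 * l) \<pi>"
  shows "tri (phased (3 * l) \<pi> k x) (k + 3 * i) = \<pi> (tri x (k + 3 * i))"
proof -
  have tri: "tri y (k + 3 * i) = blk (3 * l) (sh (int l * k) y) i" for y
    unfolding blk_triple B_sh tri_def by (simp add: algebra_simps)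
  have "sh (int l * k) (phased (3 * l) \<pi> k x) = gate (3 * l) \<pi> (sh (int l * k) x)"
    by (simp add: phased_def)
  then show ?thesis
    unfolding tri using blk_gate[of "3 * l" \<pi> "sh (int l * k) x" i] l_pos adm_length[OF assms]
    by simp
qed

lemma block_in_triple:
  obtains i \<rho> where "j = k + 3 * i + \<rho>" "\<rho> = 0 \<or> \<rho> = 1 \<or> \<rho> = (2::int)"
proof
  show "j = k + 3 * ((j - k) div 3) + (j - k) mod 3" by simp
  show "(j - k) mod 3 = 0 \<or> (j - k) mod 3 = 1 \<or> (j - k) mod 3 = 2" by presburger
qed

lemma tri_eqI:
  assumes "\<And>i. tri x (k + 3 * i) = tri y (k + 3 * i)"
  shows "x = y"
proof (rule B_eqI)
  fix j
  obtain i \<rho> where j: "j = k + 3 * i + \<rho>" "\<rho> = 0 \<or> \<rho> = 1 \<or> \<rho> = 2"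
    by (rule block_in_triple)
  then show "B x j = B y j"
    using tri_eqD[OF assms[of i]] by auto
qed

lemma tri_L: "x \<in> X \<Longrightarrow> tri x j \<in> L"
proof -
  assume x: "x \<in> X"
  have e: "int l * j + int l = int l * (j + 1)" "int l * (j + 1) + int l = int l * (j + 2)"
    by (simp_all add: algebra_simps)
  have "tri x j = win x (int l * j) (l + (l + l))"
    unfolding win_add e tri_def blk_def ..
  then show ?thesis using win_in_L[OF x] by simp
qed

lemma tri_starts: "B x j \<in> R l \<Longrightarrow> starts (tri x j)"
  by (simp add: tri_def R_starts)

text \<open>The repair move. The triple starts with a return block, hence with \<open>w\<close>, so
  its context is given by its followers; the block \<open>e\<close> is chosen with these followers
  and allows the first two blocks to become \<open>a a\<close>.\<close>

lemma eraser:
  assumes "x \<in> X" "B x j \<in> R l"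
  obtains e q where "q = a @ a @ e" "length e = l" "starts e" "e \<in> L" "F e = F (tri x j)"
    "adm X (3 * l) (trans (tri x j) q)"
    "\<And>y. y \<in> X \<Longrightarrow> g (gate (3 * l) (trans (tri x j) q) y) =
        gate (3 * l) (trans (tri x j) q) (g y)"
proof -
  have p: "tri x j \<in> L" "starts (tri x j)" using assms by (auto intro: tri_L tri_starts)
  obtain e where e: "e \<in> L" "length e = l" "starts e" "F e = F (tri x j)"
    using reach_l[OF p] by blast
  have ae: "a @ e \<in> L" "starts (a @ e)"
    using R_append_L[OF aR] R_starts[OF aR] e by auto
  have q: "a @ a @ e \<in> L" "starts (a @ a @ e)"
    using R_append_L[OF aR ae(2,1)] R_starts[OF aR] by auto
  have Fq: "F (a @ a @ e) = F (tri x j)"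
    using R_append_F[OF aR ae(2)] R_append_F[OF aR e(3)] e(4) by simp
  have lq: "length (a @ a @ e) = 3 * l" using e R_length[OF aR] by simp
  have "adm X (3 * l) (trans (tri x j) (a @ a @ e))"
    using l_pos lq length_tri ctx_eqI[OF p(2) q(2)] Fq by (intro adm_transpose) auto
  moreover have "g (gate (3 * l) (trans (tri x j) (a @ a @ e)) y) =
        gate (3 * l) (trans (tri x j) (a @ a @ e)) (g y)" if "y \<in> X" for y
    using g_triple[OF that p(1) q(1) p(2) q(2) length_tri lq] Fq by simp
  ultimately show thesis using that e by blast
qed

text \<open>After enough swaps, the positions of one parity are empty on the left and those of the
  other parity are empty on the right, so no two neighbours are both occupied.\<close>

lemma sparse:
  assumes "good x"
  shows "\<exists>t. \<forall>j. B (evolve t x) j = z \<or> B (evolve t x) (j + 1) = z"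
proof -
  obtain m where m: "m \<ge> 0" "\<And>j. \<bar>j\<bar> > m \<Longrightarrow> B x j = z"
    using finite_supportD[of x] assms by (auto simp: good_def)
  have R: "B x j \<in> R l" for j using assms by (simp add: good_def)
  \<comment> \<open>With \<open>m + 2\<close> steps the two cleared half-lines overlap, so every
    pair of neighbours lies in one of them.\<close>
  define t where "t = nat (m + 2)"
  have t: "int t = m + 2" using m by (simp add: t_def)
  have le: "B (evolve t x) j = z" if "j < - m + int t" "even (j - int t)" for j
    using that m(2) R by (intro evolve_left[where c = "j + 1" and m = "- m"]) auto
  have ri: "B (evolve t x) j = z" if "j > m - int t" "odd (j - int t)" for j
    using that m(2) R by (intro evolve_right[where c = "j - 1" and m = m]) auto
  have "B (evolve t x) j = z \<or> B (evolve t x) (j + 1) = z" for j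
  proof (cases "j + 1 < - m + int t")
    case True
    then show ?thesis using le[of j] le[of "j + 1"] by auto
  next
    case False
    then show ?thesis using ri[of j] ri[of "j + 1"] t m(1) by auto
  qed
  then show ?thesis by blast
qed

text \<open>Let the first bad block of \<open>g x\<close> stand at \<beta> and consider the repair
  of the triple starting one block earlier. After sparsification \<open>x\<close> contains neither
  that triple, which has a bad block, nor a pattern beginning with \<open>a a\<close>, so the repair
  fixes it. Then it fixes the image as well, although the triple occurs there: a
  contradiction.\<close>

lemma good_g:
  assumes "good x"
  shows "good (g x)"
proof (rule ccontr)
  have x: "x \<in> X" "finite_support x" "\<And>j. B x j \<in> R l" using assms by (auto simp: good_def)
  define y where "y = g x"
  have y: "y \<in> X" "finite_support y" using gX g_finite_support x y_def by auto
  assume "\<not> good (g x)"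
  then obtain j0 where j0: "B y j0 \<notin> R l" using y by (auto simp: good_def y_def)
  obtain m where m: "\<And>j. \<bar>j\<bar> > m \<Longrightarrow> B y j = z" using y by (auto simp: finite_support_def)
  define Bd where "Bd = {j. B y j \<notin> R l}"
  have "Bd \<subseteq> {- m..m}"
    unfolding Bd_def using m zR by (metis (mono_tags, lifting) abs_le_iff atLeastAtMost_iff linorder_not_less mem_Collect_eq minus_le_iff subsetI)
  then have finB: "finite Bd" using finite_subset by blast
  define \<beta> where "\<beta> = Min Bd"
  have "\<beta> \<in> Bd" unfolding \<beta>_def using finB j0 by (intro Min_in) (auto simp: Bd_def)
  then have bad: "B y \<beta> \<notin> R l" by (simp add: Bd_def)
  have "\<beta> - 1 \<notin> Bd" using finB Min_le[of Bd "\<beta> - 1"] unfolding \<beta>_def by force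
  then have gd: "B y (\<beta> - 1) \<in> R l" by (simp add: Bd_def)
  obtain t where t: "\<And>j. B (evolve t x) j = z \<or> B (evolve t x) (j + 1) = z"
    using sparse[OF assms] by blast
  define x' y' where "x' = evolve t x" and "y' = evolve t y"
  have x': "x' \<in> X" "\<And>j. B x' j \<in> R l" using x evolve_X evolve_good by (auto simp: x'_def)
  have gx': "g x' = y'" using g_evolve[OF x(1)] by (simp add: x'_def y'_def y_def)
  have y': "y' \<in> X" "B y' (\<beta> - 1) \<in> R l" "B y' \<beta> \<notin> R l"
    using evolve_X y gd bad evolve_good by (auto simp: y'_def)
  obtain e q where q: "q = a @ a @ e" and adm: "adm X (3 * l) (trans (tri y' (\<beta> - 1)) q)"
    and comm: "\<And>y. y \<in> X \<Longrightarrow> g (gate (3 * l) (trans (tri y' (\<beta> - 1)) q) y) =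
        gate (3 * l) (trans (tri y' (\<beta> - 1)) q) (g y)"
    using eraser[OF y'(1,2)] by metis
  define p where "p = tri y' (\<beta> - 1)"
  define \<tau> where "\<tau> = phased (3 * l) (trans p q) (\<beta> - 1)"
  have "\<tau> x' = x'"
  proof (rule tri_eqI[of _ "\<beta> - 1"])
    fix i
    let ?j = "\<beta> - 1 + 3 * i"
    have "tri x' ?j \<noteq> p"
    proof
      assume "tri x' ?j = p"
      then have "B x' (?j + 1) = B y' \<beta>"
        using tri_eqD(2)[of x' ?j y' "\<beta> - 1"] by (simp add: p_def)
      then show False using x' y' by metis
    qed
    moreover have "tri x' ?j \<noteq> q"
      using tri_eq_append[of a a x' ?j e] R_length[OF aR] t[of ?j] dist by (auto simp: q x'_def)
    ultimately show "tri (\<tau> x') ?j = tri x' ?j"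
      unfolding \<tau>_def using tri_phased[OF adm[folded p_def]] by (simp add: Transposition.transpose_def)
  qed
  moreover have "g (\<tau> x') = \<tau> (g x')"
    unfolding \<tau>_def using adm comm by (intro phased_g x'(1)) (auto simp: p_def)
  ultimately have "\<tau> y' = y'" using gx' by simp
  then have "tri y' (\<beta> - 1) = q"
    using tri_phased[OF adm[folded p_def], of "\<beta> - 1" y' 0] by (simp add: \<tau>_def p_def)
  then have "B y' \<beta> = a"
    using tri_eq_append[of a a y' "\<beta> - 1" e] R_length[OF aR] by (simp add: q)
  then show False using y'(3) aR by simp
qed

section \<open>Two counter-moving lanes and the translation of particles\<close>

definition s :: "(int \<Rightarrow> 'a) \<Rightarrow> int \<Rightarrow> 'a" where "s x = S 1 (S 0 x)"

text \<open>On return blocks the two swaps compose to a translation on each parity class: odd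
  positions move left by two, even positions right by two.\<close>

lemma B_s:
  assumes "good x"
  shows "B (s x) j = (if odd j then B x (j + 2) else B x (j - 2))"
  using assms by (simp add: s_def B_S partner_def good_def algebra_simps)

lemma good_s: "good x \<Longrightarrow> good (s x)"
  by (simp add: good_def s_def S_X S_finite_support S_good)

lemma good_sn: "good x \<Longrightarrow> good ((s ^^ n) x)"
  by (induction n) (auto simp: good_s)

lemma g_s: "x \<in> X \<Longrightarrow> g (s x) = s (g x)"
  by (simp add: s_def g_S S_X)

lemma g_sn: "good x \<Longrightarrow> g ((s ^^ n) x) = (s ^^ n) (g x)"
proof (induction n)
  case (Suc n)
  then have "(s ^^ n) x \<in> X" using good_sn by (simp add: good_def)
  then show ?case using Suc by (simp add: g_s)
qed simp

lemma B_sn: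
  assumes "good x"
  shows "B ((s ^^ n) x) j = (if odd j then B x (j + 2 * int n) else B x (j - 2 * int n))"
proof (induction n arbitrary: j)
  case (Suc n)
  have "B ((s ^^ Suc n) x) j = (if odd j then B ((s ^^ n) x) (j + 2) else B ((s ^^ n) x) (j - 2))"
    using B_s[OF good_sn[OF assms]] by simp
  then show ?case using Suc by (simp add: algebra_simps)
qed simp

text \<open>\<open>p = True\<close> keeps the left-moving odd positions, \<open>p = False\<close>
  the right-moving even ones.\<close>

definition lane :: "bool \<Rightarrow> (int \<Rightarrow> 'a) \<Rightarrow> int \<Rightarrow> 'a" where
  "lane p x = pt l (\<lambda>j. if odd j = p then B x j else z)"

lemma lane:
  assumes "good x"
  shows "good (lane p x)" "B (lane p x) j = (if odd j = p then B x j else z)"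
proof -
  obtain m where m: "\<And>j. \<bar>j\<bar> > m \<Longrightarrow> B x j = z"
    using assms by (auto simp: good_def finite_support_def)
  let ?c = "\<lambda>j. if odd j = p then B x j else z"
  have R: "?c j \<in> R l" for j using assms zR by (simp add: good_def)
  show "good (lane p x)" unfolding lane_def
    by (rule good_pt[of _ m]) (use R m in auto)
  show "B (lane p x) j = ?c j" unfolding lane_def by (rule pt_X(2)) (rule R)
qed

text \<open>On a point living on one lane \<open>s\<close> is a translation, so it is the same
  translation on the image. But \<open>s\<close> moves the other lane in the opposite direction;
  that lane of the image is therefore periodic, and by finite support empty.\<close>

lemma g_lane_zero:
  assumes "good x" "\<And>j. odd j \<noteq> p \<Longrightarrow> B x j = z" "odd j \<noteq> p"
  shows "B (g x) j = z"
proof -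
  define d :: int where "d = (if p then 2 else - 2)"
  have "s x = sh (int l * d) x"
    by (rule B_eqI) (use assms(2) in \<open>auto simp: B_s[OF assms(1)] B_sh d_def\<close>)
  then have "s (g x) = sh (int l * d) (g x)"
    using g_s[of x] g_sh[of x "int l * d"] assms(1) by (simp add: good_def)
  then have "B (s (g x)) i = B (g x) (i + d)" for i
    by (simp add: B_sh)
  then have per: "B (g x) (i - d) = B (g x) (i + d)" if "odd i \<noteq> p" for i
    using B_s[OF good_g[OF assms(1)], of i] that by (auto simp: d_def split: if_splits)
  have odd_d: "even d" by (simp add: d_def)
  have step: "B (g x) (j + 2 * d * int n) = B (g x) j" for n
  proof (induction n)
    case (Suc n)
    have "odd (j + 2 * d * int n + d) \<noteq> p" using assms(3) odd_d by simp
    from per[OF this] Suc show ?case by (simp add: algebra_simps)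
  qed simp
  obtain m where m: "m \<ge> 0" "\<And>j. \<bar>j\<bar> > m \<Longrightarrow> B (g x) j = z"
    using good_g[OF assms(1)] finite_supportD[of "g x"] by (auto simp: good_def)
  define n where "n = nat (m + \<bar>j\<bar> + 1)"
  have "int n = m + \<bar>j\<bar> + 1" using m(1) by (simp add: n_def)
  then have "B (g x) (j + 2 * d * int n) = z"
    by (intro m(2)) (auto simp: d_def)
  then show ?thesis using step by simp
qed

text \<open>Iterating \<open>s\<close> separates the two lanes beyond the radius of
  \<open>g\<close>. Near the separated contents of one lane the other lane is empty, so
  \<open>g\<close> cannot see it.\<close>

lemma superposition:
  assumes "good x"
  shows "B (g x) j = B (g (lane (odd j) x)) j"
proof -
  define p where "p = odd j"
  define x' where "x' = lane p x"
  have x': "good x'" "\<And>j. B x' j = (if odd j = p then B x j else z)"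
    using lane[OF assms] by (auto simp: x'_def)
  obtain r where r: "\<And>x y j j'. x \<in> X \<Longrightarrow> y \<in> X \<Longrightarrow> (\<And>k. \<bar>k\<bar> \<le> r \<Longrightarrow> B x (j + k) = B y (j' + k)) \<Longrightarrow> B (g x) j = B (g y) j'"
    using g_block_local by metis
  obtain m where m: "m \<ge> 0" "\<And>j. \<bar>j\<bar> > m \<Longrightarrow> B x j = z"
    using assms finite_supportD[of x] by (auto simp: good_def)
  \<comment> \<open>Large enough that, within distance \<open>r\<close> of the moved position
    \<open>i\<close>, the opposite lane shows only blocks from outside the support.\<close>
  define n where "n = nat (m + \<bar>r\<bar> + \<bar>j\<bar> + 1)"
  have n: "int n = m + \<bar>r\<bar> + \<bar>j\<bar> + 1" using m(1) by (simp add: n_def)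
  define i where "i = (if p then j - 2 * int n else j + 2 * int n)"
  have odd_i: "odd i = p" by (simp add: i_def p_def)
  have "B (g y) j = B (g ((s ^^ n) y)) i" if "good y" for y
    using B_sn[OF good_g[OF that], of n i] odd_i g_sn[OF that, of n]
    by (auto simp: i_def split: if_splits)
  moreover have "B (g ((s ^^ n) x)) i = B (g ((s ^^ n) x')) i"
  proof (rule r)
    show "(s ^^ n) x \<in> X" "(s ^^ n) x' \<in> X"
      using good_sn assms x'(1) by (auto simp: good_def)
    fix k assume k: "\<bar>k\<bar> \<le> r"
    show "B ((s ^^ n) x) (i + k) = B ((s ^^ n) x') (i + k)"
    proof (cases "odd (i + k) = p")
      case True
      then show ?thesis by (auto simp: B_sn[OF assms] B_sn[OF x'(1)] x'(2))
    next
      case False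
      have z: "B x (if p then i + k - 2 * int n else i + k + 2 * int n) = z"
        by (rule m(2)) (use n k in \<open>auto simp: i_def\<close>)
      then have "B ((s ^^ n) x) (i + k) = z"
        using False by (auto simp: B_sn[OF assms])
      moreover have "B ((s ^^ n) x') (i + k) = z"
        using False by (auto simp: B_sn[OF x'(1)] x'(2))
      ultimately show ?thesis by simp
    qed
  qed
  ultimately show ?thesis using assms x'(1) by (simp add: x'_def p_def)
qed

definition pair_at :: "(int \<Rightarrow> 'a) \<Rightarrow> int \<Rightarrow> 'a list \<times> 'a list" where
  "pair_at x i = (B x (2 * i), B x (2 * i + 1))"

lemma pair_at_range: "P \<in> range (pair_at x) \<longleftrightarrow> (\<exists>i. (B x (2 * i), B x (2 * i + 1)) = P)"
  unfolding pair_at_def image_iff by (simp add: eq_commute)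

lemma pair_at_meet:
  assumes "good x" "P \<in> R l \<times> R l" "Q \<in> R l \<times> R l" "P \<noteq> Q"
  shows "(P \<in> range (pair_at x) \<or> Q \<in> range (pair_at x)) \<longleftrightarrow> (P \<in> range (pair_at (g x)) \<or> Q \<in> range (pair_at (g x)))"
proof -
  obtain c d c' d' where PQ: "P = (c, d)" "Q = (c', d')" by force
  then have R: "c \<in> R l" "d \<in> R l" "c' \<in> R l" "d' \<in> R l" "(c, d) \<noteq> (c', d')" using assms by auto
  have "x \<in> X" using assms by (simp add: good_def)
  from g_pair_fixed_iff[OF this R(1-4)] show ?thesis
    unfolding pair_fixed_iff[OF R] PQ pair_at_range by blast
qed

text \<open>A transposition only tests whether one of two pairs occurs. Testing two absent pairs
  against each other shows that \<open>P0\<close> stays absent in the image; testing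
  \<open>P\<close> against \<open>P0\<close> then detects \<open>P\<close> alone.\<close>

lemma pair_at_iff:
  assumes "good x" "P0 \<in> R l \<times> R l" "Q0 \<in> R l \<times> R l" "P0 \<noteq> Q0"
    "P0 \<notin> range (pair_at x)" "Q0 \<notin> range (pair_at x)" "P \<in> R l \<times> R l"
  shows "P \<in> range (pair_at x) \<longleftrightarrow> P \<in> range (pair_at (g x))"
proof -
  have "P0 \<notin> range (pair_at (g x))" using pair_at_meet[OF assms(1-4)] assms(5,6) by blast
  then show ?thesis
    using pair_at_meet[OF assms(1,2,7)] assms(5) by (cases "P = P0") auto
qed

definition token :: "int \<Rightarrow> int \<Rightarrow> 'a" where
  "token i = pt l (\<lambda>j. if j = i then a else z)"

lemma token: "good (token i)" "B (token i) j = (if j = i then a else z)"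
proof -
  show "good (token i)" unfolding token_def
    by (rule good_pt[of _ "\<bar>i\<bar>"]) (use aR zR in auto)
  show "B (token i) j = (if j = i then a else z)" unfolding token_def
    by (rule pt_X(2)) (use aR zR in auto)
qed

lemma token_sh: "token (i - k) = sh (int l * k) (token i)"
  by (rule B_eqI) (auto simp: B_sh token)

lemma g_token_shift: "B (g (token (i + k))) j = B (g (token i)) (j - k)"
proof -
  have "token (i + k) = sh (int l * (- k)) (token i)" using token_sh[of i "- k"] by simp
  then have "g (token (i + k)) = sh (int l * (- k)) (g (token i))"
    using g_sh[of "token i"] token(1) by (simp add: good_def)
  then show ?thesis by (simp only: B_sh) simp
qed

text \<open>A particle on the odd lane meets a particle on the even lane exactly when their indices
  agree, and transpositions of pairs detect such meetings.\<close>

lemma g_token: "\<exists>e. (\<forall>j. B (g (token 1)) j = (if j = 2 * e + 1 then a else z)) \<and>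
    (\<forall>j. B (g (token 0)) j = (if j = 2 * e then a else z))"
proof -
  \<comment> \<open>Two particles, the odd one at \<open>1\<close> and the even one at
    \<open>2 * k\<close>; they form an aligned pair exactly when \<open>k = 0\<close>.\<close>
  define y where "y k = pt l (\<lambda>j. if j = 1 \<or> j = 2 * k then a else z)" for k :: int
  have y: "good (y k)" "\<And>j. B (y k) j = (if j = 1 \<or> j = 2 * k then a else z)" for k
  proof -
    show "good (y k)" unfolding y_def
      by (rule good_pt[of _ "1 + 2 * \<bar>k\<bar>"]) (use aR zR in auto)
    show "B (y k) j = (if j = 1 \<or> j = 2 * k then a else z)" for j unfolding y_def
      by (rule pt_X(2)) (use aR zR in auto)
  qed
  have laneT: "lane True (y k) = token 1" for k
    by (rule B_eqI) (auto simp: lane y token)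
  have laneF: "lane False (y k) = token (0 + 2 * k)" for k
    by (rule B_eqI) (auto simp: lane y token)
  have odd: "B (g (y k)) (2 * i + 1) = B (g (token 1)) (2 * i + 1)" for i k
    using superposition[OF y(1), of k "2 * i + 1"] by (simp add: laneT)
  have even: "B (g (y k)) (2 * i) = B (g (token 0)) (2 * i - 2 * k)" for i k
    using superposition[OF y(1), of k "2 * i"] g_token_shift[of 0 "2 * k"] by (simp add: laneF)
  have zlane0: "B (g (token 0)) j = z" if "odd j" for j
    by (rule g_lane_zero[OF token(1), of False]) (use that in \<open>auto simp: token\<close>)
  have zlane1: "B (g (token 1)) j = z" if "even j" for j
    by (rule g_lane_zero[OF token(1), of True]) (use that in \<open>auto simp: token\<close>)
  \<comment> \<open>These are the reference pairs for \<open>pair_at_iff\<close>: the block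
    \<open>b\<close> does not occur in \<open>y k\<close>.\<close>
  have absent: "(b, b) \<notin> range (pair_at (y k))" "(b, a) \<notin> range (pair_at (y k))" for k
    using dist by (auto simp: pair_at_def y split: if_splits)
  note iff = pair_at_iff[OF y(1) _ _ _ absent]
  have "pair_at (y 0) 0 = (a, a)" by (simp add: pair_at_def y)
  then have "(a, a) \<in> range (pair_at (y 0))" by (metis rangeI)
  then have "(a, a) \<in> range (pair_at (g (y 0)))" using iff aR bR dist by simp
  then obtain e where e: "B (g (token 0)) (2 * e) = a" "B (g (token 1)) (2 * e + 1) = a"
    unfolding pair_at_range using odd[of 0] even[of 0] by auto
  \<comment> \<open>Non-meeting is preserved too: a pair of two non-vacuum blocks in the image would
    have to occur in \<open>y k\<close>. Running over all \<open>k\<close> leaves room for only one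
    occupied index on each lane.\<close>
  have nomeet: "B (g (token 0)) (2 * i - 2 * k) = z \<or> B (g (token 1)) (2 * i + 1) = z" if "k \<noteq> 0" for i k
  proof (rule ccontr)
    assume H: "\<not> ?thesis"
    define c d where "c = B (g (token 0)) (2 * i - 2 * k)" and "d = B (g (token 1)) (2 * i + 1)"
    have cd: "c \<in> R l" "d \<in> R l" using good_g[OF token(1)] by (auto simp: good_def c_def d_def)
    have "pair_at (g (y k)) i = (c, d)" by (simp add: pair_at_def odd even c_def d_def)
    then have "(c, d) \<in> range (pair_at (g (y k)))" by (metis rangeI)
    then have "(c, d) \<in> range (pair_at (y k))" using iff cd aR bR dist by simp
    then obtain i' where "B (y k) (2 * i') = c" "B (y k) (2 * i' + 1) = d" by (auto simp: pair_at_def)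
    then have "2 * i' = 2 * k" "2 * i' + 1 = 1"
      using H by (auto simp: y c_def d_def split: if_splits)
    then show False using that by simp
  qed
  have o: "B (g (token 1)) (2 * i + 1) = z" if "i \<noteq> e" for i
    using nomeet[of "i - e" i] e dist that by (simp add: algebra_simps)
  have ev: "B (g (token 0)) (2 * i) = z" if "i \<noteq> e" for i
    using nomeet[of "e - i" e] e dist that by (simp add: algebra_simps)
  show ?thesis
  proof (intro exI[of _ e] conjI allI)
    fix j
    show "B (g (token 1)) j = (if j = 2 * e + 1 then a else z)"
      using zlane1[of j] o e by (cases "even j") (auto elim!: oddE)
    show "B (g (token 0)) j = (if j = 2 * e then a else z)"
      using zlane0[of j] ev e by (cases "odd j") (auto elim!: evenE)
  qed
qed

lemma g_good: "\<exists>e. \<forall>x. good x \<longrightarrow> g x = sh (int l * (- 2 * e)) x"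
proof -
  obtain e where e: "\<And>j. B (g (token 1)) j = (if j = 2 * e + 1 then a else z)"
    "\<And>j. B (g (token 0)) j = (if j = 2 * e then a else z)"
    using g_token by blast
  have shifted: "B (g x) (2 * (i + e) + (if p then 1 else 0)) = B x (2 * i + (if p then 1 else 0))"
    if x: "good x" for x i p
  proof -
    define q :: int where "q = 2 * i + (if p then 0 else 1)"
    define y where "y = pt l (\<lambda>j. if odd j = p then B x j else if j = q then a else z)"
    obtain m where m: "\<And>j. \<bar>j\<bar> > m \<Longrightarrow> B x j = z" using x by (auto simp: good_def finite_support_def)
    have R: "B x j \<in> R l" for j using x by (simp add: good_def)
    have gy: "good y" unfolding y_def
      by (rule good_pt[of _ "max m \<bar>q\<bar>"]) (use aR zR R m in auto)
    have By: "B y j = (if odd j = p then B x j else if j = q then a else z)" for j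
      unfolding y_def by (rule pt_X(2)) (use aR zR R in auto)
    have oq: "odd q = (\<not> p)" by (simp add: q_def)
    have same: "lane p y = lane p x" by (rule B_eqI) (auto simp: lane gy x By)
    have probe: "lane (\<not> p) y = token ((if p then 0 else 1) + 2 * i)"
      by (rule B_eqI) (use oq in \<open>auto simp: lane gy By token q_def\<close>)
    have gs: "B (g y) k = B (g x) k" if "odd k = p" for k
      using superposition[OF gy, of k] superposition[OF x, of k] that by (simp add: same)
    have gp: "B (g y) k = (if k = q + 2 * e then a else z)" if "odd k = (\<not> p)" for k
      using superposition[OF gy, of k] that
      by (auto simp: probe g_token_shift[of 0 "2 * i", simplified] g_token_shift[of 1 "2 * i"] e q_def)
    \<comment> \<open>The probe lane carries only \<open>a\<close> and \<open>z\<close>, so a pair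
      with \<open>b\<close> on that lane cannot occur.\<close>
    have absent: "(if p then (b, z) else (z, b)) \<notin> range (pair_at y)" "(if p then (b, a) else (a, b)) \<notin> range (pair_at y)"
      using dist by (auto simp: pair_at_def By q_def split: if_splits)
    define r where "r = B x (2 * i + (if p then 1 else 0))"
    have "pair_at y i = (if p then (a, r) else (r, a))" by (simp add: pair_at_def By r_def q_def)
    then have "(if p then (a, r) else (r, a)) \<in> range (pair_at y)" by (metis rangeI)
    then have "(if p then (a, r) else (r, a)) \<in> range (pair_at (g y))"
      using pair_at_iff[OF gy _ _ _ absent, of "if p then (a, r) else (r, a)"] R aR bR zR dist
      by (cases p) (simp_all add: r_def)
    then obtain k where "B (g y) (2 * k + (if p then 0 else 1)) = a" "B (g y) (2 * k + (if p then 1 else 0)) = r"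
      unfolding pair_at_range by (cases p) auto
    then show ?thesis using dist gp[of "2 * k + (if p then 0 else 1)"] gs[of "2 * k + (if p then 1 else 0)"]
      by (cases p) (auto simp: r_def q_def split: if_splits)
  qed
  have "g x = sh (int l * (- 2 * e)) x" if x: "good x" for x
  proof (rule B_eqI)
    fix j
    show "B (g x) j = B (sh (int l * (- 2 * e)) x) j"
    proof (cases "odd j")
      case True
      then obtain i where "j = 2 * i + 1" by (elim oddE)
      then show ?thesis using shifted[OF x, of "i - e" True] unfolding B_sh by (simp add: algebra_simps)
    next
      case False
      then obtain i where "j = 2 * i" by (auto elim: evenE)
      then show ?thesis using shifted[OF x, of "i - e" False] unfolding B_sh by (simp add: algebra_simps)
    qed
  qed
  then show ?thesis by blast
qed

end

section \<open>Erosion of homoclinic points\<close>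

context swap_centralizer
begin

lemma phased_sh:
  assumes "adm X N \<pi>" "int l * d = int N * k'"
  shows "sh (int l * d) (phased N \<pi> k x) = phased N \<pi> k (sh (int l * d) x)"
proof -
  have "gate N \<pi> (sh (int l * d) y) = sh (int l * d) (gate N \<pi> y)" for y :: "int \<Rightarrow> 'a"
    unfolding assms(2) using adm_pos[OF assms(1)] adm_length[OF assms(1)] by (intro gate_sh)
  from this[of "sh (int l * k) x"] show ?thesis
    by (simp add: phased_def add.commute)
qed

text \<open>The phased gate is injective and commutes with \<open>g\<close> and, by the divisibility
  assumption, with the translation; cancelling it transports the equation from the transformed point
  back to the original one.\<close>

lemma cube_pull_back:
  assumes "adm X N \<pi>" "\<And>x. x \<in> X \<Longrightarrow> g (gate N \<pi> x) = gate N \<pi> (g x)"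
    "int l * d = int N * k'" "x \<in> X"
    "g (g (g (phased N \<pi> k x))) = sh (int l * d) (phased N \<pi> k x)"
  shows "g (g (g x)) = sh (int l * d) x"
proof (rule phased_inj[OF assms(1)])
  show "phased N \<pi> k (g (g (g x))) = phased N \<pi> k (sh (int l * d) x)"
    using assms(5) phased_g[OF assms(1) _ assms(2)] gX assms(4)
    by (simp add: phased_sh[OF assms(1,3), symmetric])
qed

text \<open>Once the swaps have moved everything away from the bad blocks, the pattern \<open>a a e\<close> does not
  occur outside them, so replacing it can create bad blocks only to the left of the last one, while
  the first one is repaired.\<close>
lemma erode:
  assumes d: "\<And>x. good x \<Longrightarrow> g (g (g x)) = sh (int l * (6 * d)) x"
    and x: "x \<in> X" "finite_support x" "{j. B x j \<notin> R l} \<subseteq> {\<beta>..<\<beta> + int n}"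
  shows "g (g (g x)) = sh (int l * (6 * d)) x"
  using x
proof (induction n arbitrary: x \<beta>)
  case 0
  then show ?case by (intro d) (auto simp: good_def)
next
  case (Suc n)
  note x = \<open>x \<in> X\<close> \<open>finite_support x\<close>
  show ?case
  proof (cases "{j. B x j \<notin> R l} = {}")
    case True
    then show ?thesis by (intro d) (use x in \<open>auto simp: good_def\<close>)
  next
    case False
    define Bd where "Bd = {j. B x j \<notin> R l}"
    have finB: "finite Bd" using Suc.prems(3) finite_subset unfolding Bd_def by blast
    define b0 b1 where "b0 = Min Bd" and "b1 = Max Bd"
    have "b0 \<in> Bd" "b1 \<in> Bd" using Min_in[OF finB] Max_in[OF finB] False unfolding b0_def b1_def Bd_def by blast+
    then have bad: "B x b0 \<notin> R l" "B x b1 \<notin> R l" by (auto simp: Bd_def)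
    have btw: "b0 \<le> j \<and> j \<le> b1" if "B x j \<notin> R l" for j
      using that finB unfolding b0_def b1_def Bd_def by (auto intro: Min_le Max_ge)
    have bnd: "\<beta> \<le> b0" "b1 < \<beta> + int (Suc n)" using Suc.prems(3) bad by auto
    obtain m where m: "m \<ge> 0" "\<And>j. \<bar>j\<bar> > m \<Longrightarrow> B x j = z" using finite_supportD[OF x(2)] by blast
    \<comment> \<open>Enough steps for the emptied positions to extend from the far left up to
      \<open>b0\<close> and from the far right down to \<open>b1\<close>.\<close>
    define t where "t = nat (m + \<bar>b0\<bar> + \<bar>b1\<bar>)"
    have t: "int t = m + \<bar>b0\<bar> + \<bar>b1\<bar>" using m(1) by (simp add: t_def)
    define x' where "x' = evolve t x"
    have x': "x' \<in> X" "finite_support x'" using x evolve_X evolve_finite_support by (auto simp: x'_def)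
    have good': "B x' j \<in> R l \<longleftrightarrow> B x j \<in> R l" for j by (simp add: x'_def evolve_good)
    have inside: "B x j \<in> R l" if "j < b0 \<or> j > b1" for j
      using btw[of j] that by linarith
    have left: "B x' j = z" if "j < b0" "even (j - int t)" for j
      unfolding x'_def
    proof (rule evolve_left[where c = b0 and m = "- m"])
      show "j < - m + int t" using t that by linarith
      show "B x i = z" if "i < - m" for i using that by (intro m(2)) linarith
    qed (use inside that in blast)+
    have right: "B x' j = z" if "j > b1" "odd (j - int t)" for j
      unfolding x'_def
    proof (rule evolve_right[where c = b1 and m = m])
      show "m - int t < j" using t that by linarith
      show "B x i = z" if "m < i" for i using that by (intro m(2)) linarith
    qed (use inside that in blast)+
    have noaa: "\<not> (B x' j = a \<and> B x' (j + 1) = a)" if "j + 1 < b0 \<or> j > b1" for j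
    proof -
      have "B x' j = z \<or> B x' (j + 1) = z"
      proof (cases "even (j - int t)")
        case True
        moreover from this have "odd (j + 1 - int t)" by presburger
        ultimately show ?thesis using left[of j] right[of "j + 1"] that by linarith
      next
        case False
        moreover from this have "even (j + 1 - int t)" by presburger
        ultimately show ?thesis using left[of "j + 1"] right[of j] that by blast
      qed
      then show ?thesis using dist by auto
    qed
    have "B x (b0 - 1) \<in> R l" using btw[of "b0 - 1"] by fastforce
    then have c: "B x' (b0 - 1) \<in> R l" by (simp add: good')
    obtain e q where q: "q = a @ a @ e" "length e = l" "starts e" "e \<in> L" "F e = F (tri x' (b0 - 1))"
      and adm: "adm X (3 * l) (trans (tri x' (b0 - 1)) q)"
      and comm: "\<And>y. y \<in> X \<Longrightarrow> g (gate (3 * l) (trans (tri x' (b0 - 1)) q) y) =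
          gate (3 * l) (trans (tri x' (b0 - 1)) q) (g y)"
      using eraser[OF x'(1) c] by metis
    define p where "p = tri x' (b0 - 1)"
    note adm = adm[folded p_def] and comm = comm[folded p_def]
    define x2 where "x2 = phased (3 * l) (trans p q) (b0 - 1) x'"
    have x2X: "x2 \<in> X" unfolding x2_def by (rule phased_X[OF adm x'(1)])
    have la: "length a = l" using aR by (rule R_length)
    \<comment> \<open>If the block after the first bad one is a return block, the triple has the
      followers of \<open>w\<close>, and so has \<open>e\<close>: the repair creates no new bad
      block.\<close>
    have eR: "e \<in> R l" if "B x' (b0 + 1) \<in> R l"
    proof -
      have "b0 - 1 + 1 = b0" "b0 - 1 + 2 = b0 + 1" by simp_all
      then have peq: "p = (B x' (b0 - 1) @ B x' b0) @ B x' (b0 + 1)"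
        unfolding p_def tri_def by (metis append.assoc)
      moreover have "p \<in> L" using tri_L[OF x'(1)] by (simp add: p_def)
      ultimately have "(B x' (b0 - 1) @ B x' b0) @ w \<in> L"
        using append_L_iff R_starts[OF that] by metis
      from F_append[OF R_starts[OF that] this] have "F p = F w"
        using R_F[OF that] by (simp only: peq)
      then show ?thesis using q by (simp add: R_def p_def)
    qed
    have tri2: "tri x2 (b0 - 1 + 3 * i) = trans p q (tri x' (b0 - 1 + 3 * i))" for i
      unfolding x2_def by (rule tri_phased[OF adm])
    have new: "b0 < J \<and> J \<le> b1" if J: "B x2 J \<notin> R l" for J
    proof -
      obtain i \<rho> where i: "J = b0 - 1 + 3 * i + \<rho>" "\<rho> = 0 \<or> \<rho> = 1 \<or> \<rho> = 2"
        by (rule block_in_triple)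
      define j where "j = b0 - 1 + 3 * i"
      have Jj: "J = j \<or> J = j + 1 \<or> J = j + 2" using i by (auto simp: j_def)
      have tj: "tri x2 j = trans p q (tri x' j)" using tri2 j_def by simp
      consider "tri x' j = p" | "tri x' j = q" | "tri x' j \<noteq> p" "tri x' j \<noteq> q" by blast
      then show ?thesis
      proof cases
        case 1
        then have "tri x2 j = a @ a @ e" using tj q by simp
        then have x2j: "B x2 j = a" "B x2 (j + 1) = a" "B x2 (j + 2) = e"
          using tri_eq_append[OF la la] by auto
        then have J2: "J = j + 2" "e \<notin> R l" using J Jj aR by auto
        have e2: "b0 - 1 + 2 = b0 + 1" by simp
        have eqs: "B x' (j + 1) = B x' b0" "B x' (j + 2) = B x' (b0 + 1)"
          using tri_eqD(2,3)[of x' j x' "b0 - 1"] 1 unfolding e2 p_def by simp_all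
        have "b0 \<le> j + 1 \<and> j + 1 \<le> b1" using eqs bad good' btw by metis
        moreover have "B x' (j + 2) \<notin> R l" using eR J2 eqs by auto
        then have "j + 2 \<le> b1" using btw good' by blast
        ultimately show ?thesis using J2 by simp
      next
        \<comment> \<open>Here the gate also writes \<open>p\<close> over an existing
          \<open>a a e\<close>. By \<open>noaa\<close> such a pattern begins between the first and
          the last bad block, and avoiding these two places it strictly right of \<open>b0\<close>
          and ending at most at \<open>b1\<close>.\<close>
        case 2
        then have x'j: "B x' j = a" "B x' (j + 1) = a" using tri_eq_append[OF la la] q by auto
        then have "\<not> (j + 1 < b0 \<or> j > b1)" using noaa by blast
        moreover have "j \<noteq> b0" "j \<noteq> b1" "j + 1 \<noteq> b0" "j + 1 \<noteq> b1"
          using x'j aR bad good' by metis+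
        ultimately show ?thesis using Jj by linarith
      next
        case 3
        then have "tri x2 j = tri x' j" using tj by (simp add: Transposition.transpose_def)
        then have "B x2 J = B x' J" using tri_eqD[of x2 j x' j] Jj by auto
        then have "b0 \<le> J \<and> J \<le> b1" using J good' btw by simp
        \<comment> \<open>The triple containing \<open>b0\<close> in this alignment is
          \<open>p\<close> itself, which the gate has changed.\<close>
        moreover have "J \<noteq> b0"
        proof
          assume "J = b0"
          then have "j = b0 - 1" using i by (auto simp: j_def)
          then show False using 3 by (simp add: p_def)
        qed
        ultimately show ?thesis by simp
      qed
    qed
    have "finite_support x2"
    proof -
      obtain m' where m': "\<And>j. \<bar>j\<bar> > m' \<Longrightarrow> B x' j = z" using x'(2) by (auto simp: finite_support_def)
      have "B x2 J = z" if J: "\<bar>J\<bar> > m' + \<bar>b0\<bar> + \<bar>b1\<bar> + 4" for J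
      proof -
        obtain i \<rho> where i: "J = b0 - 1 + 3 * i + \<rho>" "\<rho> = 0 \<or> \<rho> = 1 \<or> \<rho> = 2"
          by (rule block_in_triple)
        define j where "j = b0 - 1 + 3 * i"
        have Jj: "J = j \<or> J = j + 1 \<or> J = j + 2" using i by (auto simp: j_def)
        have zs: "B x' j = z" "B x' (j + 1) = z" "B x' (j + 2) = z"
          using Jj J by (auto intro!: m')
        have "tri x' j \<noteq> p"
        proof
          assume "tri x' j = p"
          then have "B x' (j + 1) = B x' (b0 - 1 + 1)" unfolding p_def by (rule tri_eqD)
          then have "B x' b0 = z" using zs by simp
          then show False using bad(1) good'[of b0] zR by simp
        qed
        moreover have "tri x' j \<noteq> q"
          using tri_eq_append[OF la la, of x' j e] q zs dist by auto
        ultimately have "tri x2 j = tri x' j"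
          using tri2[of i] by (simp add: j_def Transposition.transpose_def)
        then show ?thesis using tri_eqD[of x2 j x' j] Jj zs by auto
      qed
      then show ?thesis unfolding finite_support_def by blast
    qed
    moreover have "{j. B x2 j \<notin> R l} \<subseteq> {b0 + 1..<b0 + 1 + int n}"
      using new bnd by force
    ultimately have "g (g (g x2)) = sh (int l * (6 * d)) x2"
      using x2X by (intro Suc.IH)
    then have K': "g (g (g x')) = sh (int l * (6 * d)) x'"
      unfolding x2_def
      by (rule cube_pull_back[OF adm comm, of _ "2 * d", rotated 3]) (use x' in auto)
    \<comment> \<open>The swaps are undone one by one; translation by \<open>6 * d\<close> blocks is
      a multiple of both the pair length and the triple length.\<close>
    have pull: "g (g (g (evolve t x))) = sh (int l * (6 * d)) (evolve t x) \<Longrightarrow> g (g (g x)) = sh (int l * (6 * d)) x" for t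
    proof (induction t)
      case (Suc t)
      have "g (g (g (evolve t x))) = sh (int l * (6 * d)) (evolve t x)"
        by (rule cube_pull_back[OF adm_S g_swp, of _ "3 * d" _ "int t"])
          (use Suc.prems x evolve_X in \<open>auto simp: S_def\<close>)
      then show ?case by (rule Suc.IH)
    qed simp
    show ?thesis using pull K' by (simp add: x'_def)
  qed
qed

text \<open>The given window is enclosed between two copies of \<open>w\<close> by mixing, which
  gives a loop of \<open>2 * k\<close> blocks; outside, blocks \<open>z\<close> are added.\<close>

lemma finite_support_dense:
  assumes "x \<in> X"
  shows "\<exists>h\<in>X. finite_support h \<and> agree r h x"
proof -
  \<comment> \<open>Leaves room on each side for a mixing gap of length at least \<open>M\<close>
    and, on the left, for \<open>w\<close>; the gap lengths below put \<open>u\<close> at the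
    positions from \<open>- r\<close> to \<open>r\<close>.\<close>
  define k where "k = r + 1 + length w + M"
  define u where "u = win x (- int r) (2 * r + 1)"
  have uL: "u \<in> L" unfolding u_def using assms by (rule win_in_L)
  have lk: "k \<le> l * k" using l_pos by simp
  have "M \<le> l * k - r - length w" using lk by (simp add: k_def)
  from mix[OF w_L uL this] obtain c where c: "length c = l * k - r - length w" "w @ c @ u \<in> L" by blast
  have "M \<le> l * k - r - 1" using lk by (simp add: k_def)
  from mix[OF c(2) w_L this] obtain d where d: "length d = l * k - r - 1" "(w @ c @ u) @ d @ w \<in> L" by blast
  define v where "v = w @ c @ u @ d"
  have lv: "length v = 2 * l * k" using c d lk by (simp add: v_def u_def k_def)
  have loop: "loop v" using d by (simp add: loop_def v_def starts_def)
  define h where "h = (\<lambda>i. if - int (l * k) \<le> i \<and> i < int (l * k) then v ! nat (i + int (l * k)) else z ! nat (i mod int l))"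
  have "win h (- (int l * int k)) (2 * l * k) = v"
  proof (rule nth_equalityI)
    fix i assume "i < length (win h (- (int l * int k)) (2 * l * k))"
    then have i: "i < 2 * l * k" by simp
    then have "int i < int (2 * l * k)" by (simp only: of_nat_less_iff)
    then have "int i < int (l * k) + int (l * k)" by (simp add: algebra_simps)
    then have "h (- (int l * int k) + int i) = v ! i" by (simp add: h_def)
    then show "win h (- (int l * int k)) (2 * l * k) ! i = v ! i" by (simp only: nth_win[OF i])
  qed (simp add: lv)
  then have lamh: "loop (win h (- (int l * int k)) (2 * l * k))" using loop by simp
  have out: "B h j = z" if "j < - int k \<or> j \<ge> int k" for j
  proof (rule nth_equalityI)
    show "length (B h j) = length z" using zR by (simp add: R_length)
    fix i assume "i < length (B h j)"
    then have i: "i < l" by simp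
    have "\<not> (- int (l * k) \<le> int l * j + int i \<and> int l * j + int i < int (l * k))"
    proof (cases "j < - int k")
      case True
      then have "int l * j \<le> int l * (- int k - 1)" by (intro mult_left_mono) auto
      then show ?thesis using i by (simp add: algebra_simps)
    next
      case False
      then have "int l * int k \<le> int l * j" using that by (intro mult_left_mono) auto
      then show ?thesis by simp
    qed
    then have "h (int l * j + int i) = z ! nat ((int l * j + int i) mod int l)"
      unfolding h_def by (rule if_not_P)
    then show "B h j ! i = z ! i" using i by (simp add: blk_def)
  qed
  have "h \<in> X" by (rule extend_X[OF lamh]) (simp add: out zR)
  moreover have "finite_support h" unfolding finite_support_def by (rule exI[of _ "int k"]) (auto intro!: out)
  moreover have "agree r h x"
    unfolding agree_def
  proof safe
    fix i :: int assume i: "\<bar>i\<bar> \<le> int r"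
    have "int k \<le> int (l * k)" using lk by (simp only: of_nat_le_iff)
    moreover have "int r + int (length w) < int k" by (simp add: k_def)
    ultimately have rk: "int r + int (length w) < int (l * k)" by linarith
    have len: "int (length w + length c) = int (l * k) - int r" using c(1) rk by linarith
    define n where "n = nat (i + int r)"
    have n: "n < 2 * r + 1" "int n = i + int r" using i by (auto simp: n_def)
    have "nat (i + int (l * k)) = length (w @ c) + n"
      using n len i rk by simp
    then have "v ! nat (i + int (l * k)) = (u @ d) ! n"
      unfolding v_def by (metis append.assoc nth_append_length_plus)
    also have "\<dots> = u ! n" using n by (simp add: nth_append u_def)
    also have "\<dots> = x i" using n by (simp add: u_def)
    finally have "v ! nat (i + int (l * k)) = x i" .
    moreover have "- int (l * k) \<le> i \<and> i < int (l * k)" using i rk by linarith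
    ultimately show "h i = x i" unfolding h_def by (simp only: if_P)
  qed
  ultimately show ?thesis by blast
qed

text \<open>Good points give the translation, erosion extends it to finite support, and locality
  together with density of these points extends it to all of \<open>X\<close>.\<close>

lemma cube_shift: "\<exists>d. \<forall>x\<in>X. g (g (g x)) = sh d x"
proof -
  obtain e where e: "\<And>x. good x \<Longrightarrow> g x = sh (int l * (- 2 * e)) x" using g_good by blast
  define d where "d = int l * (6 * (- e))"
  have good3: "g (g (g x)) = sh (int l * (6 * (- e))) x" if "good x" for x
  proof -
    have "good (g x)" "good (g (g x))" using that good_g by auto
    from e[OF this(2)] e[OF this(1)] e[OF that] show ?thesis by (simp add: algebra_simps)
  qed
  have fin3: "g (g (g h)) = sh d h" if h: "h \<in> X" "finite_support h" for h
  proof -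
    obtain m where m: "m \<ge> 0" "\<And>j. \<bar>j\<bar> > m \<Longrightarrow> B h j = z" using finite_supportD[OF h(2)] by blast
    have "{j. B h j \<notin> R l} \<subseteq> {- m..<- m + int (nat (2 * m + 1))}"
    proof
      fix j assume "j \<in> {j. B h j \<notin> R l}"
      then have "\<not> \<bar>j\<bar> > m" using m zR by auto
      then show "j \<in> {- m..<- m + int (nat (2 * m + 1))}" using m(1) by auto
    qed
    from erode[OF good3 h this] show ?thesis by (simp add: d_def)
  qed
  have loc: "is_local X (\<lambda>x. g (g (g x)))"
    by (rule is_local_comp[OF g_local is_local_comp[OF g_local g_local gX] gX[OF gX]])
  have "g (g (g x)) = sh d x" if x: "x \<in> X" for x
  proof
    fix i
    obtain S1 where S1: "\<And>x y. x \<in> X \<Longrightarrow> y \<in> X \<Longrightarrow> agree S1 x y \<Longrightarrow> g (g (g x)) i = g (g (g y)) i"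
      using loc unfolding is_local_def by meson
    define r where "r = max S1 (nat \<bar>i + d\<bar>)"
    obtain h where h: "h \<in> X" "finite_support h" "agree r h x" using finite_support_dense[OF x] by blast
    have "g (g (g x)) i = g (g (g h)) i"
      using S1[OF h(1) x] agree_mono[OF h(3), of S1] by (simp add: r_def)
    also have "\<dots> = h (i + d)" using fin3[OF h(1,2)] by (simp add: sh_apply)
    also have "\<dots> = x (i + d)" using h(3) unfolding agree_def r_def by auto
    finally show "g (g (g x)) i = sh d x i" by (simp add: sh_apply)
  qed
  then show ?thesis by blast
qed

end

section \<open>A finite set with small centralizer\<close>

context mixing_sofic
begin

text \<open>The requirements on \<open>g\<close> mention only the shift and gates on words of the
  fixed lengths \<open>2 * l\<close> and \<open>3 * l\<close>, of which there are finitely many.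
  Including the shift forces a commuting element into its automorphism group.\<close>

lemma finite_set_with_small_centralizer:
  "\<exists>Fs. finite Fs \<and> Fs \<subseteq> carrier G \<and>
     (\<forall>f\<in>carrier G. (\<forall>\<phi>\<in>Fs. f \<otimes>\<^bsub>G\<^esub> \<phi> = \<phi> \<otimes>\<^bsub>G\<^esub> f) \<longrightarrow> (\<exists>d. \<forall>x\<in>X. f (f (f x)) = sh d x))"
proof -
  obtain n0 where n0: "\<And>n. n \<ge> n0 \<Longrightarrow> 4 \<le> card (R n)" using R_card by blast
  obtain n1 where n1: "\<And>n u. n \<ge> n1 \<Longrightarrow> u \<in> L \<Longrightarrow> starts u \<Longrightarrow> \<exists>e\<in>L. length e = n \<and> starts e \<and> F e = F u"
    using reach by blast
  \<comment> \<open>Long enough for three distinct return blocks and for replacement words with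
    every occurring follower set.\<close>
  define l where "l = max n0 (max n1 1)"
  have l: "l \<ge> n0" "l \<ge> n1" "l > 0" by (auto simp: l_def)
  have "3 \<le> card (R l)" using n0[OF l(1)] by linarith
  then obtain D where D: "D \<subseteq> R l" "card D = 3"
    using obtain_subset_with_card_n by metis
  then obtain z a b where zab: "D = {z, a, b}" "z \<noteq> a" "a \<noteq> b" "z \<noteq> b"
    unfolding card_3_iff by blast
  define P where "P = {p \<in> L. starts p \<and> length p = 3 * l}"
  have finP: "finite P"
    by (rule finite_subset[OF _ finite_words[of "3 * l"]]) (auto simp: P_def)
  define pair where "pair = (\<lambda>(c, d, c', d'). restrict (gate (2 * l) (trans (c @ d) (c' @ d'))) X)"
  define trip where "trip = (\<lambda>(p, q). restrict (gate (3 * l) (trans p q)) X)"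
  define Fs where "Fs = {restrict (sh 1) X, restrict (gate (2 * l) (swp l)) X} \<union>
      pair ` (R l \<times> R l \<times> R l \<times> R l) \<union> trip ` {(p, q). p \<in> P \<and> q \<in> P \<and> F p = F q}"
  have finite_support: "finite Fs"
  proof -
    have "finite {(p, q). p \<in> P \<and> q \<in> P \<and> F p = F q}"
      by (rule finite_subset[of _ "P \<times> P"]) (use finP in auto)
    then show ?thesis unfolding Fs_def using finite_R by simp
  qed
  have admtrip: "adm X (3 * l) (trans p q)"
    if "p \<in> P" "q \<in> P" "F p = F q" for p q
    by (rule adm_transpose) (use that l ctx_eqI in \<open>auto simp: P_def\<close>)
  have sub: "Fs \<subseteq> carrier G"
  proof
    fix f assume "f \<in> Fs"
    then consider "f = restrict (sh 1) X" | "f = restrict (gate (2 * l) (swp l)) X"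
      | c d c' d' where "c \<in> R l" "d \<in> R l" "c' \<in> R l" "d' \<in> R l" "f = pair (c, d, c', d')"
      | p q where "p \<in> P" "q \<in> P" "F p = F q" "f = trip (p, q)"
      unfolding Fs_def by blast
    then show "f \<in> carrier G"
    proof cases
      case 1
      then show ?thesis using AutN_G[OF sh_Aut[of 1 1]] by simp
    next
      case 2
      then show ?thesis using AutN_G[OF gate_Aut[OF adm_swp[OF l(3)]]] l by simp
    next
      case 3
      then show ?thesis using AutN_G[OF gate_Aut[OF adm_pair[OF l(3)]]] l by (simp add: pair_def)
    next
      case 4
      then show ?thesis using AutN_G[OF gate_Aut[OF admtrip]] l by (simp add: trip_def)
    qed
  qed
  have "\<exists>d. \<forall>x\<in>X. f (f (f x)) = sh d x"
    if f: "f \<in> carrier G" and comm: "\<forall>\<phi>\<in>Fs. f \<otimes>\<^bsub>G\<^esub> \<phi> = \<phi> \<otimes>\<^bsub>G\<^esub> f" for f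
  proof -
    have cm: "f (\<gamma> x) = \<gamma> (f x)" if "restrict \<gamma> X \<in> Fs" "x \<in> X" for \<gamma> x
    proof -
      have "(f \<otimes>\<^bsub>G\<^esub> restrict \<gamma> X) x = (restrict \<gamma> X \<otimes>\<^bsub>G\<^esub> f) x"
        using comm that by simp
      moreover have "restrict \<gamma> X \<in> carrier G" using sub that by blast
      ultimately show ?thesis using that f G_X[OF f] by (simp add: mult_G_apply)
    qed
    obtain n where n: "f \<in> AutN n" using f by (elim G_AutN)
    have sh1: "f (sh 1 x) = sh 1 (f x)" if "x \<in> X" for x
      by (rule cm[OF _ that]) (simp add: Fs_def)
    have f1: "f \<in> AutN 1" using AutN_iff[OF n, of 1] sh1 by simp
    have s: "subshift_space A X" by unfold_locales
    have "swap_centralizer A X w M l z a b f"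
    proof unfold_locales
      show "0 < l" "a \<noteq> z" "b \<noteq> z" "a \<noteq> b" using l zab by auto
      show "z \<in> R l" "a \<in> R l" "b \<in> R l" using D zab by auto
      show "\<exists>e\<in>L. length e = l \<and> starts e \<and> F e = F u" if "u \<in> L" "starts u" for u
        using n1[OF l(2) that] .
      show "f x \<in> X" if "x \<in> X" for x using G_X[OF f that] .
      show "inj_on f X" using AutN_D(7)[OF n] .
      show "is_local X f"
        unfolding is_local_def using continuous_imp_local[OF s s AutN_D(6)[OF n]] by blast
      show "f (sh k x) = sh k (f x)" if "x \<in> X" for x k
        using AutN_sh[OF f1 that, of k] by simp
      show "f (gate (2 * l) (swp l) x) = gate (2 * l) (swp l) (f x)" if "x \<in> X" for x
        by (rule cm[OF _ that]) (simp add: Fs_def)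
      show "f (gate (2 * l) (trans (c @ d) (c' @ d')) x) =
          gate (2 * l) (trans (c @ d) (c' @ d')) (f x)"
        if "x \<in> X" "c \<in> R l" "d \<in> R l" "c' \<in> R l" "d' \<in> R l" for x c d c' d'
      proof (rule cm[OF _ that(1)])
        have "pair (c, d, c', d') \<in> Fs" using that unfolding Fs_def by blast
        then show "restrict (gate (2 * l) (trans (c @ d) (c' @ d'))) X \<in> Fs"
          by (simp add: pair_def)
      qed
      show "f (gate (3 * l) (trans p q) x) = gate (3 * l) (trans p q) (f x)"
        if "x \<in> X" "p \<in> L" "q \<in> L" "starts p" "starts q" "length p = 3 * l" "length q = 3 * l" "F p = F q" for x p q
      proof (rule cm[OF _ that(1)])
        have "trip (p, q) \<in> Fs" using that unfolding Fs_def P_def by blast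
        then show "restrict (gate (3 * l) (trans p q)) X \<in> Fs"
          by (simp add: trip_def)
      qed
    qed
    then show ?thesis by (rule swap_centralizer.cube_shift)
  qed
  then show ?thesis using finite_support sub by blast
qed

end

section \<open>Permutations of words with equal followers\<close>

text \<open>Multiple transitivity of the symmetric group; a transposition corrects one further value
  while leaving the earlier ones alone.\<close>

lemma permutes_extend:
  assumes "distinct xs" "distinct ys" "length xs = length ys" "set xs \<subseteq> C" "set ys \<subseteq> C"
  shows "\<exists>\<sigma>. \<sigma> permutes C \<and> map \<sigma> xs = ys"
  using assms(3,1,2,4,5)
proof (induction xs ys rule: list_induct2)
  case Nil
  show ?case by (intro exI[of _ id] conjI permutes_id) simp
next
  case (Cons x xs y ys)
  then obtain \<sigma> where \<sigma>: "\<sigma> permutes C" "map \<sigma> xs = ys" by auto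
  have inj: "inj \<sigma>" using \<sigma>(1) by (rule permutes_inj)
  let ?t = "trans (\<sigma> x) y"
  have "?t permutes C"
    by (rule permutes_swap_id) (use Cons.prems permutes_in_image[OF \<sigma>(1)] in auto)
  then have "(?t \<circ> \<sigma>) permutes C" using \<sigma>(1) by (intro permutes_compose)
  moreover have "(?t \<circ> \<sigma>) x' = \<sigma> x'" if "x' \<in> set xs" for x'
  proof -
    have "\<sigma> x' \<in> set ys" using \<sigma>(2) that by auto
    then have "\<sigma> x' \<noteq> y" "\<sigma> x' \<noteq> \<sigma> x" using Cons.prems inj that by (auto dest: injD)
    then show ?thesis by (simp add: Transposition.transpose_def)
  qed
  then have "map (?t \<circ> \<sigma>) xs = ys" using \<sigma>(2) by (metis map_cong)
  moreover have "(?t \<circ> \<sigma>) x = y" by simp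
  ultimately show ?case by (metis list.simps(9))
qed

lemma conj_transpose:
  assumes "bij \<sigma>"
  shows "\<sigma> \<circ> trans a b \<circ> inv_into UNIV \<sigma> = trans (\<sigma> a) (\<sigma> b)"
proof
  fix x
  obtain y where y: "x = \<sigma> y" using assms by (metis bij_pointE)
  have "inv_into UNIV \<sigma> x = y" using assms y by (simp add: bij_is_inj inv_f_f)
  moreover have "\<sigma> y = \<sigma> u \<longleftrightarrow> y = u" for u using assms by (metis bij_is_inj injD)
  ultimately show "(\<sigma> \<circ> trans a b \<circ> inv_into UNIV \<sigma>) x = trans (\<sigma> a) (\<sigma> b) x"
    by (auto simp: Transposition.transpose_def y)
qed

lemma conj_comp: "bij \<sigma> \<Longrightarrow> \<sigma> \<circ> (f \<circ> g) \<circ> inv_into UNIV \<sigma> = (\<sigma> \<circ> f \<circ> inv_into UNIV \<sigma>) \<circ> (\<sigma> \<circ> g \<circ> inv_into UNIV \<sigma>)"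
  by (rule ext) (simp add: bij_is_inj inv_f_f)

context mixing_sofic
begin

definition W :: "nat \<Rightarrow> 'a list set" where
  "W N = {u \<in> L. length u = N \<and> starts u}"

definition cls :: "nat \<Rightarrow> 'a list set \<Rightarrow> 'a list set" where
  "cls N q = {u \<in> W N. F u = q}"

text \<open>The product of the symmetric groups of the follower classes \<open>cls N q\<close>,
  acting trivially on all other words.\<close>

definition Perm :: "nat \<Rightarrow> ('a list \<Rightarrow> 'a list) set" where
  "Perm N = {\<pi>. \<pi> permutes W N \<and> (\<forall>u. F (\<pi> u) = F u)}"

lemma finite_W: "finite (W N)"
  by (rule finite_subset[OF _ finite_words[of N]]) (auto simp: W_def)

lemma finite_cls: "finite (cls N q)"
  by (rule finite_subset[OF _ finite_W[of N]]) (auto simp: cls_def)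

lemma Perm_adm:
  assumes "\<pi> \<in> Perm N" "N > 0"
  shows "adm X N \<pi>"
proof -
  have p: "\<pi> permutes W N" and F: "\<And>u. F (\<pi> u) = F u" using assms by (auto simp: Perm_def)
  have "\<pi> permutes {u. length u = N}"
    by (rule permutes_subset[OF p]) (auto simp: W_def)
  then have "bij_betw \<pi> {u. length u = N} {u. length u = N}" by (rule permutes_imp_bij)
  moreover have "ctx X (\<pi> u) = ctx X u" for u
  proof (cases "u \<in> W N")
    case True
    then have "\<pi> u \<in> W N" using permutes_in_image[OF p] by simp
    then show ?thesis using True F by (intro ctx_eqI) (auto simp: W_def)
  next
    case False
    then show ?thesis using p by (simp add: permutes_not_in)
  qed
  ultimately show ?thesis using assms(2) by (simp add: adm_def)
qed

lemma Perm_comp: "\<pi> \<in> Perm N \<Longrightarrow> \<rho> \<in> Perm N \<Longrightarrow> \<pi> \<circ> \<rho> \<in> Perm N"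
  by (auto simp: Perm_def intro: permutes_compose)

lemma Perm_id: "id \<in> Perm N"
  by (simp add: Perm_def permutes_id)

lemma Perm_inv: "\<pi> \<in> Perm N \<Longrightarrow> inv_into UNIV \<pi> \<in> Perm N"
proof -
  assume p: "\<pi> \<in> Perm N"
  then have "\<pi> permutes W N" by (simp add: Perm_def)
  then have "inv_into UNIV \<pi> permutes W N" and "\<And>u. \<pi> (inv_into UNIV \<pi> u) = u"
    by (auto simp: permutes_inv permutes_inverses)
  moreover have "F (inv_into UNIV \<pi> u) = F u" for u
  proof -
    have "F (\<pi> (inv_into UNIV \<pi> u)) = F (inv_into UNIV \<pi> u)" using p by (simp add: Perm_def)
    then show ?thesis using \<open>\<And>u. \<pi> (inv_into UNIV \<pi> u) = u\<close> by simp
  qed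
  ultimately show ?thesis by (simp add: Perm_def)
qed

lemma Perm_bij: "\<pi> \<in> Perm N \<Longrightarrow> bij \<pi>"
  by (auto simp: Perm_def permutes_bij)

lemma Perm_cls:
  assumes "\<sigma> permutes cls N q"
  shows "\<sigma> \<in> Perm N"
proof -
  have "\<sigma> permutes W N" by (rule permutes_subset[OF assms]) (auto simp: cls_def)
  moreover have "F (\<sigma> u) = F u" for u
  proof (cases "u \<in> cls N q")
    case True
    then have "\<sigma> u \<in> cls N q" using permutes_in_image[OF assms] by simp
    then show ?thesis using True by (simp add: cls_def)
  next
    case False
    then show ?thesis using assms by (simp add: permutes_not_in)
  qed
  ultimately show ?thesis by (simp add: Perm_def)
qed

text \<open>A word \<open>u\<close> is sent injectively to \<open>w @ a @ u @ b @ e\<close>, where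
  mixing words of length \<open>M\<close> join it to \<open>w\<close> and to a fixed word
  \<open>e\<close> with the prescribed followers. The constant is the total length added.\<close>

lemma card_cls: "\<exists>c. \<forall>N q. c \<le> N \<longrightarrow> cls N q \<noteq> {} \<longrightarrow> card {u \<in> L. length u = N - c} \<le> card (cls N q)"
proof -
  obtain l where l: "\<And>u. u \<in> L \<Longrightarrow> starts u \<Longrightarrow> \<exists>e\<in>L. length e = l \<and> starts e \<and> F e = F u"
    using reach by blast
  define c where "c = length w + 2 * M + l"
  show ?thesis
  proof (intro exI[of _ c] allI impI)
    fix N q assume N: "c \<le> N" and ne: "cls N q \<noteq> {}"
    then obtain u0 where "u0 \<in> L" "starts u0" "F u0 = q" by (auto simp: cls_def W_def)
    then obtain e where e: "e \<in> L" "length e = l" "starts e" "F e = q" using l by metis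
    have "\<exists>a b. length a = M \<and> length b = M \<and> w @ a @ u @ b @ e \<in> L" if u: "u \<in> L" for u
    proof -
      obtain a where a: "length a = M" "w @ a @ u \<in> L" using mix[OF w_L u, of M] by auto
      obtain b where "length b = M" "(w @ a @ u) @ b @ e \<in> L" using mix[OF a(2) e(1), of M] by auto
      then show ?thesis using a by auto
    qed
    then obtain fa fb where ab: "\<And>u. u \<in> L \<Longrightarrow> length (fa u) = M" "\<And>u. u \<in> L \<Longrightarrow> length (fb u) = M"
      "\<And>u. u \<in> L \<Longrightarrow> w @ fa u @ u @ fb u @ e \<in> L"
      by metis
    let ?f = "\<lambda>u. w @ fa u @ u @ fb u @ e"
    let ?S = "{u \<in> L. length u = N - c}"
    have "inj_on ?f ?S"
    proof (rule inj_onI)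
      fix u v assume "u \<in> ?S" "v \<in> ?S" "?f u = ?f v"
      moreover from this have "u @ fb u @ e = v @ fb v @ e"
        using ab by (simp add: append_eq_append_conv)
      ultimately show "u = v" by (simp add: append_eq_append_conv)
    qed
    moreover have "?f ` ?S \<subseteq> cls N q"
    proof
      fix y assume "y \<in> ?f ` ?S"
      then obtain u where u: "u \<in> L" "length u = N - c" "y = ?f u" by auto
      have y: "y = (w @ fa u @ u @ fb u) @ e" using u by simp
      have "y \<in> L" using u ab by simp
      then have "F y = F e" unfolding y using F_append[OF e(3)] append_L_iff[OF e(3)] by blast
      moreover have "length y = N" using u ab N e by (simp add: c_def)
      moreover have "starts y" using u(3) by (simp add: starts_def)
      ultimately show "y \<in> cls N q" using \<open>y \<in> L\<close> e by (simp add: cls_def W_def)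
    qed
    ultimately show "card ?S \<le> card (cls N q)"
      using card_inj_on_le finite_cls by blast
  qed
qed

text \<open>\<theta> times its conjugate by the transposition of \<open>u1\<close> and
  \<open>u3\<close> is the double transposition of \<open>u1\<close>, \<open>u3\<close> and of
  \<open>u2\<close>, \<open>u4\<close>; all double transpositions of the class are conjugate to it.
  \<open>Q\<close> stands for membership in a normal set closed under products.\<close>

lemma double_transpositions:
  assumes Qcomp: "\<And>\<pi> \<rho>. \<pi> \<in> Perm N \<Longrightarrow> \<rho> \<in> Perm N \<Longrightarrow> Q \<pi> \<Longrightarrow> Q \<rho> \<Longrightarrow> Q (\<pi> \<circ> \<rho>)"
    and Qconj: "\<And>\<pi> \<rho>. \<pi> \<in> Perm N \<Longrightarrow> \<rho> \<in> Perm N \<Longrightarrow> Q \<pi> \<Longrightarrow> Q (\<rho> \<circ> \<pi> \<circ> inv_into UNIV \<rho>)"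
    and \<theta>: "\<theta> \<in> Perm N" "Q \<theta>" "\<And>u. \<theta> (\<theta> u) = u"
    and u: "distinct [u1, u3, u2, u4]" "set [u1, u3, u2, u4] \<subseteq> cls N q" "\<theta> u1 = u2" "\<theta> u3 = u4"
    and x: "distinct [x1, x2, x3, x4]" "set [x1, x2, x3, x4] \<subseteq> cls N q"
  shows "Q (trans x1 x2 \<circ> trans x3 x4)"
proof -
  let ?t = trans
  have tP: "?t y y' \<in> Perm N" if "y \<in> cls N q" "y' \<in> cls N q" for y y'
    by (rule Perm_cls) (rule permutes_swap_id[OF that])
  define \<rho> where "\<rho> = ?t u1 u3"
  have \<rho>: "\<rho> \<in> Perm N" unfolding \<rho>_def using u by (intro tP) auto
  have inv\<rho>: "inv_into UNIV \<rho> = \<rho>" unfolding \<rho>_def by simp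
  have \<theta>u: "\<theta> u2 = u1" "\<theta> u4 = u3" using u(3,4) \<theta>(3) by metis+
  have D: "\<theta> \<circ> (\<rho> \<circ> \<theta> \<circ> inv_into UNIV \<rho>) = ?t u1 u3 \<circ> ?t u2 u4"
  proof
    fix x
    consider "x = u1" | "x = u2" | "x = u3" | "x = u4" | "x \<notin> {u1, u2, u3, u4}" by blast
    then show "(\<theta> \<circ> (\<rho> \<circ> \<theta> \<circ> inv_into UNIV \<rho>)) x = (?t u1 u3 \<circ> ?t u2 u4) x"
    proof cases
      case 5
      then have "\<theta> x \<noteq> u1" "\<theta> x \<noteq> u3" using \<theta>(3)[of x] u(3,4) by auto
      then show ?thesis using 5 \<theta>(3) unfolding inv\<rho> by (simp add: \<rho>_def Transposition.transpose_def)
    qed (use u \<theta>u in \<open>auto simp: inv\<rho> \<rho>_def Transposition.transpose_def\<close>)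
  qed
  have conjP: "\<rho> \<circ> \<theta> \<circ> inv_into UNIV \<rho> \<in> Perm N" using \<rho> \<theta>(1) by (intro Perm_comp Perm_inv)
  have QD: "Q (?t u1 u3 \<circ> ?t u2 u4)"
    unfolding D[symmetric] by (rule Qcomp[OF \<theta>(1) conjP \<theta>(2) Qconj[OF \<theta>(1) \<rho> \<theta>(2)]])
  obtain \<sigma> where \<sigma>: "\<sigma> permutes cls N q" "map \<sigma> [u1, u3, u2, u4] = [x1, x2, x3, x4]"
    using permutes_extend[OF u(1) x(1) _ u(2) x(2)] by auto
  have \<sigma>P: "\<sigma> \<in> Perm N" using \<sigma>(1) by (rule Perm_cls)
  have DP: "?t u1 u3 \<circ> ?t u2 u4 \<in> Perm N" using u by (intro Perm_comp tP) auto
  have "\<sigma> \<circ> (?t u1 u3 \<circ> ?t u2 u4) \<circ> inv_into UNIV \<sigma> = ?t x1 x2 \<circ> ?t x3 x4"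
    unfolding conj_comp[OF Perm_bij[OF \<sigma>P]] conj_transpose[OF Perm_bij[OF \<sigma>P]]
    using \<sigma>(2) by simp
  then show ?thesis using Qconj[OF DP \<sigma>P QD] by simp
qed

text \<open>In every nonempty follower class \<open>n\<close> chosen words are rotated and the
  others fixed. The enumeration \<open>\<phi> q\<close> is exposed because transpositions inside
  powers of \<open>\<tau>\<close> have to be exhibited on explicit words.\<close>

lemma cycle_exists:
  assumes "n > 0" "\<And>q. cls N q \<noteq> {} \<Longrightarrow> n \<le> card (cls N q)"
  shows "\<exists>\<tau> \<phi>. \<tau> \<in> Perm N \<and> (\<forall>u. (\<tau> ^^ n) u = u) \<and>
     (\<forall>q. cls N q \<noteq> {} \<longrightarrow> inj_on (\<phi> q) {..<n} \<and> \<phi> q ` {..<n} \<subseteq> cls N q \<and>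
        (\<forall>i<n. \<forall>k. (\<tau> ^^ k) (\<phi> q i) = \<phi> q ((i + k) mod n)))"
proof -
  have "\<exists>f. inj_on f {..<n} \<and> f ` {..<n} \<subseteq> cls N q" if "cls N q \<noteq> {}" for q
    using card_le_inj[of "{..<n}" "cls N q"] assms(2)[OF that] finite_cls by auto
  then obtain \<phi> where \<phi>: "\<And>q. cls N q \<noteq> {} \<Longrightarrow> inj_on (\<phi> q) {..<n}"
    "\<And>q. cls N q \<noteq> {} \<Longrightarrow> \<phi> q ` {..<n} \<subseteq> cls N q"
    by metis
  define cyc where "cyc u = (u \<in> W N \<and> u \<in> \<phi> (F u) ` {..<n})" for u
  define \<tau> where "\<tau> u = (if cyc u then \<phi> (F u) (Suc (inv_into {..<n} (\<phi> (F u)) u) mod n) else u)" for u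
  have ne: "cls N (F u) \<noteq> {}" if "u \<in> W N" for u using that by (auto simp: cls_def)
  have \<phi>F: "F (\<phi> q i) = q" "\<phi> q i \<in> W N" if "cls N q \<noteq> {}" "i < n" for q i
    using \<phi>(2)[OF that(1)] that(2) by (auto simp: cls_def)
  have \<tau>\<phi>: "\<tau> (\<phi> q i) = \<phi> q (Suc i mod n)" if "cls N q \<noteq> {}" "i < n" for q i
    using \<phi>F[OF that] that \<phi>(1)[OF that(1)] by (simp add: \<tau>_def cyc_def inv_into_f_f)
  have \<tau>k: "(\<tau> ^^ k) (\<phi> q i) = \<phi> q ((i + k) mod n)" if "cls N q \<noteq> {}" "i < n" for q i k
  proof (induction k)
    case (Suc k)
    then show ?case using \<tau>\<phi>[OF that(1), of "(i + k) mod n"] assms(1) by (simp add: mod_Suc_eq)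
  qed (use that in simp)
  have \<tau>fix: "\<tau> u = u" if "\<not> cyc u" for u using that by (simp add: \<tau>_def)
  have \<tau>n: "(\<tau> ^^ n) u = u" for u
  proof (cases "cyc u")
    case True
    then obtain i where "u = \<phi> (F u) i" "i < n" by (auto simp: cyc_def)
    then show ?thesis using \<tau>k[of "F u" i n] ne True by (simp add: cyc_def) 
  next
    case False
    have "(\<tau> ^^ k) u = u" for k by (induction k) (auto simp: \<tau>fix False)
    then show ?thesis .
  qed
  have "\<tau> (( \<tau> ^^ (n - 1)) u) = u" "(\<tau> ^^ (n - 1)) (\<tau> u) = u" for u
    using \<tau>n[of u] assms(1) by (cases n; simp add: funpow_swap1)+
  then have "bij \<tau>" by (intro bij_betw_byWitness[where f' = "\<tau> ^^ (n - 1)"]) auto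
  moreover have "\<tau> u = u" if "u \<notin> W N" for u by (rule \<tau>fix) (use that in \<open>simp add: cyc_def\<close>)
  ultimately have "\<tau> permutes W N" by (simp add: permutes_bij_def permutes_def bij_iff)
  moreover have "F (\<tau> u) = F u" for u
  proof (cases "cyc u")
    case True
    then show ?thesis using \<phi>F[OF ne, of u] assms(1) by (simp add: \<tau>_def cyc_def)
  qed (simp add: \<tau>fix)
  ultimately have "\<tau> \<in> Perm N" by (simp add: Perm_def)
  then show ?thesis using \<tau>n \<phi> \<tau>k by blast
qed

definition head_perm :: "nat \<Rightarrow> ('a list \<Rightarrow> 'a list) \<Rightarrow> 'a list set \<Rightarrow> 'a list \<Rightarrow> 'a list" where
  "head_perm n \<pi> U u = (if drop n u \<in> U then \<pi> (take n u) @ drop n u else u)"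

text \<open>For a fixed tail \<open>t\<close> the four words with heads \<open>c0\<close>, ...,
  \<open>c3\<close> lie in one follower class, since the heads have equal followers. The head
  permutation is the product of these double transpositions over the tails in
  \<open>U\<close>.\<close>

lemma head_perm_closure:
  assumes Qcomp: "\<And>\<pi> \<rho>. \<pi> \<in> Perm N \<Longrightarrow> \<rho> \<in> Perm N \<Longrightarrow> Q \<pi> \<Longrightarrow> Q \<rho> \<Longrightarrow> Q (\<pi> \<circ> \<rho>)"
    and Qid: "Q id"
    and Qdt: "\<And>x1 x2 x3 x4 q. distinct [x1, x2, x3, x4] \<Longrightarrow> set [x1, x2, x3, x4] \<subseteq> cls N q \<Longrightarrow>
      Q (trans x1 x2 \<circ> trans x3 x4)"
    and c: "distinct [c0, c1, c2, c3]" "set [c0, c1, c2, c3] \<subseteq> R n"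
    and U: "finite U" "\<And>t. t \<in> U \<Longrightarrow> length t = N - n \<and> c0 @ t \<in> L" and nN: "n \<le> N"
  shows "head_perm n (trans c0 c1 \<circ> trans c2 c3) U \<in> Perm N \<and>
    Q (head_perm n (trans c0 c1 \<circ> trans c2 c3) U)"
  using U
proof (induction U rule: finite_induct)
  let ?t = trans
  let ?p = "?t c0 c1 \<circ> ?t c2 c3"
  case empty
  have e: "head_perm n ?p {} = id" by (auto simp: head_perm_def)
  show ?case unfolding e using Qid Perm_id by blast
next
  let ?t = trans
  let ?p = "?t c0 c1 \<circ> ?t c2 c3"
  case (insert t U)
  have t: "length t = N - n" "c0 @ t \<in> L" using insert.prems by auto
  have lc: "length c = n" if "c \<in> {c0, c1, c2, c3}" for c using c(2) R_length that by auto
  have Fc: "F c = F c0" if "c \<in> {c0, c1, c2, c3}" for c using c(2) R_F that by auto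
  define q where "q = F (c0 @ t)"
  have mem: "c @ t \<in> cls N q" if "c \<in> {c0, c1, c2, c3}" for c
  proof -
    have app: "c @ b \<in> L \<longleftrightarrow> c0 @ b \<in> L" for b using Fc[OF that] by (auto simp: fol_def)
    have "F (c @ t) = q" using app[of "t @ _"] by (auto simp: fol_def q_def)
    moreover have "c @ t \<in> L" using app t by simp
    moreover have "starts c" using c(2) R_starts that by auto
    ultimately show ?thesis using t nN lc[OF that] by (simp add: cls_def W_def)
  qed
  have dist: "distinct [c0 @ t, c1 @ t, c2 @ t, c3 @ t]" using c(1) by simp
  have sub: "set [c0 @ t, c1 @ t, c2 @ t, c3 @ t] \<subseteq> cls N q" using mem by simp
  have "length t = N - n \<and> c0 @ t \<in> L" if "t \<in> U" for t using insert.prems that by blast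
  from insert.IH[OF this] have IH: "head_perm n ?p U \<in> Perm N" "Q (head_perm n ?p U)" by blast+
  have DP: "?t (c0 @ t) (c1 @ t) \<circ> ?t (c2 @ t) (c3 @ t) \<in> Perm N"
    by (intro Perm_comp Perm_cls[of _ N q] permutes_swap_id) (use mem in auto)
  have lp: "length (?p x) = length x" for x
    using lc by (auto simp: Transposition.transpose_def)
  have "head_perm n ?p (insert t U) = (?t (c0 @ t) (c1 @ t) \<circ> ?t (c2 @ t) (c3 @ t)) \<circ> head_perm n ?p U"
  proof
    fix u
    show "head_perm n ?p (insert t U) u = ((?t (c0 @ t) (c1 @ t) \<circ> ?t (c2 @ t) (c3 @ t)) \<circ> head_perm n ?p U) u"
    proof (cases "drop n u = t")
      case True
      define x where "x = take n u"
      have u: "u = x @ t" using True by (metis append_take_drop_id x_def)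
      have "head_perm n ?p U u = x @ t" using True insert.hyps u by (simp add: head_perm_def)
      moreover have "head_perm n ?p (insert t U) u = ?p x @ t"
        using True by (simp add: head_perm_def x_def)
      ultimately show ?thesis by (simp add: Transposition.transpose_def)
    next
      case False
      have "drop n (head_perm n ?p U u) = drop n u"
      proof (cases "n \<le> length u")
        case True
        then show ?thesis using lp[of "take n u"] by (auto simp: head_perm_def)
      next
        case False
        then have "length (head_perm n ?p U u) = length u"
          using lp[of "take n u"] by (simp add: head_perm_def)
        then show ?thesis using False by simp
      qed
      then have "head_perm n ?p U u \<noteq> c @ t" if "c \<in> {c0, c1, c2, c3}" for c
        using False lc[OF that] by auto
      then have "(?t (c0 @ t) (c1 @ t) \<circ> ?t (c2 @ t) (c3 @ t)) (head_perm n ?p U u) = head_perm n ?p U u"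
        by (simp add: Transposition.transpose_def)
      then show ?thesis using False by (simp add: head_perm_def)
    qed
  qed
  then show ?case using Perm_comp[OF DP IH(1)] Qcomp[OF DP IH(1) Qdt[OF dist sub] IH(2)] by metis
qed

end

text \<open>Links two block lengths: a gate on long blocks that alters only the heads is a gate on
  short blocks switched on at every \<open>j\<close>-th position.\<close>

lemma blk_gate_head:
  assumes N: "n > 0" "j > 0" and len: "\<And>v. length v = n \<Longrightarrow> length (p v) = n"
    and eq: "\<pi> (blk (n * j) x (k div int j)) = p (take n (blk (n * j) x (k div int j))) @ drop n (blk (n * j) x (k div int j))"
  shows "blk n (gate (n * j) \<pi> x) k = (if int j dvd k then p (blk n x k) else blk n x k)"
proof -
  define i where "i = k div int j"
  define r where "r = nat (k mod int j)"
  define u where "u = blk (n * j) x i"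
  have r: "r < j" "int r = k mod int j" using N by (auto simp: r_def nat_less_iff)
  have k: "k = int j * i + int r" by (simp add: r i_def)
  have "n * 1 \<le> n * j" using N by (intro mult_le_mono2) simp
  then have nj: "n \<le> n * j" by simp
  have take_u: "take n u = blk n x (int j * i)"
  proof (rule nth_equalityI)
    fix s assume "s < length (take n u)"
    then have "s < n" by simp
    then have s: "s < n" "s < n * j" using nj by linarith+
    then show "take n u ! s = blk n x (int j * i) ! s"
      by (simp add: u_def blk_def algebra_simps)
  qed (use nj in \<open>simp add: u_def\<close>)
  have lu: "length (take n u) = n" using N by (simp add: u_def)
  have val: "gate (n * j) \<pi> x (int n * k + int s) = (p (take n u) @ drop n u) ! (n * r + s)" if s: "s < n" for s
  proof -
    have "n * r + s < n * Suc r" using s by simp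
    also have "\<dots> \<le> n * j" using r by (intro mult_le_mono2) simp
    finally have lt: "int (n * r + s) < int (n * j)" by (simp only: of_nat_less_iff)
    have e: "int n * k + int s = int (n * r + s) + i * int (n * j)" by (simp add: k algebra_simps)
    have "(int n * k + int s) div int (n * j) = i"
      unfolding e using lt N by (subst div_mult_self1) (auto simp del: of_nat_mult of_nat_add)
    moreover have "(int n * k + int s) mod int (n * j) = int (n * r + s)"
      unfolding e using lt by (simp del: of_nat_mult of_nat_add)
    ultimately show ?thesis unfolding gate_def using eq by (simp add: u_def i_def del: of_nat_mult of_nat_add)
  qed
  show ?thesis
  proof (rule nth_equalityI)
    show "length (blk n (gate (n * j) \<pi> x) k) = length (if int j dvd k then p (blk n x k) else blk n x k)"
      using len by simp
    fix s assume "s < length (blk n (gate (n * j) \<pi> x) k)"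
    then have s: "s < n" by simp
    have lhs: "blk n (gate (n * j) \<pi> x) k ! s = (p (take n u) @ drop n u) ! (n * r + s)"
      using s val[OF s] by (simp add: blk_def)
    show "blk n (gate (n * j) \<pi> x) k ! s = (if int j dvd k then p (blk n x k) else blk n x k) ! s"
    proof (cases "r = 0")
      case True
      then have "int j dvd k" using k by simp
      moreover have "k = int j * i" using k True by simp
      ultimately show ?thesis unfolding lhs using True s len[OF lu] take_u by (simp add: nth_append)
    next
      case False
      then have nd: "\<not> int j dvd k" using r by (simp add: dvd_eq_mod_eq_0)
      have "n * 1 \<le> n * r" using False by (intro mult_le_mono2) simp
      then have ge: "n \<le> n * r + s" unfolding mult_1_right by linarith
      have "n * r + s < n * Suc r" using s by simp
      also have "\<dots> \<le> n * j" using r by (intro mult_le_mono2) simp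
      finally have lt: "n * r + s < n * j" .
      have "(p (take n u) @ drop n u) ! (n * r + s) = u ! (n * r + s)"
      proof -
        have "n \<le> length u" using nj by (simp add: u_def)
        then show ?thesis using ge len[OF lu] by (simp add: nth_append)
      qed
      also have "\<dots> = x (int (n * j) * i + int (n * r + s))"
        using lt by (simp add: u_def blk_def del: of_nat_mult of_nat_add)
      also have "int (n * j) * i + int (n * r + s) = int n * k + int s" by (simp add: k algebra_simps)
      finally show ?thesis unfolding lhs using nd s by (simp add: blk_def)
    qed
  qed
qed

section \<open>Cyclic subgroups and their normal closures\<close>

context mixing_sofic
begin

text \<open>A submonoid stable under conjugation, with \<open>h'\<close> in the role of the inverse
  of \<open>h\<close>. It is phrased with composition of maps, matching the computations with
  gates.\<close>

definition normal_in :: "nat \<Rightarrow> ((int \<Rightarrow> 'a) \<Rightarrow> int \<Rightarrow> 'a) set \<Rightarrow> bool" where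
  "normal_in N K \<longleftrightarrow> restrict id X \<in> K \<and> (\<forall>f\<in>K. \<forall>h\<in>K. compose X f h \<in> K) \<and>
     (\<forall>f\<in>K. \<forall>h\<in>AutN N. \<forall>h'\<in>AutN N. (\<forall>x\<in>X. h (h' x) = x) \<longrightarrow> compose X h (compose X f h') \<in> K)"

lemma normal_in_id: "normal_in N K \<Longrightarrow> restrict id X \<in> K"
  and normal_in_comp: "normal_in N K \<Longrightarrow> f \<in> K \<Longrightarrow> h \<in> K \<Longrightarrow> compose X f h \<in> K"
  and normal_in_conj: "normal_in N K \<Longrightarrow> f \<in> K \<Longrightarrow> h \<in> AutN N \<Longrightarrow> h' \<in> AutN N \<Longrightarrow>
    (\<And>x. x \<in> X \<Longrightarrow> h (h' x) = x) \<Longrightarrow> compose X h (compose X f h') \<in> K"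
  by (auto simp: normal_in_def)

lemma gate_comp_restrict:
  assumes "adm X N \<pi>" "adm X N \<rho>"
  shows "restrict (gate N (\<pi> \<circ> \<rho>)) X = compose X (restrict (gate N \<pi>) X) (restrict (gate N \<rho>) X)"
  by (rule ext) (simp add: compose_def restrict_def gate_X[OF assms(2)] gate_gate[OF assms(2,1)])

lemma funpow_gate:
  assumes "\<pi> \<in> Perm N" "N > 0" "x \<in> X"
  shows "\<pi> ^^ k \<in> Perm N" "(restrict (gate N \<pi>) X ^^ k) x = gate N (\<pi> ^^ k) x"
proof -
  show P: "\<pi> ^^ k \<in> Perm N" for k
    by (induction k) (use Perm_id Perm_comp[OF assms(1)] in \<open>auto simp: id_def comp_def\<close>)
  have a: "adm X N (\<pi> ^^ k)" for k using P assms(2) by (rule Perm_adm)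
  show "(restrict (gate N \<pi>) X ^^ k) x = gate N (\<pi> ^^ k) x"
  proof (induction k)
    case 0
    show ?case using assms(2) by (simp add: gate_ident)
  next
    case (Suc k)
    then show ?case
      using gate_X[OF a assms(3)] gate_gate[OF a Perm_adm[OF assms(1,2)]] by (simp add: comp_def)
  qed
qed

lemma four_in_R: "\<exists>n0. \<forall>n\<ge>n0. \<exists>c0 c1 c2 c3. distinct [c0, c1, c2, c3] \<and> set [c0, c1, c2, c3] \<subseteq> R n"
proof -
  obtain n0 where n0: "\<And>n. n \<ge> n0 \<Longrightarrow> 4 \<le> card (R n)" using R_card by blast
  have "\<exists>c0 c1 c2 c3. distinct [c0, c1, c2, c3] \<and> set [c0, c1, c2, c3] \<subseteq> R n" if n: "n \<ge> n0" for n
  proof -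
    obtain D where D: "D \<subseteq> R n" "card D = 4" using n0[OF n] obtain_subset_with_card_n by metis
    then have "finite D" using finite_R finite_subset by blast
    then obtain xs where xs: "set xs = D" "distinct xs" using finite_distinct_list by blast
    then have "length xs = 4" using D by (metis distinct_card)
    then obtain c0 c1 c2 c3 where "xs = [c0, c1, c2, c3]"
      by (auto simp: numeral_eq_Suc length_Suc_conv)
    then show ?thesis using xs D by blast
  qed
  then show ?thesis by blast
qed

text \<open>\<open>\<kappa>\<close> is the product of shifted copies of its restriction to every \<open>j\<close>-th block, and that
  restriction is a product of double transpositions of words with equal followers; these lie in the
  normal closure of every involution that contains two transpositions in each follower class.\<close>

lemma large_cyclic_subgroup:
  assumes "d > 0"
  shows "\<exists>N1 \<kappa> c. N1 > 0 \<and> d dvd N1 \<and> \<kappa> \<in> AutN N1 \<and> (\<exists>x\<in>X. \<kappa> x \<noteq> x) \<and>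
    (\<forall>j>0. \<forall>a\<ge>2. c \<le> N1 * j \<longrightarrow> 2 ^ a \<le> card {u \<in> L. length u = N1 * j - c} \<longrightarrow>
      (\<exists>\<tau>\<in>AutN (N1 * j). (\<forall>x\<in>X. (\<tau> ^^ (2 ^ a)) x = x) \<and>
        (\<forall>K. normal_in (N1 * j) K \<longrightarrow> restrict (\<tau> ^^ (2 ^ (a - 1))) X \<in> K \<longrightarrow> \<kappa> \<in> K)))"
proof -
  obtain n0 where n0: "\<And>n. n \<ge> n0 \<Longrightarrow> \<exists>c0 c1 c2 c3. distinct [c0, c1, c2, c3] \<and> set [c0, c1, c2, c3] \<subseteq> R n"
    using four_in_R by blast
  obtain c where c: "\<And>N q. c \<le> N \<Longrightarrow> cls N q \<noteq> {} \<Longrightarrow> card {u \<in> L. length u = N - c} \<le> card (cls N q)"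
    using card_cls by blast
  \<comment> \<open>A multiple of \<open>d\<close>, and long enough for four distinct return
    blocks.\<close>
  define N1 where "N1 = d * Suc n0"
  have "1 * Suc n0 \<le> d * Suc n0" using assms by (intro mult_le_mono1) simp
  then have N1: "N1 > 0" "N1 \<ge> n0" "d dvd N1" by (auto simp: N1_def)
  obtain c0 c1 c2 c3 where cs: "distinct [c0, c1, c2, c3]" "set [c0, c1, c2, c3] \<subseteq> R N1"
    using n0[OF N1(2)] by blast
  let ?t = trans
  define p where "p = ?t c0 c1 \<circ> ?t c2 c3"
  have inR: "c \<in> R N1" if "c \<in> {c0, c1, c2, c3}" for c using cs that by auto
  have ctx: "ctx X c = ctx X c'" if "c \<in> {c0, c1, c2, c3}" "c' \<in> {c0, c1, c2, c3}" for c c'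
    using inR[OF that(1)] inR[OF that(2)] by (intro ctx_eqI) (auto simp: R_starts R_F)
  have admp: "adm X N1 p"
    unfolding p_def using N1 R_length[OF inR] ctx by (intro adm_comp adm_transpose) auto
  have lp: "length (p v) = N1" if "length v = N1" for v using adm_length[OF admp that] .
  have pfix: "p v = v" if "v \<notin> {c0, c1, c2, c3}" for v
    using that by (auto simp: p_def Transposition.transpose_def)
  define \<kappa> where "\<kappa> = restrict (gate N1 p) X"
  have \<kappa>A: "\<kappa> \<in> AutN N1" unfolding \<kappa>_def by (rule gate_Aut[OF admp])
  have "\<exists>x\<in>X. \<kappa> x \<noteq> x"
  proof -
    have "c0 \<in> L" "length c0 = N1" using inR[of c0] by (auto simp: R_L R_length)
    then obtain x where x: "x \<in> X" "blk N1 x 0 = c0" using L_obtain[of c0 0] by (auto simp: blk_def)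
    have "length (p (blk N1 x 0)) = N1" by (rule lp) simp
    then have "blk N1 (\<kappa> x) 0 = p c0" using blk_gate[OF N1(1), of p x 0] x by (simp add: \<kappa>_def)
    moreover have "p c0 = c1" using cs by (auto simp: p_def Transposition.transpose_def)
    ultimately have "\<kappa> x \<noteq> x" using x cs by auto
    then show ?thesis using x by blast
  qed
  moreover have "\<exists>\<tau>\<in>AutN (N1 * j). (\<forall>x\<in>X. (\<tau> ^^ (2 ^ a)) x = x) \<and>
        (\<forall>K. normal_in (N1 * j) K \<longrightarrow> restrict (\<tau> ^^ (2 ^ (a - 1))) X \<in> K \<longrightarrow> \<kappa> \<in> K)"
    if j: "j > 0" and a: "a \<ge> 2" and cN: "c \<le> N1 * j" and card: "2 ^ a \<le> card {u \<in> L. length u = N1 * j - c}" for j a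
  proof -
    define N where "N = N1 * j"
    have N: "N > 0" "N1 \<le> N" using N1 j by (auto simp: N_def)
    \<comment> \<open>Half the cycle length. From \<open>a \<ge> 2\<close> follows
      \<open>h \<ge> 2\<close>, so the \<open>h\<close>-th power of a cycle contains two disjoint
      transpositions, the input of \<open>double_transpositions\<close>.\<close>
    define h :: nat where "h = 2 ^ (a - 1)"
    have "(2::nat) ^ 1 \<le> 2 ^ (a - 1)" using a by (intro power_increasing) auto
    then have h: "h \<ge> 2" by (simp add: h_def)
    have n: "2 ^ a = 2 * h" using a unfolding h_def by (metis Suc_diff_1 Suc_1 less_le_trans pos2 power_Suc)
    have "0 < 2 * h" using h by simp
    have big: "2 * h \<le> card (cls N q)" if "cls N q \<noteq> {}" for q
      using c[OF cN, of q] that card unfolding n N_def by linarith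
    have ex: "\<exists>t0 \<phi>. t0 \<in> Perm N \<and> (\<forall>u. (t0 ^^ (2 * h)) u = u) \<and>
     (\<forall>q. cls N q \<noteq> {} \<longrightarrow> inj_on (\<phi> q) {..<2 * h} \<and> \<phi> q ` {..<2 * h} \<subseteq> cls N q \<and>
        (\<forall>i<2 * h. \<forall>k. (t0 ^^ k) (\<phi> q i) = \<phi> q ((i + k) mod (2 * h))))"
      by (rule cycle_exists[OF \<open>0 < 2 * h\<close>]) (rule big)
    obtain t0 \<phi> where cyc: "t0 \<in> Perm N \<and> (\<forall>u. (t0 ^^ (2 * h)) u = u) \<and>
     (\<forall>q. cls N q \<noteq> {} \<longrightarrow> inj_on (\<phi> q) {..<2 * h} \<and> \<phi> q ` {..<2 * h} \<subseteq> cls N q \<and>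
        (\<forall>i<2 * h. \<forall>k. (t0 ^^ k) (\<phi> q i) = \<phi> q ((i + k) mod (2 * h))))"
      using ex by (elim exE) (rule that)
    have t0: "t0 \<in> Perm N" "\<And>u. (t0 ^^ (2 * h)) u = u"
      and \<phi>: "\<And>q. cls N q \<noteq> {} \<Longrightarrow> inj_on (\<phi> q) {..<2 * h}"
        "\<And>q. cls N q \<noteq> {} \<Longrightarrow> \<phi> q ` {..<2 * h} \<subseteq> cls N q"
        "\<And>q i k. cls N q \<noteq> {} \<Longrightarrow> i < 2 * h \<Longrightarrow> (t0 ^^ k) (\<phi> q i) = \<phi> q ((i + k) mod (2 * h))"
      using cyc by simp_all
    define \<gamma> where "\<gamma> \<pi> = restrict (gate N \<pi>) X" for \<pi>
    have \<gamma>A: "\<gamma> \<pi> \<in> AutN N" if "\<pi> \<in> Perm N" for \<pi>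
      unfolding \<gamma>_def by (rule gate_Aut[OF Perm_adm[OF that N(1)]])
    have \<gamma>comp: "\<gamma> (\<pi> \<circ> \<rho>) = compose X (\<gamma> \<pi>) (\<gamma> \<rho>)" if "\<pi> \<in> Perm N" "\<rho> \<in> Perm N" for \<pi> \<rho>
      unfolding \<gamma>_def by (rule gate_comp_restrict) (use that Perm_adm N in auto)
    have pow: "(\<gamma> t0 ^^ k) x = gate N (t0 ^^ k) x" if "x \<in> X" for k x
      unfolding \<gamma>_def by (rule funpow_gate(2)[OF t0(1) N(1) that])
    have "t0 ^^ (2 * h) = id" using t0(2) by auto
    then have "(\<gamma> t0 ^^ (2 ^ a)) x = x" if "x \<in> X" for x
      unfolding n using pow[OF that, of "2 * h"] N(1) by (simp add: gate_ident)
    moreover have "\<kappa> \<in> K" if K: "normal_in N K" and tK: "restrict (\<gamma> t0 ^^ h) X \<in> K" for K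
    proof -
      define \<theta> where "\<theta> = t0 ^^ h"
      define Q where "Q \<pi> \<longleftrightarrow> \<gamma> \<pi> \<in> K" for \<pi>
      obtain x0 where x0: "x0 \<in> X" using X_nonempty by blast
      have \<theta>P: "\<theta> \<in> Perm N" unfolding \<theta>_def by (rule funpow_gate(1)[OF t0(1) N(1) x0])
      have "restrict (\<gamma> t0 ^^ h) X = restrict (gate N \<theta>) X"
        by (rule restrict_ext) (simp add: pow \<theta>_def)
      then have "restrict (\<gamma> t0 ^^ h) X = \<gamma> \<theta>" unfolding \<gamma>_def[of \<theta>] .
      then have Q\<theta>: "Q \<theta>" using tK by (simp add: Q_def)
      have \<theta>\<theta>: "\<theta> (\<theta> u) = u" for u using t0(2)[of u] by (simp add: \<theta>_def mult_2 funpow_add)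
      have Qcomp: "Q (\<pi> \<circ> \<rho>)" if "\<pi> \<in> Perm N" "\<rho> \<in> Perm N" "Q \<pi>" "Q \<rho>" for \<pi> \<rho>
        using that normal_in_comp[OF K] by (simp add: Q_def \<gamma>comp)
      have Qid: "Q id"
      proof -
        have "\<gamma> id = restrict id X" unfolding \<gamma>_def using N by (auto simp: gate_ident)
        then show ?thesis using normal_in_id[OF K] by (simp add: Q_def)
      qed
      have Qconj: "Q (\<rho> \<circ> \<pi> \<circ> inv_into UNIV \<rho>)" if p: "\<pi> \<in> Perm N" "\<rho> \<in> Perm N" "Q \<pi>" for \<pi> \<rho>
      proof -
        let ?i = "inv_into UNIV \<rho>"
        have i: "?i \<in> Perm N" using p by (intro Perm_inv)
        have "\<rho> \<circ> ?i = id" using Perm_bij[OF p(2)] by (simp add: fun_eq_iff bij_is_surj surj_f_inv_f)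
        then have "compose X (\<gamma> \<rho>) (\<gamma> ?i) = \<gamma> id" using \<gamma>comp[OF p(2) i] by simp
        then have "\<gamma> \<rho> (\<gamma> ?i x) = \<gamma> id x" if "x \<in> X" for x
          using that by (metis compose_eq)
        then have inv: "\<gamma> \<rho> (\<gamma> ?i x) = x" if "x \<in> X" for x
          using that N by (simp add: \<gamma>_def gate_ident)
        have "compose X (\<gamma> \<rho>) (compose X (\<gamma> \<pi>) (\<gamma> ?i)) \<in> K"
          by (rule normal_in_conj[OF K _ \<gamma>A[OF p(2)] \<gamma>A[OF i] inv]) (use p in \<open>simp_all add: Q_def\<close>)
        moreover have "\<gamma> (\<rho> \<circ> (\<pi> \<circ> ?i)) = compose X (\<gamma> \<rho>) (compose X (\<gamma> \<pi>) (\<gamma> ?i))"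
          using \<gamma>comp[OF p(2) Perm_comp[OF p(1) i]] \<gamma>comp[OF p(1) i] by simp
        ultimately show ?thesis by (simp add: Q_def comp_assoc)
      qed
      have Qdt: "Q (?t x1 x2 \<circ> ?t x3 x4)"
        if x: "distinct [x1, x2, x3, x4]" "set [x1, x2, x3, x4] \<subseteq> cls N q" for x1 x2 x3 x4 q
      proof -
        have ne: "cls N q \<noteq> {}" using x by auto
        have inj: "\<phi> q i = \<phi> q k \<longleftrightarrow> i = k" if "i < 2 * h" "k < 2 * h" for i k
          using inj_on_eq_iff[OF \<phi>(1)[OF ne]] that by auto
        have mem: "\<phi> q i \<in> cls N q" if "i < 2 * h" for i using \<phi>(2)[OF ne] that by auto
        show ?thesis
        proof (rule double_transpositions[OF Qcomp Qconj \<theta>P Q\<theta> \<theta>\<theta> _ _ _ _ x])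
          show "distinct [\<phi> q 0, \<phi> q 1, \<phi> q h, \<phi> q (h + 1)]" using h by (simp add: inj)
          show "set [\<phi> q 0, \<phi> q 1, \<phi> q h, \<phi> q (h + 1)] \<subseteq> cls N q" using h mem by simp
          show "\<theta> (\<phi> q 0) = \<phi> q h" "\<theta> (\<phi> q 1) = \<phi> q (h + 1)"
            using \<phi>(3)[OF ne, of 0 h] \<phi>(3)[OF ne, of 1 h] h by (simp_all add: \<theta>_def)
        qed
      qed
      define U where "U = {t. length t = N - N1 \<and> c0 @ t \<in> L}"
      have "finite U"
        by (rule finite_subset[OF _ finite_words[of "N - N1"]]) (auto simp: U_def dest: L_appendD2)
      have "head_perm N1 p U \<in> Perm N \<and> Q (head_perm N1 p U)"
        unfolding p_def
      proof (rule head_perm_closure[OF Qcomp Qid _ cs \<open>finite U\<close> _ N(2)])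
        show "Q (?t x1 x2 \<circ> ?t x3 x4)"
          if "distinct [x1, x2, x3, x4]" "set [x1, x2, x3, x4] \<subseteq> cls N q" for x1 x2 x3 x4 q
          by (rule Qdt[OF that])
        show "length t = N - N1 \<and> c0 @ t \<in> L" if "t \<in> U" for t using that by (simp add: U_def)
      qed
      then have \<pi>1: "head_perm N1 p U \<in> Perm N" "Q (head_perm N1 p U)" by blast+
      define \<pi>1 where "\<pi>1 = head_perm N1 p U"
      have head: "\<pi>1 u = p (take N1 u) @ drop N1 u" if u: "u \<in> L" "length u = N" for u
      proof (cases "drop N1 u \<in> U")
        case False
        \<comment> \<open>All four heads have the same followers, so a tail outside \<open>U\<close>
          can follow none of them and \<open>p\<close> fixes the head.\<close>
        have "take N1 u \<notin> {c0, c1, c2, c3}"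
        proof
          assume "take N1 u \<in> {c0, c1, c2, c3}"
          then have "F (take N1 u) = F c0" using inR R_F by (metis insertI1)
          moreover have "drop N1 u \<in> F (take N1 u)" using u by (simp add: fol_def)
          ultimately have "c0 @ drop N1 u \<in> L" by (simp add: fol_def)
          then show False using False u by (simp add: U_def)
        qed
        then show ?thesis using False pfix by (simp add: \<pi>1_def head_perm_def)
      qed (simp add: \<pi>1_def head_perm_def)
      have adm1: "adm X N \<pi>1" using Perm_adm[OF \<pi>1(1) N(1)] by (simp add: \<pi>1_def)
      have head_blk: "blk N1 (gate N \<pi>1 x) k = (if int j dvd k then p (blk N1 x k) else blk N1 x k)"
        if x: "x \<in> X" for x k
        unfolding N_def
      proof (rule blk_gate_head[OF N1(1) j lp])
        have "blk N x (k div int j) \<in> L" unfolding blk_def by (rule win_in_L[OF x])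
        then show "\<pi>1 (blk (N1 * j) x (k div int j)) =
          p (take N1 (blk (N1 * j) x (k div int j))) @ drop N1 (blk (N1 * j) x (k div int j))"
          using head[of "blk N x (k div int j)"] by (simp add: N_def)
      qed
      \<comment> \<open>Conjugating by a translation of \<open>i\<close> short blocks moves the
        action from the multiples of \<open>j\<close> to the residue class of \<open>i\<close>; the
        product over all residues is \<kappa>.\<close>
      define \<kappa>i where "\<kappa>i i = compose X (restrict (sh (- (int N1 * i))) X) (compose X (\<gamma> \<pi>1) (restrict (sh (int N1 * i)) X))" for i
      have \<kappa>iK: "\<kappa>i i \<in> K" for i
        unfolding \<kappa>i_def by (rule normal_in_conj[OF K _ sh_Aut sh_Aut])
          (use \<pi>1(2) in \<open>auto simp: Q_def \<pi>1_def\<close>)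
      have \<kappa>i_eq: "\<kappa>i i x = sh (int N1 * (- i)) (gate N \<pi>1 (sh (int N1 * i) x))" if "x \<in> X" for i x
        using that gate_X[OF adm1] by (simp add: \<kappa>i_def compose_eq \<gamma>_def)
      have \<kappa>iX: "\<kappa>i i x \<in> X" if "x \<in> X" for i x
        unfolding \<kappa>i_eq[OF that] using that gate_X[OF adm1] by simp
      have \<kappa>i_blk: "blk N1 (\<kappa>i i x) k = (if int j dvd k - i then p (blk N1 x k) else blk N1 x k)" if "x \<in> X" for i x k
        unfolding \<kappa>i_eq[OF that] blk_sh using that by (simp add: head_blk blk_sh)
      define \<Phi> where "\<Phi> = rec_nat (restrict id X) (\<lambda>m f. compose X (\<kappa>i (int m)) f)"
      have \<Phi>0: "\<Phi> 0 = restrict id X" and \<Phi>S: "\<Phi> (Suc m) = compose X (\<kappa>i (int m)) (\<Phi> m)" for m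
        by (simp_all add: \<Phi>_def)
      have \<Phi>K: "\<Phi> m \<in> K" for m
      proof (induction m)
        case 0
        show ?case unfolding \<Phi>0 by (rule normal_in_id[OF K])
      next
        case (Suc m)
        show ?case unfolding \<Phi>S by (rule normal_in_comp[OF K \<kappa>iK Suc])
      qed
      have \<Phi>b: "\<Phi> m x \<in> X \<and> (\<forall>k. blk N1 (\<Phi> m x) k = (if k mod int j < int m then p (blk N1 x k) else blk N1 x k))"
        if x: "x \<in> X" and m: "m \<le> j" for m x
        using m
      proof (induction m)
        case 0
        have "\<not> k mod int j < 0" for k using j by (simp add: not_less)
        then show ?case using x by (simp add: \<Phi>0)
      next
        case (Suc m)
        then have IH: "\<Phi> m x \<in> X" "\<And>k. blk N1 (\<Phi> m x) k = (if k mod int j < int m then p (blk N1 x k) else blk N1 x k)"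
          by auto
        have eq: "\<Phi> (Suc m) x = \<kappa>i (int m) (\<Phi> m x)" using x by (simp add: \<Phi>S compose_eq)
        have dvd: "int j dvd k - int m \<longleftrightarrow> k mod int j = int m" for k
          using Suc.prems by (simp add: mod_eq_dvd_iff[symmetric])
        have "blk N1 (\<Phi> (Suc m) x) k = (if k mod int j < int (Suc m) then p (blk N1 x k) else blk N1 x k)" for k
          unfolding eq \<kappa>i_blk[OF IH(1)] IH(2) dvd by auto
        then show ?case using \<kappa>iX[OF IH(1)] eq by simp
      qed
      have "\<Phi> j = \<kappa>"
      proof
        fix x
        show "\<Phi> j x = \<kappa> x"
        proof (cases "x \<in> X")
          case True
          have "blk N1 (\<Phi> j x) k = blk N1 (gate N1 p x) k" for k
            using \<Phi>b[OF True, of j] j N1 lp by (simp add: blk_gate)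
          then have "\<Phi> j x = gate N1 p x" by (rule blk_eqI[OF N1(1)])
          then show ?thesis using True by (simp add: \<kappa>_def)
        next
          case False
          then show ?thesis using j by (cases j) (auto simp: \<Phi>S compose_def \<kappa>_def)
        qed
      qed
      then show ?thesis using \<Phi>K by metis
    qed
    ultimately show ?thesis
      using \<gamma>A[OF t0(1)] unfolding N_def h_def by blast
  qed
  ultimately show ?thesis using N1 \<kappa>A by blast
qed

end

section \<open>Entropy as the growth rate of the language\<close>

text \<open>The limit is the infimum of \<open>f n / n\<close>; division with remainder by an index
  that nearly attains it bounds the quotients for large \<open>n\<close>.\<close>

lemma fekete:
  fixes f :: "nat \<Rightarrow> real"
  assumes nonneg: "\<And>n. 0 \<le> f n" and sub: "\<And>m n. f (m + n) \<le> f m + f n"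
  shows "\<exists>h. (\<lambda>n. f n / real n) \<longlonglongrightarrow> h"
proof -
  define S where "S = (\<lambda>n. f n / real n) ` {1..}"
  define h where "h = Inf S"
  have bdd: "bdd_below S"
    unfolding S_def by (rule bdd_belowI2[of _ 0]) (use nonneg in auto)
  have le: "h \<le> f n / real n" if "n \<ge> 1" for n
    unfolding h_def by (rule cInf_lower[OF _ bdd]) (use that in \<open>auto simp: S_def\<close>)
  have mult: "f (q * m + r) \<le> real q * f m + f r" for q m r
  proof (induction q)
    case (Suc q)
    have "f (Suc q * m + r) = f (m + (q * m + r))" by (simp add: algebra_simps)
    also have "\<dots> \<le> f m + f (q * m + r)" by (rule sub)
    finally show ?case using Suc by (simp add: algebra_simps)
  qed simp
  have "(\<lambda>n. f n / real n) \<longlonglongrightarrow> h"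
  proof (rule LIMSEQ_I)
    fix \<epsilon> :: real assume \<epsilon>: "\<epsilon> > 0"
    have "S \<noteq> {}" by (auto simp: S_def)
    then obtain y where y: "y \<in> S" "y < h + \<epsilon> / 2"
      using cInf_lessD[of S "h + \<epsilon> / 2"] \<epsilon> unfolding h_def by auto
    then obtain m where m: "m \<ge> 1" "f m / real m < h + \<epsilon> / 2" by (auto simp: S_def)
    define C where "C = Max (f ` {..<m})"
    have C: "f r \<le> C" if "r < m" for r unfolding C_def using that by (intro Max_ge) auto
    have C0: "0 \<le> C" using C[of 0] m nonneg[of 0] by simp
    obtain N0 :: nat where N0: "real N0 > 2 * C / \<epsilon>" using reals_Archimedean2 by blast
    show "\<exists>no. \<forall>n\<ge>no. norm (f n / real n - h) < \<epsilon>"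
    proof (intro exI[of _ "max N0 1"] allI impI)
      fix n assume n: "max N0 1 \<le> n"
      define q where "q = n div m"
      have "f n \<le> real q * f m + f (n mod m)"
        using mult[of q m "n mod m"] by (simp add: q_def)
      also have "\<dots> \<le> real q * f m + C" using C[of "n mod m"] m by simp
      finally have 1: "f n \<le> real q * f m + C" .
      have "real q * real m \<le> real n"
        by (metis div_times_less_eq_dividend of_nat_le_iff of_nat_mult q_def)
      then have "real q \<le> real n / real m" using m by (simp add: field_simps)
      then have "real q * f m \<le> real n / real m * f m" by (intro mult_right_mono nonneg)
      then have 2: "f n \<le> real n * (f m / real m) + C" using 1 by simp
      have n0: "real n > 0" using n by simp
      have "f n / real n \<le> (real n * (f m / real m) + C) / real n"
        using 2 n0 by (intro divide_right_mono) auto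
      also have "\<dots> = f m / real m + C / real n" using n0 by (simp add: field_simps)
      also have "\<dots> < h + \<epsilon> / 2 + \<epsilon> / 2"
      proof (rule add_strict_mono[OF m(2)])
        have "real N0 \<le> real n" using n by simp
        then have "2 * C / \<epsilon> < real n" using N0 by linarith
        then show "C / real n < \<epsilon> / 2" using \<epsilon> n0 by (simp add: field_simps)
      qed
      finally have "f n / real n < h + \<epsilon>" by simp
      moreover have "h \<le> f n / real n" using n by (intro le) simp
      ultimately show "norm (f n / real n - h) < \<epsilon>" by simp
    qed
  qed
  then show ?thesis by blast
qed

context subshift_space
begin

definition complexity :: "nat \<Rightarrow> nat" where
  "complexity n = card {u \<in> L. length u = n}"

lemma complexity_pos: "complexity n \<ge> 1"
proof -
  obtain x where "x \<in> X" using X_nonempty by blast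
  then have "win x 0 n \<in> {u \<in> L. length u = n}" by (simp add: win_in_L)
  then have "card {u \<in> L. length u = n} > 0" using finite_words card_gt_0_iff by blast
  then show ?thesis by (simp add: complexity_def)
qed

lemma complexity_add: "complexity (m + n) \<le> complexity m * complexity n"
proof -
  let ?f = "\<lambda>u. (take m u, drop m u)"
  have "inj_on ?f {u \<in> L. length u = m + n}"
  proof (rule inj_onI)
    fix u v :: "'a list" assume "?f u = ?f v"
    then have "take m u @ drop m u = take m v @ drop m v" by simp
    then show "u = v" by (simp only: append_take_drop_id)
  qed
  moreover have "?f ` {u \<in> L. length u = m + n} \<subseteq> {u \<in> L. length u = m} \<times> {u \<in> L. length u = n}"
  proof
    fix y assume "y \<in> ?f ` {u \<in> L. length u = m + n}"
    then obtain u where u: "u \<in> L" "length u = m + n" "y = ?f u" by blast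
    have e: "take m u @ drop m u \<in> L" using u by simp
    show "y \<in> {u \<in> L. length u = m} \<times> {u \<in> L. length u = n}"
      using u L_appendD1[OF e] L_appendD2[OF e] by simp
  qed
  ultimately have "card {u \<in> L. length u = m + n} \<le> card ({u \<in> L. length u = m} \<times> {u \<in> L. length u = n})"
    by (rule card_inj_on_le) (simp add: finite_words)
  then show ?thesis by (simp add: complexity_def card_cartesian_product)
qed

lemma complexity_lim: "\<exists>h. (\<lambda>n. ln (real (complexity n)) / real n) \<longlonglongrightarrow> h"
proof (rule fekete)
  show "0 \<le> ln (real (complexity n))" for n using complexity_pos[of n] by simp
  show "ln (real (complexity (m + n))) \<le> ln (real (complexity m)) + ln (real (complexity n))" for m n
  proof -
    have pos: "real (complexity n) > 0" for n using complexity_pos[of n] by simp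
    have "real (complexity (m + n)) \<le> real (complexity m) * real (complexity n)"
      using complexity_add[of m n] by (metis of_nat_le_iff of_nat_mult)
    then have "ln (real (complexity (m + n))) \<le> ln (real (complexity m) * real (complexity n))"
      using pos by simp
    then show ?thesis using pos[of m] pos[of n] by (simp add: ln_mult)
  qed
qed

definition growth_rate :: real where
  "growth_rate = lim (\<lambda>n. ln (real (complexity n)) / real n)"

lemma growth_rate: "(\<lambda>n. ln (real (complexity n)) / real n) \<longlonglongrightarrow> growth_rate"
  unfolding growth_rate_def using complexity_lim limI by blast

text \<open>With a Lebesgue radius \<open>R\<close> of the cover, the letters from
  \<open>- R\<close> to \<open>n + R\<close> select a member of the join containing the point, so
  one member per word of length \<open>n + (2 * R + 1)\<close> suffices.\<close>

lemma subcover_bound: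
  assumes cov: "open_cover_of space_top \<U>"
  shows "\<exists>r. \<forall>n. \<exists>\<V>\<subseteq>cover_join space_top shift \<U> n. finite \<V> \<and> card \<V> \<le> complexity (n + r) \<and> \<Union>\<V> = X"
proof -
  have "\<exists>R. \<forall>x\<in>X. \<exists>U\<in>\<U>. \<forall>y\<in>X. agree R x y \<longrightarrow> y \<in> U"
    by (rule lebesgue_number) (use cov in \<open>simp_all add: open_cover_of_def\<close>)
  then obtain R where R: "\<forall>x\<in>X. \<exists>U. U \<in> \<U> \<and> (\<forall>y\<in>X. agree R x y \<longrightarrow> y \<in> U)"
    unfolding Bex_def by (elim exE)
  from bchoice[OF R] obtain c where
    "\<forall>x\<in>X. c x \<in> \<U> \<and> (\<forall>y\<in>X. agree R x y \<longrightarrow> y \<in> c x)" by (elim exE)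
  then have c: "\<And>x. x \<in> X \<Longrightarrow> c x \<in> \<U>" "\<And>x y. x \<in> X \<Longrightarrow> y \<in> X \<Longrightarrow> agree R x y \<Longrightarrow> y \<in> c x"
    by simp_all
  have "\<exists>\<V>\<subseteq>cover_join space_top shift \<U> n. finite \<V> \<and> card \<V> \<le> complexity (n + (2 * R + 1)) \<and> \<Union>\<V> = X" for n
  proof -
    let ?Ws = "{u \<in> L. length u = n + (2 * R + 1)}"
    let ?win = "\<lambda>x. win x (- int R) (n + (2 * R + 1))"
    have "\<forall>v\<in>?Ws. \<exists>x. x \<in> X \<and> ?win x = v"
    proof
      fix v assume "v \<in> ?Ws"
      then have v: "v \<in> L" "length v = n + (2 * R + 1)" by simp_all
      obtain x where "x \<in> X" "win x (- int R) (length v) = v" using L_obtain[OF v(1)] .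
      then show "\<exists>x. x \<in> X \<and> ?win x = v" unfolding v(2) by blast
    qed
    from bchoice[OF this] obtain p where "\<forall>v\<in>?Ws. p v \<in> X \<and> ?win (p v) = v" by (elim exE)
    then have p: "\<And>v. v \<in> ?Ws \<Longrightarrow> p v \<in> X" "\<And>v. v \<in> ?Ws \<Longrightarrow> ?win (p v) = v" by blast+
    define V where "V v = {x \<in> topspace space_top. \<forall>i<n. (shift ^^ i) x \<in> c (sh (int i) (p v))}" for v
    have Vj: "V v \<in> cover_join space_top shift \<U> n" if "v \<in> ?Ws" for v
      unfolding cover_join_def V_def using c(1) p(1)[OF that]
      by (intro CollectI exI[of _ "\<lambda>i. c (sh (int i) (p v))"]) auto
    have xV: "x \<in> V (?win x)" if x: "x \<in> X" for x
    proof -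
      have v: "?win x \<in> ?Ws" using win_in_L[OF x] by simp
      have "sh (int i) x \<in> c (sh (int i) (p (?win x)))" if i: "i < n" for i
      proof (rule c(2))
        show "agree R (sh (int i) (p (?win x))) (sh (int i) x)"
          unfolding agree_def sh_apply
        proof safe
          fix k :: int assume "\<bar>k\<bar> \<le> int R"
          then show "p (?win x) (k + int i) = x (k + int i)"
            by (intro win_eqD[OF p(2)[OF v]]) (use i in auto)
        qed
      qed (use x p(1)[OF v] in auto)
      then show ?thesis using x by (simp add: V_def shift_funpow)
    qed
    have "X \<subseteq> \<Union>(V ` ?Ws)"
    proof
      fix x assume x: "x \<in> X"
      have "?win x \<in> ?Ws" using win_in_L[OF x] by simp
      then show "x \<in> \<Union>(V ` ?Ws)" using xV[OF x] by (rule UN_I)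
    qed
    moreover have "V v \<subseteq> X" for v by (auto simp: V_def)
    ultimately have "\<Union>(V ` ?Ws) = X" by blast
    moreover have "card (V ` ?Ws) \<le> complexity (n + (2 * R + 1))"
      unfolding complexity_def by (rule card_image_le[OF finite_words])
    ultimately show ?thesis using finite_words Vj by (intro exI[of _ "V ` ?Ws"]) blast
  qed
  then show ?thesis by blast
qed

text \<open>The additional length \<open>r\<close> of the words disappears in the limit, since
  \<open>(n + r) / n\<close> tends to 1.\<close>

lemma cover_entropy_le:
  assumes "open_cover_of space_top \<U>"
  shows "cover_entropy space_top shift \<U> \<le> ereal growth_rate"
proof -
  obtain r where r: "\<And>n. \<exists>\<V>\<subseteq>cover_join space_top shift \<U> n. finite \<V> \<and> card \<V> \<le> complexity (n + r) \<and> \<Union>\<V> = X"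
    using subcover_bound[OF assms] by blast
  define k where "k n = min_subcover_card space_top (cover_join space_top shift \<U> n)" for n
  have k: "k n \<le> complexity (n + r)" for n
  proof -
    obtain \<V> where \<V>: "\<V> \<subseteq> cover_join space_top shift \<U> n" "finite \<V>" "card \<V> \<le> complexity (n + r)" "\<Union>\<V> = X"
      using r by blast
    then have "k n \<le> card \<V>"
      unfolding k_def min_subcover_card_def by (intro Least_le) auto
    then show ?thesis using \<V> by simp
  qed
  have le: "ln (real (k n)) \<le> ln (real (complexity (n + r)))" for n
  proof (cases "k n = 0")
    \<comment> \<open>Here \<open>ln 0 = 0\<close> by convention, and the right-hand side is
      nonnegative.\<close>
    case True
    then show ?thesis using complexity_pos[of "n + r"] by simp
  next
    case False
    then show ?thesis using k[of n] by simp
  qed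
  have "(\<lambda>n. ln (real (complexity (n + r))) / real (n + r) * (real (n + r) / real n)) \<longlonglongrightarrow> growth_rate * 1"
  proof (rule tendsto_mult)
    show "(\<lambda>n. ln (real (complexity (n + r))) / real (n + r)) \<longlonglongrightarrow> growth_rate"
      using growth_rate by (rule LIMSEQ_ignore_initial_segment)
    have "(\<lambda>n. 1 + real r * (1 / real n)) \<longlonglongrightarrow> 1 + real r * 0"
      by (intro tendsto_intros lim_1_over_n)
    moreover have "eventually (\<lambda>n. 1 + real r * (1 / real n) = real (n + r) / real n) sequentially"
      using eventually_gt_at_top[of 0] by eventually_elim (simp add: field_simps)
    ultimately show "(\<lambda>n. real (n + r) / real n) \<longlonglongrightarrow> 1"
      by (simp add: tendsto_cong)
  qed
  moreover have "eventually (\<lambda>n. ln (real (complexity (n + r))) / real (n + r) * (real (n + r) / real n) = ln (real (complexity (n + r))) / real n) sequentially"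
    using eventually_gt_at_top[of 0] by eventually_elim simp
  ultimately have "(\<lambda>n. ln (real (complexity (n + r))) / real n) \<longlonglongrightarrow> growth_rate * 1"
    by (rule Lim_transform_eventually)
  then have "(\<lambda>n. ln (real (complexity (n + r))) / real n) \<longlonglongrightarrow> growth_rate" by simp
  then have lim: "limsup (\<lambda>n. ereal (ln (real (complexity (n + r))) / real n)) = ereal growth_rate"
    by (intro lim_imp_Limsup) auto
  have "cover_entropy space_top shift \<U> \<le> limsup (\<lambda>n. ereal (ln (real (complexity (n + r))) / real n))"
    unfolding cover_entropy_def k_def[symmetric]
    by (rule Limsup_mono) (use le in \<open>auto intro!: always_eventually divide_right_mono\<close>)
  then show ?thesis by (simp add: lim)
qed

text \<open>The partition by the letter at the origin attains the rate: points realizing different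
  words of length \<open>n\<close> lie in different members of the join, so a subcover has at least
  \<open>complexity n\<close> members.\<close>

lemma cover_entropy_ge: "\<exists>\<U>. open_cover_of space_top \<U> \<and> ereal growth_rate \<le> cover_entropy space_top shift \<U>"
proof -
  define \<U> where "\<U> = (\<lambda>s. {x \<in> X. x 0 = s}) ` A"
  have cov: "open_cover_of space_top \<U>"
    unfolding open_cover_of_def
  proof (intro conjI ballI)
    fix U assume "U \<in> \<U>"
    then obtain s where "U = {x \<in> X. x 0 = s}" by (auto simp: \<U>_def)
    then show "openin space_top U" unfolding openin_top by (auto intro!: exI[of _ 0] simp: agree_def)
  next
    show "\<Union>\<U> = topspace space_top" using in_A by (auto simp: \<U>_def)
  qed
  \<comment> \<open>Taken from here is the existence of a finite subcover, which ensures that the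
    least cardinality is attained.\<close>
  obtain r where r: "\<And>n. \<exists>\<V>\<subseteq>cover_join space_top shift \<U> n. finite \<V> \<and> card \<V> \<le> complexity (n + r) \<and> \<Union>\<V> = X"
    using subcover_bound[OF cov] by blast
  have ge: "complexity n \<le> min_subcover_card space_top (cover_join space_top shift \<U> n)" for n
  proof -
    let ?P = "\<lambda>k. \<exists>\<V>\<subseteq>cover_join space_top shift \<U> n. finite \<V> \<and> card \<V> = k \<and> \<Union>\<V> = topspace space_top"
    have "\<exists>k. ?P k" using r[of n] by auto
    then have "?P (min_subcover_card space_top (cover_join space_top shift \<U> n))"
      unfolding min_subcover_card_def by (rule LeastI_ex)
    then obtain \<V> where \<V>: "\<V> \<subseteq> cover_join space_top shift \<U> n" "finite \<V>" "\<Union>\<V> = X"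
      "card \<V> = min_subcover_card space_top (cover_join space_top shift \<U> n)" by auto
    let ?Ws = "{u \<in> L. length u = n}"
    have "\<forall>u\<in>?Ws. \<exists>x. x \<in> X \<and> win x 0 n = u"
    proof
      fix u assume "u \<in> ?Ws"
      then have u: "u \<in> L" "length u = n" by simp_all
      obtain x where "x \<in> X" "win x 0 (length u) = u" using L_obtain[OF u(1)] .
      then show "\<exists>x. x \<in> X \<and> win x 0 n = u" unfolding u(2) by blast
    qed
    from bchoice[OF this] obtain p where "\<forall>u\<in>?Ws. p u \<in> X \<and> win (p u) 0 n = u" by (elim exE)
    then have p: "\<And>u. u \<in> L \<Longrightarrow> length u = n \<Longrightarrow> p u \<in> X \<and> win (p u) 0 n = u" by blast
    have "\<exists>V. V \<in> \<V> \<and> p u \<in> V" if "u \<in> L" "length u = n" for u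
      using p[OF that] \<V>(3) by blast
    then obtain V where V: "\<And>u. u \<in> L \<Longrightarrow> length u = n \<Longrightarrow> V u \<in> \<V> \<and> p u \<in> V u" by metis
    have "inj_on V {u \<in> L. length u = n}"
    proof (rule inj_onI)
      fix u v assume "u \<in> {u \<in> L. length u = n}" "v \<in> {u \<in> L. length u = n}" and eq: "V u = V v"
      then have u: "u \<in> L" "length u = n" and v: "v \<in> L" "length v = n" by auto
      obtain C where C: "V u = {x \<in> topspace space_top. \<forall>i<n. (shift ^^ i) x \<in> C i}" "\<And>i. i < n \<Longrightarrow> C i \<in> \<U>"
        using V[OF u] \<V>(1) unfolding cover_join_def by blast
      have "p u (int i) = p v (int i)" if i: "i < n" for i
      proof -
        obtain s where s: "C i = {x \<in> X. x 0 = s}" using C(2)[OF i] by (auto simp: \<U>_def)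
        have "sh (int i) (p u) \<in> C i" "sh (int i) (p v) \<in> C i"
          using V[OF u] V[OF v] eq C(1) i by (auto simp: shift_funpow)
        then show ?thesis by (simp add: s sh_apply)
      qed
      then have "win (p u) 0 n = win (p v) 0 n" by (simp add: win_eq_iff)
      then show "u = v" using p[OF u] p[OF v] by simp
    qed
    then have "card {u \<in> L. length u = n} \<le> card \<V>"
      by (rule card_inj_on_le) (use V \<V> in auto)
    then show ?thesis using \<V> by (simp add: complexity_def)
  qed
  have "limsup (\<lambda>n. ereal (ln (real (complexity n)) / real n)) = ereal growth_rate"
    using growth_rate by (intro lim_imp_Limsup) auto
  moreover have "limsup (\<lambda>n. ereal (ln (real (complexity n)) / real n)) \<le> cover_entropy space_top shift \<U>"
    unfolding cover_entropy_def
  proof (intro Limsup_mono always_eventually allI)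
    fix n
    have "ln (real (complexity n)) \<le> ln (real (min_subcover_card space_top (cover_join space_top shift \<U> n)))"
      using ge[of n] complexity_pos[of n] by simp
    then show "ereal (ln (real (complexity n)) / real n) \<le>
        ereal (ln (real (min_subcover_card space_top (cover_join space_top shift \<U> n))) / real n)"
      by (simp add: divide_right_mono)
  qed
  ultimately show ?thesis using cov by auto
qed

lemma topological_entropy_eq: "topological_entropy space_top shift = ereal growth_rate"
  unfolding topological_entropy_def
proof (rule antisym)
  show "(SUP \<U>\<in>{\<U>. open_cover_of space_top \<U>}. cover_entropy space_top shift \<U>) \<le> ereal growth_rate"
    by (rule SUP_least) (simp add: cover_entropy_le)
  show "ereal growth_rate \<le> (SUP \<U>\<in>{\<U>. open_cover_of space_top \<U>}. cover_entropy space_top shift \<U>)"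
    using cover_entropy_ge by (auto intro: SUP_upper2)
qed

end

section \<open>Comparison of the entropies\<close>

text \<open>If two of the first \<open>2^a\<close> iterates agreed, the greatest common divisor with
  \<open>2^a\<close> would be a period that is a smaller power of two. It would divide
  \<open>2^(a - 1)\<close>, against \<open>ne\<close>.\<close>

lemma orbit_card:
  assumes S: "finite S" "\<And>y. y \<in> S \<Longrightarrow> f y \<in> S" "y \<in> S"
    and per: "(f ^^ (2 ^ a)) y = y" and ne: "(f ^^ (2 ^ (a - 1))) y \<noteq> y" and a: "a \<ge> 1"
  shows "2 ^ a \<le> card S"
proof -
  let ?n = "2 ^ a :: nat"
  have mult: "(f ^^ (k * e)) y = y" if "(f ^^ e) y = y" for k e
    by (induction k) (auto simp: funpow_add that)
  have inj: "inj_on (\<lambda>i. (f ^^ i) y) {..<?n}"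
  proof (rule linorder_inj_onI)
    fix i k assume ik: "i < k" "i \<in> {..<?n}" "k \<in> {..<?n}"
    show "(f ^^ i) y \<noteq> (f ^^ k) y"
    proof
      assume eq: "(f ^^ i) y = (f ^^ k) y"
      define d where "d = k - i"
      have d: "d > 0" "d < ?n" using ik by (auto simp: d_def)
      have "(f ^^ (?n - i)) ((f ^^ i) y) = y" using ik per by (simp add: funpow_add[symmetric, THEN fun_cong, unfolded comp_def])
      moreover have "(f ^^ (?n - i)) ((f ^^ k) y) = (f ^^ (?n - i + k)) y" by (simp add: funpow_add)
      moreover have "?n - i + k = d + ?n" using ik by (auto simp: d_def)
      ultimately have fd: "(f ^^ d) y = y" using eq per by (simp add: funpow_add)
      obtain u v where uv: "d * u = ?n * v + gcd d ?n" using bezout_nat[of d ?n] d by auto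
      have "(f ^^ (u * d)) y = y" by (rule mult[OF fd])
      moreover have "u * d = gcd d ?n + v * ?n" using uv by (simp add: algebra_simps)
      moreover have "(f ^^ (v * ?n)) y = y" by (rule mult[OF per])
      ultimately have g: "(f ^^ gcd d ?n) y = y" by (simp add: funpow_add)
      obtain b where b: "b \<le> a" "gcd d ?n = 2 ^ b"
        using divides_primepow_nat[of 2 "gcd d ?n" a] by auto
      have "gcd d ?n \<le> d" using d by (intro gcd_le1_nat) simp
      then have "(2::nat) ^ b < 2 ^ a" using b(2) d(2) by linarith
      then have "b < a" by simp
      then have "(2::nat) ^ (a - 1) = 2 ^ (a - 1 - b) * 2 ^ b" by (simp add: power_add[symmetric])
      then have "(f ^^ (2 ^ (a - 1))) y = y" using mult[of "2 ^ b" "2 ^ (a - 1 - b)"] g b by simp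
      then show False using ne by simp
    qed
  qed auto
  have "(f ^^ i) y \<in> S" for i by (induction i) (auto simp: S)
  then have "card {..<?n} \<le> card S" by (intro card_inj_on_le[OF inj _ S(1)]) auto
  then show ?thesis by simp
qed

text \<open>Allows word lengths to run through an arithmetic progression with a constant loss.
  Subtraction on the naturals is truncated, which concerns only finitely many
  \<open>t\<close>.\<close>

lemma subsequence_rate:
  fixes f :: "nat \<Rightarrow> real"
  assumes "(\<lambda>n. f n / real n) \<longlonglongrightarrow> h" "\<alpha> > 0"
  shows "(\<lambda>t. f (\<alpha> * t - c) / real t) \<longlonglongrightarrow> real \<alpha> * h"
proof -
  have at_top: "filterlim (\<lambda>t. \<alpha> * t - c) at_top sequentially"
    unfolding filterlim_at_top
  proof
    fix Z
    show "eventually (\<lambda>t. Z \<le> \<alpha> * t - c) sequentially"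
      using eventually_ge_at_top[of "Z + c"]
    proof eventually_elim
      case (elim t)
      have "1 * t \<le> \<alpha> * t" using assms(2) by (intro mult_le_mono1) simp
      then show ?case using elim by linarith
    qed
  qed
  have 1: "(\<lambda>t. f (\<alpha> * t - c) / real (\<alpha> * t - c)) \<longlonglongrightarrow> h"
    using filterlim_compose[OF assms(1) at_top] .
  have ev: "eventually (\<lambda>t. t > 0 \<and> \<alpha> * t > c) sequentially"
    using eventually_gt_at_top[of c]
  proof eventually_elim
    case (elim t)
    have "1 * t \<le> \<alpha> * t" using assms(2) by (intro mult_le_mono1) simp
    then show ?case using elim by linarith
  qed
  have "(\<lambda>t. real \<alpha> - real c * (1 / real t)) \<longlonglongrightarrow> real \<alpha> - real c * 0"
    by (intro tendsto_intros lim_1_over_n)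
  moreover have "eventually (\<lambda>t. real \<alpha> - real c * (1 / real t) = real (\<alpha> * t - c) / real t) sequentially"
    using ev by eventually_elim (simp add: of_nat_diff field_simps)
  ultimately have 2: "(\<lambda>t. real (\<alpha> * t - c) / real t) \<longlonglongrightarrow> real \<alpha>"
    by (simp add: tendsto_cong)
  have "(\<lambda>t. real (\<alpha> * t - c) / real t * (f (\<alpha> * t - c) / real (\<alpha> * t - c))) \<longlonglongrightarrow> real \<alpha> * h"
    by (rule tendsto_mult[OF 2 1])
  moreover have "eventually (\<lambda>t. real (\<alpha> * t - c) / real t * (f (\<alpha> * t - c) / real (\<alpha> * t - c)) = f (\<alpha> * t - c) / real t) sequentially"
    using ev
  proof eventually_elim
    case (elim t)
    then have "0 < \<alpha> * t - c" by simp
    then have "0 < real (\<alpha> * t - c)" by (simp only: of_nat_0_less_iff)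
    moreover have "q / real t * (F / q) = F / real t" if "0 < q" for q F :: real
      using that by simp
    ultimately show ?case by blast
  qed
  ultimately show ?thesis by (rule Lim_transform_eventually)
qed

section \<open>Periodic points and centralizers of powers of the shift\<close>

context subshift_space
begin

definition Per :: "nat \<Rightarrow> (int \<Rightarrow> 'a) set" where
  "Per m = {y \<in> X. sh (int m) y = y}"

lemma sh_mult_fixed:
  assumes "sh p y = y"
  shows "sh (p * k) y = y"
proof (induction k rule: int_induct[where k = 0])
  case (step1 i)
  have "sh (p * (i + 1)) y = sh p (sh (p * i) y)" by (simp add: algebra_simps)
  then show ?case using step1 assms by simp
next
  case (step2 i)
  have "sh p (sh (p * (i - 1)) y) = sh p y" using step2 assms by (simp add: algebra_simps)
  then have "sh (- p) (sh p (sh (p * (i - 1)) y)) = sh (- p) (sh p y)" by simp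
  then show ?case by simp
qed simp

text \<open>A point of period \<open>m\<close> is determined by \<open>m\<close> consecutive
  letters.\<close>

lemma Per_card:
  assumes "m > 0"
  shows "finite (Per m)" "card (Per m) \<le> complexity m"
proof -
  have inj: "inj_on (\<lambda>y. win y 0 m) (Per m)"
  proof (rule inj_onI)
    fix x y assume x: "x \<in> Per m" and y: "y \<in> Per m" and eq: "win x 0 m = win y 0 m"
    have val: "u i = u (i mod int m)" if "u \<in> Per m" for u i
    proof -
      have "sh (int m * (i div int m)) u = u"
        by (rule sh_mult_fixed) (use that in \<open>simp add: Per_def\<close>)
      then have "sh (int m * (i div int m)) u (i mod int m) = u (i mod int m)" by simp
      then show ?thesis by (simp add: sh_apply)
    qed
    show "x = y"
    proof
      fix i
      have "x (i mod int m) = y (i mod int m)"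
        by (rule win_eqD[OF eq]) (use assms in auto)
      then show "x i = y i" using val[OF x] val[OF y] by simp
    qed
  qed
  have sub: "(\<lambda>y. win y 0 m) ` Per m \<subseteq> {u \<in> L. length u = m}"
    using win_in_L by (auto simp: Per_def)
  show "finite (Per m)" by (rule finite_imageD[OF finite_subset[OF sub finite_words] inj])
  show "card (Per m) \<le> complexity m" unfolding complexity_def by (rule card_inj_on_le[OF inj sub finite_words])
qed

lemma AutN_Per: "f \<in> AutN m \<Longrightarrow> y \<in> Per m \<Longrightarrow> f y \<in> Per m"
  using AutN_D(4,5)[of f m y] by (simp add: Per_def)

lemma sh_G: "restrict (sh k) X \<in> carrier G"
  using AutN_G[OF sh_Aut[of k 1]] by simp

text \<open>Describes the automorphism group of a power of the shift as a centralizer in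
  \<open>G\<close>, a form that group isomorphisms transport.\<close>

lemma commutes_sh_iff:
  assumes "f \<in> carrier G"
  shows "f \<otimes>\<^bsub>G\<^esub> restrict (sh k) X = restrict (sh k) X \<otimes>\<^bsub>G\<^esub> f \<longleftrightarrow> f \<in> AutN (nat \<bar>k\<bar>)"
proof -
  interpret group G by (rule group_G)
  obtain n where n: "f \<in> AutN n" using assms by (elim G_AutN)
  have "f \<otimes>\<^bsub>G\<^esub> restrict (sh k) X = restrict (sh k) X \<otimes>\<^bsub>G\<^esub> f \<longleftrightarrow> (\<forall>x\<in>X. f (sh k x) = sh k (f x))"
  proof
    assume eq: "f \<otimes>\<^bsub>G\<^esub> restrict (sh k) X = restrict (sh k) X \<otimes>\<^bsub>G\<^esub> f"
    show "\<forall>x\<in>X. f (sh k x) = sh k (f x)"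
    proof
      fix x assume x: "x \<in> X"
      have "(f \<otimes>\<^bsub>G\<^esub> restrict (sh k) X) x = (restrict (sh k) X \<otimes>\<^bsub>G\<^esub> f) x" using eq by simp
      then show "f (sh k x) = sh k (f x)"
        using x assms sh_G G_X[OF assms x] by (simp add: mult_G_apply)
    qed
  next
    assume eq: "\<forall>x\<in>X. f (sh k x) = sh k (f x)"
    show "f \<otimes>\<^bsub>G\<^esub> restrict (sh k) X = restrict (sh k) X \<otimes>\<^bsub>G\<^esub> f"
      by (rule G_ext) (use assms sh_G eq G_X[OF assms] in \<open>auto simp: mult_G_apply\<close>)
  qed
  also have "\<dots> \<longleftrightarrow> (\<forall>x\<in>X. f (sh \<bar>k\<bar> x) = sh \<bar>k\<bar> (f x))"
  proof (cases "k \<ge> 0")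
    case False
    then have k: "\<bar>k\<bar> = - k" by simp
    have flip: "\<forall>x\<in>X. f (sh (- j) x) = sh (- j) (f x)" if H: "\<forall>x\<in>X. f (sh j x) = sh j (f x)" for j
    proof
      fix x assume "x \<in> X"
      then have "f (sh j (sh (- j) x)) = sh j (f (sh (- j) x))" by (intro H[rule_format]) simp
      then have "sh (- j) (f x) = sh (- j) (sh j (f (sh (- j) x)))" by simp
      then show "f (sh (- j) x) = sh (- j) (f x)" by simp
    qed
    show ?thesis unfolding k using flip[of k] flip[of "- k"] by auto
  qed simp
  also have "\<dots> \<longleftrightarrow> f \<in> AutN (nat \<bar>k\<bar>)" using AutN_iff[OF n, of "nat \<bar>k\<bar>"] by simp
  finally show ?thesis .
qed

lemma pow_sh: "restrict (sh d) X [^]\<^bsub>G\<^esub> (k::nat) = restrict (sh (d * int k)) X"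
proof -
  interpret group G by (rule group_G)
  show ?thesis
  proof (rule G_ext)
    show "restrict (sh d) X [^]\<^bsub>G\<^esub> k \<in> carrier G" using sh_G by simp
    fix x assume x: "x \<in> X"
    have "(restrict (sh d) X ^^ k) x = sh (d * int k) x"
      by (induction k) (use x in \<open>auto simp: algebra_simps\<close>)
    then show "(restrict (sh d) X [^]\<^bsub>G\<^esub> k) x = restrict (sh (d * int k)) X x"
      using x sh_G by (simp add: pow_G_apply)
  qed (rule sh_G)
qed

end

context mixing_sofic
begin

text \<open>A loop containing the given window is repeated periodically, and the result is shifted
  so that the window lies at the origin.\<close>

lemma periodic_dense:
  assumes "x \<in> X"
  shows "\<exists>m>0. \<exists>y\<in>Per m. agree r y x"
proof -
  define u where "u = win x (- int r) (2 * r + 1)"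
  have uL: "u \<in> L" unfolding u_def by (rule win_in_L[OF assms])
  obtain a where a: "length a = M" "w @ a @ u \<in> L" using mix[OF w_L uL, of M] by auto
  obtain b where b: "length b = M" "(w @ a @ u) @ b @ w \<in> L" using mix[OF a(2) w_L, of M] by auto
  define v where "v = w @ a @ u @ b"
  define n where "n = length v"
  have n: "n > 0" using w_ne by (simp add: n_def v_def)
  have loop: "loop v" using b by (simp add: loop_def v_def starts_def)
  define y where "y = pt n (\<lambda>_. v)"
  have By: "blk n y j = v" for j unfolding y_def by (rule blk_pt[OF n]) (simp add: n_def)
  have lamw: "loop (win y (int n * j) (n * Suc m))" for j m
  proof (induction m)
    case 0
    then show ?case using loop By[of j] by (simp add: blk_def)
  next
    case (Suc m)
    have "win y (int n * j) (n * Suc m + n) = win y (int n * j) (n * Suc m) @ blk n y (j + int (Suc m))"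
      unfolding win_add by (simp add: blk_def algebra_simps)
    moreover have "n * Suc m + n = n * Suc (Suc m)" by simp
    ultimately show ?case using loop_append[OF Suc loop] By by metis
  qed
  have yX: "y \<in> X"
  proof (rule in_X_if_win)
    fix s
    define q where "q = int n * int (Suc s)"
    have "1 * int (Suc s) \<le> q" unfolding q_def using n by (intro mult_right_mono) auto
    then have q: "int s + 1 \<le> q" by simp
    have "int (n * Suc (2 * s + 1)) = 2 * q" by (simp add: q_def algebra_simps)
    moreover have "int n * (- int (Suc s)) = - q" by (simp add: q_def algebra_simps)
    ultimately show "win y (- int s) (2 * s + 1) \<in> L"
      using loop_L[OF lamw[of "- int (Suc s)" "2 * s + 1"]] q by (elim win_sub) auto
  qed
  have per: "sh (int n) y = y"
    using blk_sh[of n 1 y] by (intro blk_eqI[OF n]) (simp add: By)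
  define k where "k = length w + M + r"
  have "agree r (sh (int k) y) x"
    unfolding agree_def sh_apply
  proof safe
    fix i :: int assume i: "\<bar>i\<bar> \<le> int r"
    define p where "p = nat (i + int r)"
    have p: "p < 2 * r + 1" "int p = i + int r" using i by (auto simp: p_def)
    have q: "i + int k = int (length (w @ a) + p)" using a p by (simp add: k_def)
    have lt: "length (w @ a) + p < n" using p by (simp add: n_def v_def u_def)
    have "y (int (length (w @ a) + p)) = blk n y 0 ! (length (w @ a) + p)"
      using lt by (simp add: blk_def)
    also have "\<dots> = (u @ b) ! p" unfolding By v_def by (metis append.assoc nth_append_length_plus)
    also have "\<dots> = u ! p" using p by (simp add: nth_append u_def)
    also have "\<dots> = x i" using p by (simp add: u_def)
    finally show "y (i + int k) = x i" unfolding q .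
  qed
  moreover have "sh (int k) y \<in> Per n" using yX per by (simp add: Per_def add.commute[of "int n"]) (metis add.commute sh_sh)
  ultimately show ?thesis using n by blast
qed

text \<open>Two distinct return blocks whose length is a multiple of \<open>p\<close> stand side by
  side in some point, which \<open>p\<close> therefore cannot have as a period.\<close>

lemma sh_not_identity:
  assumes "p > 0"
  shows "\<exists>x\<in>X. sh (int p) x \<noteq> x"
proof (rule ccontr)
  assume H: "\<not> ?thesis"
  obtain n0 where n0: "\<And>n. n \<ge> n0 \<Longrightarrow> \<exists>c0 c1 c2 c3. distinct [c0, c1, c2, c3] \<and> set [c0, c1, c2, c3] \<subseteq> R n"
    using four_in_R by blast
  define n where "n = p * Suc n0"
  have "1 * Suc n0 \<le> p * Suc n0" using assms by (intro mult_le_mono1) simp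
  then have "n \<ge> n0" by (simp add: n_def)
  then obtain c d where cd: "c \<in> R n" "d \<in> R n" "c \<noteq> d" using n0[of n] by auto
  have "c @ d \<in> L" using R_append[OF cd(1,2)] by (rule R_L)
  then obtain x where x: "x \<in> X" "win x 0 (n + n) = c @ d"
    using L_obtain[of "c @ d" 0] cd R_length by auto
  then have e: "win x 0 n = c" "win x (int n) n = d"
    using cd R_length unfolding win_add by (auto simp: append_eq_append_conv)
  have "sh (int p) x = x" using H x by blast
  then have "sh (int p * int (Suc n0)) x = x" by (rule sh_mult_fixed)
  moreover have "int p * int (Suc n0) = int n" by (simp add: n_def algebra_simps)
  ultimately have "win (sh (int n) x) 0 n = win x 0 n" by metis
  then show False using e cd by (simp add: win_sh)
qed

end

text \<open>Along a progression of lengths, words of \<open>X\<close> are counted by the order of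
  \<open>\<tau>\<close>, and this order is bounded by the number of periodic points of
  \<open>Y\<close>, hence by words of \<open>Y\<close>. The reverse inequality comes from the
  inverse isomorphism.\<close>

lemma entropy_le:
  assumes "mixing_sofic A X w M" "mixing_sofic B Y v N"
    and \<Psi>: "\<Psi> \<in> iso (stabilized_Aut (shift_topology A X) shift) (stabilized_Aut (shift_topology B Y) shift)"
    and n: "n > 0" and m: "m > 0"
    and corr: "\<And>k f. k > 0 \<Longrightarrow> f \<in> carrier (stabilized_Aut (shift_topology A X) shift) \<Longrightarrow>
      f \<in> Aut (shift_topology A X) (shift ^^ (n * k)) \<longleftrightarrow> \<Psi> f \<in> Aut (shift_topology B Y) (shift ^^ (m * k))"
  shows "real n * subshift_space.growth_rate X \<le> real m * subshift_space.growth_rate Y"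
proof -
  interpret X: mixing_sofic A X w M by fact
  interpret Y: mixing_sofic B Y v N by fact
  interpret GX: group X.G by (rule X.group_G)
  interpret GY: group Y.G by (rule Y.group_G)
  interpret \<Psi>: group_hom X.G Y.G \<Psi>
    by unfold_locales (use \<Psi> in \<open>simp add: iso_def\<close>)
  have inj: "inj_on \<Psi> (carrier X.G)" using \<Psi> by (simp add: iso_def bij_betw_def)
  have s: "subshift_space B Y" by unfold_locales
  obtain N1 \<kappa> c where N1: "N1 > 0" "n dvd N1" and \<kappa>: "\<kappa> \<in> X.AutN N1" "\<exists>x\<in>X. \<kappa> x \<noteq> x"
    and cyc: "\<And>j a. j > 0 \<Longrightarrow> a \<ge> 2 \<Longrightarrow> c \<le> N1 * j \<Longrightarrow> 2 ^ a \<le> card {u \<in> X.L. length u = N1 * j - c} \<Longrightarrow>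
      (\<exists>\<tau>\<in>X.AutN (N1 * j). (\<forall>x\<in>X. (\<tau> ^^ (2 ^ a)) x = x) \<and>
        (\<forall>K. X.normal_in (N1 * j) K \<longrightarrow> restrict (\<tau> ^^ (2 ^ (a - 1))) X \<in> K \<longrightarrow> \<kappa> \<in> K))"
    using X.large_cyclic_subgroup[OF n] by (elim exE conjE) (rule that, assumption+, blast)
  obtain k1 where k1: "N1 = n * k1" using N1(2) by blast
  have k1p: "k1 > 0" using N1(1) k1 by simp
  have \<kappa>G: "\<kappa> \<in> carrier X.G" using X.AutN_G \<kappa>(1) N1(1) by blast
  have \<Psi>\<kappa>: "\<Psi> \<kappa> \<in> carrier Y.G" using \<kappa>G by simp
  have "\<exists>y\<in>Y. \<Psi> \<kappa> y \<noteq> y"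
  proof (rule ccontr)
    assume "\<not> ?thesis"
    then have "\<Psi> \<kappa> = \<one>\<^bsub>Y.G\<^esub>"
      by (intro Y.G_ext \<Psi>\<kappa> GY.one_closed) (simp add: Y.one_G)
    then have "\<kappa> = \<one>\<^bsub>X.G\<^esub>" using inj \<kappa>G by (metis GX.one_closed \<Psi>.hom_one inj_onD)
    then show False using \<kappa>(2) by (auto simp: X.one_G)
  qed
  then obtain y1 where "y1 \<in> Y" "\<Psi> \<kappa> y1 \<noteq> y1" by blast
  then obtain i where y1: "y1 \<in> Y" "\<Psi> \<kappa> y1 i \<noteq> y1 i" by (metis ext)
  obtain q where "\<Psi> \<kappa> \<in> Y.AutN q" using \<Psi>\<kappa> by (elim Y.G_AutN)
  then obtain S0 where S0: "\<And>x y. x \<in> Y \<Longrightarrow> y \<in> Y \<Longrightarrow> agree S0 x y \<Longrightarrow> \<Psi> \<kappa> x i = \<Psi> \<kappa> y i"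
    using continuous_imp_local[OF s s Y.AutN_D(6)] by meson
  \<comment> \<open>Locality and density replace the moved point by a periodic one; the radius
    includes the coordinate \<open>i\<close> at which the motion is visible.\<close>
  obtain m0 y0 where m0: "m0 > 0" and y0: "y0 \<in> Y.Per m0" "agree (max S0 (nat \<bar>i\<bar>)) y0 y1"
    using Y.periodic_dense[OF y1(1)] by blast
  have y0Y: "y0 \<in> Y" using y0 by (simp add: Y.Per_def)
  have "y0 i = y1 i" using y0(2) by (simp add: agree_def)
  moreover have "\<Psi> \<kappa> y0 i = \<Psi> \<kappa> y1 i" by (rule S0[OF y0Y y1(1) agree_mono[OF y0(2)]]) simp
  ultimately have y0m: "\<Psi> \<kappa> y0 \<noteq> y0" using y1(2) by metis
  \<comment> \<open>The factor \<open>k1\<close> makes \<open>\<alpha>\<close> a multiple of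
    \<open>N1\<close>, and \<open>m0\<close> makes \<open>y0\<close> a point of period
    \<open>\<beta> * t\<close> for every \<open>t\<close>.\<close>
  define \<alpha> \<beta> where "\<alpha> = n * (k1 * m0)" and "\<beta> = m * (k1 * m0)"
  have pos: "\<alpha> > 0" "\<beta> > 0" using n m k1p m0 by (auto simp: \<alpha>_def \<beta>_def)
  \<comment> \<open>The factor 4 covers the case of fewer than four words, where no
    \<open>a \<ge> 2\<close> is available; otherwise rounding down to a power of two loses less than
    a factor 2.\<close>
  have bound: "X.complexity (\<alpha> * t - c) \<le> 4 * Y.complexity (\<beta> * t)" if t: "t > 0" "c \<le> \<alpha> * t" for t
  proof (cases "X.complexity (\<alpha> * t - c) < 4")
    case True
    then show ?thesis using Y.complexity_pos[of "\<beta> * t"] by linarith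
  next
    case False
    define P where "P = X.complexity (\<alpha> * t - c)"
    obtain a where a: "2 ^ a \<le> P" "P < 2 ^ (a + 1)"
      using ex_power_ivl1[of 2 P] False by (auto simp: P_def)
    have a2: "a \<ge> 2"
    proof (rule ccontr)
      assume "\<not> a \<ge> 2"
      then have "a + 1 \<le> 2" by simp
      then have "(2::nat) ^ (a + 1) \<le> 2 ^ 2" by (intro power_increasing) auto
      then show False using a False by (simp add: P_def)
    qed
    define j where "j = m0 * t"
    have Nj: "N1 * j = \<alpha> * t" by (simp add: k1 \<alpha>_def j_def)
    have jk: "j > 0" "k1 * j > 0" using m0 t k1p by (auto simp: j_def)
    obtain \<tau> where \<tau>: "\<tau> \<in> X.AutN (\<alpha> * t)" "\<And>x. x \<in> X \<Longrightarrow> (\<tau> ^^ (2 ^ a)) x = x"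
      and \<tau>K: "\<And>K. X.normal_in (\<alpha> * t) K \<Longrightarrow> restrict (\<tau> ^^ (2 ^ (a - 1))) X \<in> K \<Longrightarrow> \<kappa> \<in> K"
    proof -
      have "c \<le> N1 * j" "2 ^ a \<le> card {u \<in> X.L. length u = N1 * j - c}"
        using a(1) t(2) by (simp_all add: Nj P_def X.complexity_def)
      from cyc[OF jk(1) a2 this] show thesis unfolding Nj
        by (elim bexE conjE) (rule that, assumption, simp, simp)
    qed
    have corr': "f \<in> X.AutN (\<alpha> * t) \<longleftrightarrow> \<Psi> f \<in> Y.AutN (\<beta> * t)" if "f \<in> carrier X.G" for f
      using corr[OF jk(2) that] by (simp add: \<alpha>_def \<beta>_def j_def mult.assoc)
    have AG: "f \<in> X.AutN (\<alpha> * t) \<Longrightarrow> f \<in> carrier X.G" for f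
      using X.AutN_G pos t by simp
    define S where "S = Y.Per (\<beta> * t)"
    \<comment> \<open>The kernel of the action, through \<open>\<Psi>\<close>, on the points of
      period \<open>\<beta> * t\<close> of \<open>Y\<close>; by \<open>corr'\<close> this finite set
      is invariant.\<close>
    define K where "K = {f \<in> X.AutN (\<alpha> * t). \<forall>y\<in>S. \<Psi> f y = y}"
    have SY: "y \<in> S \<Longrightarrow> y \<in> Y" for y by (simp add: S_def Y.Per_def)
    have KG: "f \<in> K \<Longrightarrow> f \<in> carrier X.G" for f using AG by (simp add: K_def)
    have app: "\<Psi> (compose X f h) y = \<Psi> f (\<Psi> h y)" if "f \<in> carrier X.G" "h \<in> carrier X.G" "y \<in> Y" for f h y
    proof -
      have "\<Psi> (compose X f h) = \<Psi> f \<otimes>\<^bsub>Y.G\<^esub> \<Psi> h" using that by (simp add: X.mult_G[symmetric])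
      then show ?thesis using that by (simp add: Y.mult_G_apply)
    qed
    have idA: "restrict id X \<in> X.AutN (\<alpha> * t)"
    proof -
      have "restrict (sh 0) X = restrict id X" by auto
      then show ?thesis using X.sh_Aut[of 0 "\<alpha> * t"] by simp
    qed
    have \<Psi>id: "\<Psi> (restrict id X) y = y" if "y \<in> Y" for y
      using \<Psi>.hom_one that by (simp add: X.one_G Y.one_G)
    have norm: "X.normal_in (\<alpha> * t) K"
      unfolding X.normal_in_def
    proof (intro conjI ballI impI)
      show "restrict id X \<in> K" using idA \<Psi>id SY by (simp add: K_def)
    next
      fix f h assume fh: "f \<in> K" "h \<in> K"
      then show "compose X f h \<in> K"
        using X.compose_AutN[of f "\<alpha> * t" h] app[OF KG[OF fh(1)] KG[OF fh(2)]] SY by (simp add: K_def)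
    next
      fix f h h' assume f: "f \<in> K" and h: "h \<in> X.AutN (\<alpha> * t)" "h' \<in> X.AutN (\<alpha> * t)" and inv: "\<forall>x\<in>X. h (h' x) = x"
      have hG: "h \<in> carrier X.G" "h' \<in> carrier X.G" using h AG by auto
      have fA: "f \<in> X.AutN (\<alpha> * t)" using f by (simp add: K_def)
      have fh': "compose X f h' \<in> X.AutN (\<alpha> * t)" by (rule X.compose_AutN[OF fA h(2)])
      have "compose X h h' = restrict id X" using inv by (auto simp: compose_def)
      then have hh': "\<Psi> h (\<Psi> h' y) = y" if "y \<in> Y" for y using app[OF hG that] \<Psi>id[OF that] by simp
      have h'S: "\<Psi> h' y \<in> S" if "y \<in> S" for y
        using Y.AutN_Per that corr'[OF hG(2)] h(2) by (simp add: S_def)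
      have "\<Psi> (compose X h (compose X f h')) y = y" if y: "y \<in> S" for y
      proof -
        have "\<Psi> f (\<Psi> h' y) = \<Psi> h' y" using f h'S[OF y] by (simp add: K_def)
        then show ?thesis
          using app[OF hG(1) AG[OF fh'] SY[OF y]] app[OF KG[OF f] hG(2) SY[OF y]] hh'[OF SY[OF y]] by simp
      qed
      then show "compose X h (compose X f h') \<in> K"
        using X.compose_AutN[OF h(1) fh'] by (simp add: K_def)
    qed
    have "y0 \<in> S"
    proof -
      have "sh (int m0 * int (m * k1 * t)) y0 = y0"
        by (rule Y.sh_mult_fixed) (use y0(1) in \<open>simp add: Y.Per_def\<close>)
      moreover have "int m0 * int (m * k1 * t) = int (\<beta> * t)" by (simp add: \<beta>_def)
      ultimately have "sh (int (\<beta> * t)) y0 = y0" by (simp only:)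
      then show ?thesis using y0Y unfolding S_def Y.Per_def by blast
    qed
    \<comment> \<open>Since \<kappa> lies in every normal set containing the half power of
      \<open>\<tau>\<close>, that power cannot be in the kernel either: it moves some point of
      \<open>S\<close>.\<close>
    then have "\<kappa> \<notin> K" using y0m by (auto simp: K_def)
    then have notK: "restrict (\<tau> ^^ (2 ^ (a - 1))) X \<notin> K" using \<tau>K[OF norm] by blast
    have \<tau>G: "\<tau> \<in> carrier X.G" using AG \<tau>(1) .
    define h :: nat where "h = 2 ^ (a - 1)"
    have powA: "\<tau> [^]\<^bsub>X.G\<^esub> (e::nat) \<in> X.AutN (\<alpha> * t)" for e
    proof (induction e)
      case 0
      show ?case unfolding GX.nat_pow_0 X.one_G by (rule idA)
    next
      case (Suc e)
      then show ?case using X.compose_AutN[OF Suc \<tau>(1)] \<tau>G by (simp add: X.mult_G)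
    qed
    have rpow: "restrict (\<tau> ^^ h) X = \<tau> [^]\<^bsub>X.G\<^esub> h"
    proof
      fix x
      show "restrict (\<tau> ^^ h) X x = (\<tau> [^]\<^bsub>X.G\<^esub> h) x"
        using X.pow_G_apply[OF \<tau>G, of x h] X.AutN_D(3)[OF powA[of h]]
        by (cases "x \<in> X") (auto simp: extensional_def)
    qed
    have \<Psi>pow: "\<Psi> (\<tau> [^]\<^bsub>X.G\<^esub> (e::nat)) y = (\<Psi> \<tau> ^^ e) y" if "y \<in> Y" for e y
      using \<Psi>.hom_nat_pow[OF \<tau>G, of e] Y.pow_G_apply[OF \<Psi>.hom_closed[OF \<tau>G] that] by simp
    obtain y where y: "y \<in> S" "\<Psi> (\<tau> [^]\<^bsub>X.G\<^esub> h) y \<noteq> y"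
      using notK powA[of h] unfolding h_def[symmetric] rpow K_def by blast
    have "\<tau> [^]\<^bsub>X.G\<^esub> (2 ^ a :: nat) = \<one>\<^bsub>X.G\<^esub>"
    proof (rule X.G_ext)
      show "(\<tau> [^]\<^bsub>X.G\<^esub> (2 ^ a :: nat)) x = \<one>\<^bsub>X.G\<^esub> x" if "x \<in> X" for x
        unfolding X.pow_G_apply[OF \<tau>G that] \<tau>(2)[OF that] X.one_G using that by simp
    qed (rule GX.nat_pow_closed[OF \<tau>G] GX.one_closed)+
    then have "(\<Psi> \<tau> ^^ (2 ^ a)) y = y"
      using \<Psi>pow[OF SY[OF y(1)], of "2 ^ a"] SY[OF y(1)] by (simp add: Y.one_G)
    moreover have "(\<Psi> \<tau> ^^ (2 ^ (a - 1))) y \<noteq> y"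
      using \<Psi>pow[OF SY[OF y(1)], of h] y(2) by (simp add: h_def)
    moreover have "\<Psi> \<tau> z \<in> S" if "z \<in> S" for z
      using Y.AutN_Per that corr'[OF \<tau>G] \<tau>(1) by (simp add: S_def)
    moreover have bt: "\<beta> * t > 0" using pos t by simp
    ultimately have "2 ^ a \<le> card S"
      using a2 y(1) Y.Per_card(1)[OF bt] unfolding S_def by (intro orbit_card) auto
    also have "\<dots> \<le> Y.complexity (\<beta> * t)" unfolding S_def by (rule Y.Per_card(2)[OF bt])
    finally show ?thesis using a(2) by (simp add: P_def)
  qed
  have limX: "(\<lambda>t. ln (real (X.complexity (\<alpha> * t - c))) / real t) \<longlonglongrightarrow> real \<alpha> * X.growth_rate"
    by (rule subsequence_rate[OF X.growth_rate pos(1)])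
  have "(\<lambda>t. ln (real (Y.complexity (\<beta> * t - 0))) / real t) \<longlonglongrightarrow> real \<beta> * Y.growth_rate"
    by (rule subsequence_rate[OF Y.growth_rate pos(2)])
  then have "(\<lambda>t. ln 4 * (1 / real t) + ln (real (Y.complexity (\<beta> * t - 0))) / real t) \<longlonglongrightarrow> ln 4 * 0 + real \<beta> * Y.growth_rate"
    by (intro tendsto_intros lim_1_over_n)
  then have limY: "(\<lambda>t. ln 4 * (1 / real t) + ln (real (Y.complexity (\<beta> * t))) / real t) \<longlonglongrightarrow> real \<beta> * Y.growth_rate"
    by simp
  have "eventually (\<lambda>t. ln (real (X.complexity (\<alpha> * t - c))) / real t \<le> ln 4 * (1 / real t) + ln (real (Y.complexity (\<beta> * t))) / real t) sequentially"
    using eventually_gt_at_top[of c]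
  proof eventually_elim
    case (elim t)
    have "1 * t \<le> \<alpha> * t" using pos by (intro mult_le_mono1) simp
    then have "c \<le> \<alpha> * t" "t > 0" using elim by linarith+
    then have "X.complexity (\<alpha> * t - c) \<le> 4 * Y.complexity (\<beta> * t)" using bound by blast
    then have "real (X.complexity (\<alpha> * t - c)) \<le> real (4 * Y.complexity (\<beta> * t))" by (simp only: of_nat_le_iff)
    then have "ln (real (X.complexity (\<alpha> * t - c))) \<le> ln (4 * real (Y.complexity (\<beta> * t)))"
      using X.complexity_pos[of "\<alpha> * t - c"] by simp
    also have "\<dots> = ln 4 + ln (real (Y.complexity (\<beta> * t)))"
      using Y.complexity_pos[of "\<beta> * t"] by (simp add: ln_mult)
    finally have "ln (real (X.complexity (\<alpha> * t - c))) / real t \<le> (ln 4 + ln (real (Y.complexity (\<beta> * t)))) / real t"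
      by (intro divide_right_mono) auto
    then show ?case by (simp add: add_divide_distrib)
  qed
  then have "real \<alpha> * X.growth_rate \<le> real \<beta> * Y.growth_rate"
    by (intro tendsto_le[OF _ limY limX]) auto
  then have "real (k1 * m0) * (real n * X.growth_rate) \<le> real (k1 * m0) * (real m * Y.growth_rate)"
    by (simp add: \<alpha>_def \<beta>_def algebra_simps)
  then show ?thesis using k1p m0 by (simp add: mult_le_cancel_left_pos)
qed

section \<open>Matching powers of the two shifts and comparing their entropies\<close>

theorem theorem5:
  fixes A :: "'a set" and X :: "(int \<Rightarrow> 'a) set"
    and B :: "'b set" and Y :: "(int \<Rightarrow> 'b) set"
    and \<Psi> :: "((int \<Rightarrow> 'a) \<Rightarrow> (int \<Rightarrow> 'a)) \<Rightarrow> ((int \<Rightarrow> 'b) \<Rightarrow> (int \<Rightarrow> 'b))"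
  assumes "sofic_shift A X" and "mixing X" and "\<not> trivial_shift X"
    and "sofic_shift B Y" and "mixing Y" and "\<not> trivial_shift Y"
    and "\<Psi> \<in> iso (stabilized_Aut (shift_topology A X) shift)
                  (stabilized_Aut (shift_topology B Y) shift)"
  shows "topological_entropy (shift_topology A X) shift /
         topological_entropy (shift_topology B Y) shift \<in> ereal ` \<rat>"
proof -
  obtain w M where "mixing_sofic A X w M" using mixing_sofic_exists[OF assms(1-3)] by blast
  then interpret X: mixing_sofic A X w M .
  obtain v N where "mixing_sofic B Y v N" using mixing_sofic_exists[OF assms(4-6)] by blast
  then interpret Y: mixing_sofic B Y v N .
  interpret GX: group X.G by (rule X.group_G)
  interpret GY: group Y.G by (rule Y.group_G)
  interpret \<Psi>: group_hom X.G Y.G \<Psi>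
    by unfold_locales (use assms(7) in \<open>simp add: iso_def\<close>)
  have inj: "inj_on \<Psi> (carrier X.G)" and surj: "\<Psi> ` carrier X.G = carrier Y.G"
    using assms(7) by (auto simp: iso_def bij_betw_def)
  define \<Phi> where "\<Phi> = inv_into (carrier X.G) \<Psi>"
  have \<Phi>: "\<Phi> \<in> iso Y.G X.G" unfolding \<Phi>_def by (rule GX.iso_set_sym[OF assms(7)])
  have \<Phi>G: "\<Phi> g \<in> carrier X.G" "\<Psi> (\<Phi> g) = g" if "g \<in> carrier Y.G" for g
    using that surj by (auto simp: \<Phi>_def inv_into_into f_inv_into_f)
  obtain Fs where Fs: "finite Fs" "Fs \<subseteq> carrier Y.G"
    and ryan: "\<And>f. f \<in> carrier Y.G \<Longrightarrow> (\<And>\<phi>. \<phi> \<in> Fs \<Longrightarrow> f \<otimes>\<^bsub>Y.G\<^esub> \<phi> = \<phi> \<otimes>\<^bsub>Y.G\<^esub> f) \<Longrightarrow> \<exists>d. \<forall>y\<in>Y. f (f (f y)) = sh d y"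
    using Y.finite_set_with_small_centralizer by metis
  have "\<exists>k>0. \<Phi> \<phi> \<in> X.AutN k" if \<phi>: "\<phi> \<in> Fs" for \<phi>
  proof -
    have "\<Phi> \<phi> \<in> carrier X.G" using Fs(2) \<phi> by (intro \<Phi>G(1)) blast
    then show ?thesis by (rule X.G_AutN) blast
  qed
  then obtain per where per: "\<And>\<phi>. \<phi> \<in> Fs \<Longrightarrow> per \<phi> > 0 \<and> \<Phi> \<phi> \<in> X.AutN (per \<phi>)" by metis
  \<comment> \<open>A common multiple of the periods of the preimages of \<open>Fs\<close>:
    \<open>T\<close> commutes with all of them, hence \<open>\<Psi> T\<close> with all of
    \<open>Fs\<close>.\<close>
  define n0 where "n0 = prod per Fs"
  have n0: "n0 > 0" unfolding n0_def using per by (intro prod_pos) auto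
  define T where "T = restrict (sh (int n0)) X"
  have TG: "T \<in> carrier X.G" unfolding T_def by (rule X.sh_G)
  have "\<Psi> T \<otimes>\<^bsub>Y.G\<^esub> \<phi> = \<phi> \<otimes>\<^bsub>Y.G\<^esub> \<Psi> T" if \<phi>: "\<phi> \<in> Fs" for \<phi>
  proof -
    have G: "\<Phi> \<phi> \<in> carrier X.G" "\<Psi> (\<Phi> \<phi>) = \<phi>" using \<Phi>G Fs(2) \<phi> by auto
    have "per \<phi> dvd n0" unfolding n0_def using Fs(1) \<phi> by (rule dvd_prodI)
    then have "\<Phi> \<phi> \<in> X.AutN n0" using per[OF \<phi>] X.AutN_dvd by blast
    then have "\<Phi> \<phi> \<otimes>\<^bsub>X.G\<^esub> T = T \<otimes>\<^bsub>X.G\<^esub> \<Phi> \<phi>"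
      using X.commutes_sh_iff[OF G(1), of "int n0"] by (simp add: T_def)
    then show ?thesis using \<Psi>.hom_mult[OF G(1) TG] \<Psi>.hom_mult[OF TG G(1)] G(2) by simp
  qed
  then obtain d where d: "\<And>y. y \<in> Y \<Longrightarrow> \<Psi> T (\<Psi> T (\<Psi> T y)) = sh d y"
    using ryan[OF \<Psi>.hom_closed[OF TG]] by blast
  have T3: "\<Psi> (T [^]\<^bsub>X.G\<^esub> (3::nat)) = restrict (sh d) Y"
  proof (rule Y.G_ext)
    fix y assume y: "y \<in> Y"
    have "\<Psi> (T [^]\<^bsub>X.G\<^esub> (3::nat)) y = (\<Psi> T ^^ 3) y"
      using \<Psi>.hom_nat_pow[OF TG, of 3] Y.pow_G_apply[OF \<Psi>.hom_closed[OF TG] y] by simp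
    then show "\<Psi> (T [^]\<^bsub>X.G\<^esub> (3::nat)) y = restrict (sh d) Y y"
      using d y by (simp add: numeral_3_eq_3)
  qed (use TG Y.sh_G in auto)
  \<comment> \<open>It is the third power of \<open>\<Psi> T\<close> that is a power of the shift,
    so the exponent is tripled.\<close>
  define n where "n = n0 * 3"
  have n: "n > 0" using n0 by (simp add: n_def)
  have powX: "T [^]\<^bsub>X.G\<^esub> (3::nat) = restrict (sh (int n)) X"
    unfolding T_def X.pow_sh by (simp add: n_def)
  have \<Psi>sh: "\<Psi> (restrict (sh (int (n * k))) X) = restrict (sh (d * int k)) Y" for k
  proof -
    have "restrict (sh (int (n * k))) X = restrict (sh (int n)) X [^]\<^bsub>X.G\<^esub> k"
      unfolding X.pow_sh by simp
    then show ?thesis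
      using \<Psi>.hom_nat_pow[OF X.sh_G, of "int n" k] T3 Y.pow_sh by (simp add: powX)
  qed
  \<comment> \<open>Otherwise a positive power of the shift of \<open>X\<close> would lie in the
    kernel of the injective \<open>\<Psi>\<close>.\<close>
  have "d \<noteq> 0"
  proof
    assume "d = 0"
    then have "\<Psi> (restrict (sh (int n)) X) = \<one>\<^bsub>Y.G\<^esub>"
      using \<Psi>sh[of 1] by (auto simp: Y.one_G)
    then have "restrict (sh (int n)) X = \<one>\<^bsub>X.G\<^esub>"
      using inj X.sh_G by (metis GX.one_closed \<Psi>.hom_one inj_onD)
    then have "sh (int n) x = x" if "x \<in> X" for x
      using that by (metis X.one_G id_apply restrict_apply')
    then show False using X.sh_not_identity[OF n] by blast
  qed
  define m where "m = nat \<bar>d\<bar>"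
  have m: "m > 0" using \<open>d \<noteq> 0\<close> by (simp add: m_def)
  \<comment> \<open>Both memberships are centralizer conditions, and \<open>\<Psi>\<close> matches
    the two powers of the shift; the sign of \<open>d\<close> does not affect the
    centralizer.\<close>
  have corr: "f \<in> X.AutN (n * k) \<longleftrightarrow> \<Psi> f \<in> Y.AutN (m * k)" if f: "f \<in> carrier X.G" for k f
  proof -
    let ?s = "restrict (sh (int (n * k))) X"
    have "f \<in> X.AutN (n * k) \<longleftrightarrow> f \<otimes>\<^bsub>X.G\<^esub> ?s = ?s \<otimes>\<^bsub>X.G\<^esub> f"
      using X.commutes_sh_iff[OF f, of "int (n * k)"] by (simp del: of_nat_mult)
    also have "\<dots> \<longleftrightarrow> \<Psi> (f \<otimes>\<^bsub>X.G\<^esub> ?s) = \<Psi> (?s \<otimes>\<^bsub>X.G\<^esub> f)"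
      by (rule inj_on_eq_iff[OF inj, symmetric]) (intro GX.m_closed f X.sh_G)+
    also have "\<dots> \<longleftrightarrow> \<Psi> f \<otimes>\<^bsub>Y.G\<^esub> restrict (sh (d * int k)) Y = restrict (sh (d * int k)) Y \<otimes>\<^bsub>Y.G\<^esub> \<Psi> f"
      using f X.sh_G by (simp add: \<Psi>sh del: of_nat_mult)
    also have "\<dots> \<longleftrightarrow> \<Psi> f \<in> Y.AutN (nat \<bar>d * int k\<bar>)"
      using Y.commutes_sh_iff[OF \<Psi>.hom_closed[OF f]] by simp
    also have "nat \<bar>d * int k\<bar> = m * k" by (simp add: m_def abs_mult nat_mult_distrib)
    finally show ?thesis .
  qed
  have 1: "real n * X.growth_rate \<le> real m * Y.growth_rate"
    by (rule entropy_le[OF X.mixing_sofic_axioms Y.mixing_sofic_axioms assms(7) n m corr])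
  have 2: "real m * Y.growth_rate \<le> real n * X.growth_rate"
  proof (rule entropy_le[OF Y.mixing_sofic_axioms X.mixing_sofic_axioms \<Phi> m n])
    show "f \<in> Y.AutN (m * k) \<longleftrightarrow> \<Phi> f \<in> X.AutN (n * k)" if "f \<in> carrier Y.G" for k f
      using corr[OF \<Phi>G(1)[OF that]] \<Phi>G(2)[OF that] by simp
  qed
  have eq: "real n * X.growth_rate = real m * Y.growth_rate" using 1 2 by simp
  show ?thesis
  proof (cases "Y.growth_rate = 0")
    \<comment> \<open>Both rates then vanish, and the extended real quotient \<open>0 / 0\<close>
      equals 0, which is rational.\<close>
    case True
    then have "X.growth_rate = 0" using eq n by simp
    then show ?thesis unfolding X.topological_entropy_eq Y.topological_entropy_eq
      by (simp add: zero_ereal_def[symmetric] image_iff)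
  next
    case False
    then have "X.growth_rate / Y.growth_rate = real m / real n" using eq n by (simp add: field_simps)
    then have "X.growth_rate / Y.growth_rate \<in> \<rat>" by simp
    moreover have "ereal X.growth_rate / ereal Y.growth_rate = ereal (X.growth_rate / Y.growth_rate)" using False by simp
    ultimately show ?thesis unfolding X.topological_entropy_eq Y.topological_entropy_eq by simp
  qed
qed

end
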